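(* For real $s$ let $E_{2,s}(x)=\sum_{n=1}^{\infty}\frac{\sigma_1(n)}{n^s}\sin(2\pi n x)$, where $\sigma_1(n)=\sum_{d\mid n}d$. Let $x\in\mathbb{R}\setminus\mathbb{Q}$ and let $\gamma_{2,s}(x)$ be the H\"older regularity exponent of $E_{2,s}$ at $x$. Assume that $$s>2+\frac{2}{\nu(x)}-\frac{2}{\mu(x)}.$$ Then $\gamma_{2,s}(x)\geq s-2+\frac{2}{\mu(x)}$. Furthermore, if $a_n(x)\geq 7$ for infinitely many $n$, then $$\gamma_{2,s}(x)=s-2+\frac{2}{\mu(x)}.$$
   Context: H\"older regularity: for $f:\mathbb{R}\to\mathbb{R}$, $x_0\in\mathbb{R}$ and $\alpha>0$, $f\in C^{\alpha}(x_0)$ means there exist a polynomial $P$ of degree at most $[\alpha]$ and a constant $C$ with $|f(x)-P(x-x_0)|\leq C|x-x_0|^{\alpha}$ as $x\to x_0$; the H\"older regularity exponent of $f$ at $x_0$ is $\sup\{\beta: f\in C^{\beta}(x_0)\}$. For irrational $x=[a_0;a_1,a_2,\dots]$ (continued fraction, $a_n(x)$ the partial quotients) with convergents $\frac{p_n}{q_n}=[a_0;a_1,\dots,a_n]$, define $\kappa_n$ by $\big|x-\frac{p_n}{q_n}\big|=q_n^{-\kappa_n}$, and $\mu(x)=\limsup_{n}\kappa_n$, $\nu(x)=\liminf_{n}\kappa_n$, with the convention $\frac1\infty=0$. *)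

theory Defs
  imports "HOL-Analysis.Analysis" "HOL-Computational_Algebra.Polynomial"
begin

fun cf_complete :: "real \<Rightarrow> nat \<Rightarrow> real" where
  "cf_complete x 0 = x"
| "cf_complete x (Suc n) = 1 / frac (cf_complete x n)"

definition cf_quot :: "real \<Rightarrow> nat \<Rightarrow> int" where
  "cf_quot x n = \<lfloor>cf_complete x n\<rfloor>"

fun cf_num :: "real \<Rightarrow> nat \<Rightarrow> int" where
  "cf_num x 0 = cf_quot x 0"
| "cf_num x (Suc 0) = cf_quot x 1 * cf_quot x 0 + 1"
| "cf_num x (Suc (Suc n)) = cf_quot x (Suc (Suc n)) * cf_num x (Suc n) + cf_num x n"

fun cf_den :: "real \<Rightarrow> nat \<Rightarrow> int" where
  "cf_den x 0 = 1"
| "cf_den x (Suc 0) = cf_quot x 1"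
| "cf_den x (Suc (Suc n)) = cf_quot x (Suc (Suc n)) * cf_den x (Suc n) + cf_den x n"

text \<open>The lemmas \<open>cf_num_over_den\<close> and \<open>coprime_cf_num_den\<close> below confirm that
  \<open>cf_num x n / cf_den x n\<close> is \<open>[a\<^sub>0; a\<^sub>1, \<dots>, a\<^sub>n]\<close> in lowest terms.\<close>

fun cf_eval :: "real list \<Rightarrow> real" where
  "cf_eval [] = 0"
| "cf_eval [a] = a"
| "cf_eval (a # b # xs) = a + 1 / cf_eval (b # xs)"

lemma cf_complete_irrational: "x \<notin> \<rat> \<Longrightarrow> cf_complete x n \<notin> \<rat>"
proof (induction n)
  case (Suc n)
  show ?case
  proof
    assume "cf_complete x (Suc n) \<in> \<rat>"
    then have "1 / cf_complete x (Suc n) \<in> \<rat>" by (intro Rats_divide) auto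
    then have "frac (cf_complete x n) \<in> \<rat>" by simp
    then have "frac (cf_complete x n) + of_int \<lfloor>cf_complete x n\<rfloor> \<in> \<rat>"
      by (intro Rats_add) auto
    then show False using Suc by (simp add: frac_def)
  qed
qed simp

lemma cf_quot_pos:
  assumes "x \<notin> \<rat>" "n > 0"
  shows "cf_quot x n \<ge> 1"
proof -
  obtain m where m: "n = Suc m" using assms(2) gr0_implies_Suc by blast
  have "cf_complete x m \<notin> \<int>"
    using cf_complete_irrational[OF assms(1)] Ints_subset_Rats by blast
  then have "frac (cf_complete x m) > 0" by (simp add: frac_gt_0_iff)
  moreover have "frac (cf_complete x m) < 1" by (rule frac_lt_1)
  ultimately show ?thesis
    unfolding cf_quot_def m by (simp add: le_floor_iff)
qed

lemma cf_den_pos: "x \<notin> \<rat> \<Longrightarrow> cf_den x n > 0"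
proof (induction x n rule: cf_den.induct)
  case (2 x) then show ?case using cf_quot_pos[of x 1] by simp
next
  case (3 x n)
  then show ?case using cf_quot_pos[of x "Suc (Suc n)"] by (simp add: add_pos_pos)
qed simp

lemma cf_num_den_det:
  "cf_num x (Suc n) * cf_den x n - cf_num x n * cf_den x (Suc n) = (- 1) ^ n"
  by (induction n) (auto simp: algebra_simps)

lemma coprime_cf_num_den: "coprime (cf_num x n) (cf_den x n)"
proof (rule coprimeI)
  fix c assume "c dvd cf_num x n" "c dvd cf_den x n"
  then have "c dvd (- 1) ^ n" by (simp flip: cf_num_den_det[of x n])
  then show "is_unit c" by (cases "even n") simp_all
qed

lemma cf_eval_append2: "cf_eval (xs @ [u, t]) = cf_eval (xs @ [u + 1 / t])"
proof (induction xs)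
  case (Cons a xs) then show ?case by (cases xs) auto
qed simp

lemma cf_eval_append_num_den:
  assumes "x \<notin> \<rat>" "t > 0"
  shows "cf_eval (map (\<lambda>k. real_of_int (cf_quot x k)) [0..<Suc n] @ [t]) =
    (t * cf_num x n + (if n = 0 then 1 else cf_num x (n - 1))) /
    (t * cf_den x n + (if n = 0 then 0 else cf_den x (n - 1)))"
  using assms(2)
proof (induction n arbitrary: t)
  case 0 then show ?case by (simp add: field_simps)
next
  case (Suc n)
  let ?u = "real_of_int (cf_quot x (Suc n)) + 1 / t"
  let ?a = "\<lambda>k. real_of_int (cf_quot x k)"
  let ?P = "if n = 0 then 1 else cf_num x (n - 1)" and ?Q = "if n = 0 then 0 else cf_den x (n - 1)"
  have u: "?u > 0" using cf_quot_pos[OF assms(1), of "Suc n"] Suc.prems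
    by (simp add: add_pos_pos)
  have P: "cf_num x (Suc n) = cf_quot x (Suc n) * cf_num x n + ?P"
    and Q: "cf_den x (Suc n) = cf_quot x (Suc n) * cf_den x n + ?Q"
    by (cases n; simp)+
  have "cf_eval (map ?a [0..<Suc (Suc n)] @ [t]) = cf_eval (map ?a [0..<Suc n] @ [?u])"
    using cf_eval_append2[of "map ?a [0..<Suc n]" "?a (Suc n)" t] by simp
  also have "\<dots> = (?u * cf_num x n + ?P) / (?u * cf_den x n + ?Q)"
    using Suc.IH[OF u] by simp
  also have "\<dots> = (t * (?u * cf_num x n + ?P)) / (t * (?u * cf_den x n + ?Q))"
    using Suc.prems by simp
  also have "t * (?u * cf_num x n + ?P) = t * cf_num x (Suc n) + cf_num x n"
    using Suc.prems by (simp only: P) (simp add: field_simps)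
  also have "t * (?u * cf_den x n + ?Q) = t * cf_den x (Suc n) + cf_den x n"
    using Suc.prems by (simp only: Q) (simp add: field_simps)
  finally show ?case by simp
qed

lemma cf_num_over_den:
  assumes "x \<notin> \<rat>"
  shows "real_of_int (cf_num x n) / real_of_int (cf_den x n) =
    cf_eval (map (\<lambda>k. real_of_int (cf_quot x k)) [0..<Suc n])"
proof (cases n)
  case (Suc m)
  have "real_of_int (cf_quot x (Suc m)) > 0"
    using cf_quot_pos[OF assms, of "Suc m"] by simp
  from cf_eval_append_num_den[OF assms this, of m] show ?thesis
    by (cases m) (simp_all add: Suc)
qed simp

text \<open>The solution of \<open>\<bar>x - p\<^sub>n / q\<^sub>n\<bar> = q\<^sub>n powr (- \<kappa>\<^sub>n)\<close>.  It is a junk value when \<open>q\<^sub>n = 1\<close>, which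
  happens only for \<open>n \<le> 1\<close> and so does not affect \<open>limsup\<close> and \<open>liminf\<close>.\<close>

definition kappa :: "real \<Rightarrow> nat \<Rightarrow> real" where
  "kappa x n = - log (cf_den x n) \<bar>x - cf_num x n / cf_den x n\<bar>"

lemma kappa_eq:
  assumes "x \<notin> \<rat>" "cf_den x n > 1"
  shows "\<bar>x - cf_num x n / cf_den x n\<bar> = real_of_int (cf_den x n) powr (- kappa x n)"
proof -
  have "x \<noteq> cf_num x n / cf_den x n"
    using assms(1) by (metis Rats_divide Rats_of_int)
  then show ?thesis using assms(2) by (simp add: kappa_def)
qed

definition mu :: "real \<Rightarrow> ereal" where
  "mu x = limsup (\<lambda>n. ereal (kappa x n))"

definition nu :: "real \<Rightarrow> ereal" where
  "nu x = liminf (\<lambda>n. ereal (kappa x n))"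

definition holder_at :: "(real \<Rightarrow> real) \<Rightarrow> real \<Rightarrow> real \<Rightarrow> bool" where
  "holder_at f \<alpha> x0 \<longleftrightarrow>
     (\<exists>(P :: real poly) C. int (degree P) \<le> \<lfloor>\<alpha>\<rfloor> \<and>
        (\<forall>\<^sub>F x in nhds x0. \<bar>f x - poly P (x - x0)\<bar> \<le> C * \<bar>x - x0\<bar> powr \<alpha>))"

definition holder_exponent :: "(real \<Rightarrow> real) \<Rightarrow> real \<Rightarrow> ereal" where
  "holder_exponent f x0 = (SUP \<beta> \<in> {\<beta>. \<beta> > 0 \<and> holder_at f \<beta> x0}. ereal \<beta>)"

definition sigma1 :: "nat \<Rightarrow> nat" where
  "sigma1 n = (\<Sum>d | d dvd n. d)"

definition E2 :: "real \<Rightarrow> real \<Rightarrow> real" where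
  "E2 s x = (\<Sum>n. real (sigma1 (Suc n)) / real (Suc n) powr s * sin (2 * pi * real (Suc n) * x))"

end

theory Submission imports Defs "HOL-Complex_Analysis.Complex_Analysis" begin

text \<open>
  Write \<open>F(z) = \<Sum> \<sigma>\<^sub>1(n) e(n z)\<close> for \<open>Im z > 0\<close>, so that \<open>E\<^sub>2\<^sub>,\<^sub>s\<close> is the imaginary part of a Mellin transform of
  \<open>F\<close> along vertical lines.

  Lower bound of the exponent: by the Lambert series \<open>\<bar>F(b + i a)\<bar>\<close> is at most a sum over \<open>m\<close> of
  \<open>1 / (4 \<bar>sin (\<pi> m (b + i a))\<bar>\<^sup>2)\<close>. If \<open>\<bar>m x - k\<bar>\<close> is bounded below by a multiple of
  \<open>m powr (1 - r)\<close>, where \<open>r > \<mu>(x)\<close>, then the points \<open>m b\<close> with \<open>b\<close> near \<open>x\<close> are well spaced modulo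
  \<open>1\<close> on blocks of suitable length, which gains a factor \<open>R powr (2 / r)\<close> over the trivial bound
  \<open>O(a powr (-2))\<close> at distance \<open>R\<close> from \<open>x\<close>. Taylor expansion of \<open>F\<close> under the Mellin integral turns this
  into Hoelder regularity.

  Upper bound: Hoelder regularity of order \<open>\<beta>\<close> at \<open>x\<close> forces \<open>F(z) = O(Im z powr (\<beta> - s))\<close> in a cone with
  apex \<open>x\<close>, because \<open>F\<close> is the convolution of \<open>E\<^sub>2\<^sub>,\<^sub>s\<close> with the kernel \<open>\<Sum> n powr s e(n z)\<close>, whose
  moments against polynomials of degree below \<open>s\<close> stay bounded. On the other hand the modularity of
  \<open>E\<^sub>2(z) - 3 / (\<pi> Im z)\<close> transports the value at \<open>i t\<close>, where \<open>t\<close> is a complete quotient of \<open>x\<close> that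
  is at least \<open>7\<close>, to points of the cone at which \<open>F\<close> is too large if \<open>\<beta> > s - 2 + 2 / \<mu>(x)\<close>.
\<close>

section \<open>Partial fractions of the cotangent\<close>

text \<open>Weight 2 is the borderline case: the sum of \<open>1 / (m z + k)^2\<close> over the
  lattice converges only conditionally, its two orders of summation differ, and the term
  \<open>3 / (pi Im z)\<close> compensates exactly this difference. Once it is subtracted,
  \<open>Im z\<close> times the modulus of the completed series is invariant under translations,
  \<open>z\<close> to \<open>-1 / z\<close> and reflection, so a value at \<open>i t\<close> reaches
  a point beside \<open>x\<close> without loss. Some lower bound on \<open>t\<close> is essential,
  because the completed series vanishes at \<open>i\<close>; from \<open>7\<close> on its constant
  term clearly dominates \<open>1 / t\<close> and the q-series. Both halves meet at one exponent for
  this reason. At the transported point \<open>Im z\<close> is comparable to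
  \<open>1 / (q^2 t)\<close>, that is to \<open>q\<close> to the power \<open>- kappa\<close>, with
  \<open>q\<close> the denominator of the convergent. Since \<open>F\<close> has size at least a
  multiple of \<open>t / Im z\<close>, hence of \<open>1 / (q Im z)^2\<close>, it grows like
  \<open>Im z\<close> to the power \<open>-2 + 2 / kappa\<close>. The lower bound loses an
  arbitrarily small \<open>\<delta>\<close> and avoids integer orders; both are harmless because the
  exponent is a supremum.\<close>

lemma Digamma_reflection:
  fixes z :: complex
  assumes "z \<notin> \<int>"
  shows "Digamma (1 - z) - Digamma z = of_real pi * cot (of_real pi * z)"
proof -
  have z: "z \<notin> \<int>\<^sub>\<le>\<^sub>0" "1 - z \<notin> \<int>\<^sub>\<le>\<^sub>0" "sin (of_real pi * z) \<noteq> 0"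
    using assms nonpos_Ints_subset_Ints Ints_diff[of 1 "1 - z"] by (auto simp: sin_eq_0 mult.commute)
  \<comment> \<open>Logarithmic differentiation of Euler's reflection formula: the two sides are the
    same function, so the derivatives agree, and the nonzero product
    \<open>Gamma z * Gamma (1 - z)\<close> cancels.\<close>
  have "((\<lambda>z. Gamma z * Gamma (1 - z)) has_field_derivative
      Gamma z * Gamma (1 - z) * (Digamma z - Digamma (1 - z))) (at z)"
    using z by (auto intro!: derivative_eq_intros simp: algebra_simps)
  moreover have "((\<lambda>z. of_real pi / sin (of_real pi * z)) has_field_derivative
      (of_real pi / sin (of_real pi * z)) * (- of_real pi * cot (of_real pi * z))) (at z)"
    using z by (auto intro!: derivative_eq_intros simp: cot_def field_simps)
  ultimately have "Gamma z * Gamma (1 - z) * (Digamma z - Digamma (1 - z)) =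
      Gamma z * Gamma (1 - z) * (- of_real pi * cot (of_real pi * z))"
    unfolding Gamma_reflection_complex by (rule DERIV_unique)
  moreover have "Gamma z * Gamma (1 - z) \<noteq> 0" using z by (simp add: Gamma_eq_zero_iff)
  ultimately have "Digamma z - Digamma (1 - z) = - of_real pi * cot (of_real pi * z)"
    using mult_left_cancel by blast
  then show ?thesis by (simp add: algebra_simps)
qed

text \<open>\<open>Digamma_reflection\<close> differentiated once more, which is legitimate because
  the complement of the integers is open.\<close>

lemma Polygamma_1_reflection:
  fixes z :: complex
  assumes "z \<notin> \<int>"
  shows "Polygamma 1 z + Polygamma 1 (1 - z) = (of_real pi / sin (of_real pi * z))\<^sup>2"
proof -
  have nz: "w \<notin> \<int>\<^sub>\<le>\<^sub>0" "1 - w \<notin> \<int>\<^sub>\<le>\<^sub>0" "sin (of_real pi * w) \<noteq> 0" if "w \<notin> \<int>" for w :: complex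
    using that nonpos_Ints_subset_Ints Ints_diff[of 1 "1 - w"] by (auto simp: sin_eq_0 mult.commute)
  have "((\<lambda>z. Digamma (1 - z) - Digamma z) has_field_derivative
      - Polygamma 1 (1 - z) - Polygamma 1 z) (at z)"
    using nz[OF assms] by (auto intro!: derivative_eq_intros)
  moreover have "((\<lambda>z. of_real pi * cot (of_real pi * z)) has_field_derivative
      of_real pi * (- inverse (sin (of_real pi * z) ^ 2) * of_real pi)) (at z)"
    using nz[OF assms] by (auto intro!: derivative_eq_intros DERIV_cot[THEN DERIV_chain2])
  then have "((\<lambda>z. Digamma (1 - z) - Digamma z) has_field_derivative
      of_real pi * (- inverse (sin (of_real pi * z) ^ 2) * of_real pi)) (at z)"
    by (rule has_field_derivative_transform_within_open[where S="- \<int>"])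
       (use assms in \<open>auto simp: Digamma_reflection open_Compl\<close>)
  ultimately have "- Polygamma 1 (1 - z) - Polygamma 1 z = of_real pi * (- inverse (sin (of_real pi * z) ^ 2) * of_real pi)"
    by (rule DERIV_unique)
  then show ?thesis by (simp add: power2_eq_square field_simps)
qed

text \<open>The negative integers are enumerated as \<open>- n - 1\<close>, so that \<open>0\<close>
  is counted once.\<close>

lemma has_sum_int_split:
  fixes f :: "int \<Rightarrow> 'a :: {topological_comm_monoid_add}"
  assumes "((\<lambda>n. f (int n)) has_sum a) UNIV" "((\<lambda>n. f (- int n - 1)) has_sum b) UNIV"
  shows "(f has_sum (a + b)) UNIV"
proof -
  have "bij_betw int UNIV {0..}" by (rule bij_betwI[where g=nat]) auto
  then have 1: "(f has_sum a) {0..}"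
    using assms(1) has_sum_reindex_bij_betw by blast
  have "bij_betw (\<lambda>n. - int n - 1) UNIV {..<0}"
    by (rule bij_betwI[where g="\<lambda>k. nat (- k - 1)"]) auto
  then have 2: "(f has_sum b) {..<0}"
    using assms(2) has_sum_reindex_bij_betw[of "\<lambda>n. - int n - 1" UNIV "{..<0}" f b] by blast
  have "{0..} \<union> {..<0} = (UNIV :: int set)" by auto
  moreover have "(f has_sum (a + b)) ({0..} \<union> {..<0})"
    by (rule has_sum_Un_disjoint[OF 1 2]) auto
  ultimately show ?thesis by simp
qed

lemma summable_inverse_square_shift:
  fixes w :: complex
  shows "summable (\<lambda>n. norm (1 / (w + of_nat n)\<^sup>2))"
proof (rule summable_comparison_test_ev)
  show "\<forall>\<^sub>F n in sequentially. norm (norm (1 / (w + of_nat n)\<^sup>2)) \<le> 4 * (1 / real n ^ 2)"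
  proof (rule eventually_sequentiallyI)
    fix n assume n: "n \<ge> nat \<lceil>2 * norm w\<rceil> + 1"
    then have "real n \<ge> 2 * norm w" "n > 0" by linarith+
    moreover have "real n - norm w \<le> norm (w + of_nat n)"
      using norm_triangle_ineq4[of "w + of_nat n" w] by simp
    ultimately have "norm (w + of_nat n) \<ge> real n / 2" by linarith
    then have "norm (w + of_nat n) ^ 2 \<ge> (real n / 2) ^ 2" by (rule power_mono) simp
    moreover have "(real n / 2) ^ 2 > 0" using \<open>n > 0\<close> by simp
    ultimately have "1 / norm (w + of_nat n) ^ 2 \<le> 1 / (real n / 2) ^ 2"
      by (intro divide_left_mono mult_pos_pos) linarith+
    then show "norm (norm (1 / (w + of_nat n)\<^sup>2)) \<le> 4 * (1 / real n ^ 2)"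
      by (simp add: norm_divide norm_power power_divide)
  qed
  show "summable (\<lambda>n. 4 * (1 / real n ^ 2))"
    by (intro summable_mult) (use inverse_power_summable[of 2, where ?'a=real] in \<open>simp add: divide_inverse\<close>)
qed

text \<open>Each half of the integers contributes a trigamma series, \<open>Polygamma 1 w\<close>
  and \<open>Polygamma 1 (1 - w)\<close>, and the reflection formula adds them.\<close>

lemma has_sum_int_inverse_square:
  fixes w :: complex
  assumes "w \<notin> \<int>"
  shows "((\<lambda>k::int. 1 / (w + of_int k)\<^sup>2) has_sum (of_real pi / sin (of_real pi * w))\<^sup>2) UNIV"
proof -
  have P: "((\<lambda>n. 1 / (u + of_nat n)\<^sup>2) has_sum Polygamma 1 u) UNIV" for u :: complex
  proof -
    have "(\<lambda>n. 1 / (u + of_nat n)\<^sup>2) sums Polygamma 1 u"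
      using summable_sums[OF summable_norm_cancel[OF summable_inverse_square_shift[of u]]]
      by (simp add: Polygamma_def divide_inverse numeral_2_eq_2)
    then show ?thesis
      by (rule norm_summable_imp_has_sum[OF summable_inverse_square_shift])
  qed
  have "((\<lambda>n. 1 / (w + of_int (- int n - 1))\<^sup>2) has_sum Polygamma 1 (1 - w)) UNIV"
  proof -
    have "(w + of_int (- int n - 1))\<^sup>2 = ((1 - w) + of_nat n)\<^sup>2" for n
      by (simp add: power2_eq_square algebra_simps)
    then show ?thesis using P[of "1 - w"] by simp
  qed
  with P[of w] have "((\<lambda>k::int. 1 / (w + of_int k)\<^sup>2) has_sum Polygamma 1 w + Polygamma 1 (1 - w)) UNIV"
    by (intro has_sum_int_split) simp_all
  then show ?thesis using Polygamma_1_reflection[OF assms] by simp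
qed

text \<open>This series converges only conditionally, hence the limit of symmetric partial sums. The
  logarithms in the limit formulas for \<open>Digamma w\<close> and \<open>Digamma (1 - w)\<close>
  cancel.\<close>

lemma cot_partial_fractions:
  fixes w :: complex
  assumes "w \<notin> \<int>"
  shows "(\<lambda>M. (\<Sum>n<M. 1 / (w + of_nat n)) + (\<Sum>n<M. 1 / (w - of_nat n - 1))) \<longlonglongrightarrow> of_real pi * cot (of_real pi * w)"
proof -
  have z: "w \<notin> \<int>\<^sub>\<le>\<^sub>0" "1 - w \<notin> \<int>\<^sub>\<le>\<^sub>0"
    using assms nonpos_Ints_subset_Ints Ints_diff[of 1 "1 - w"] by auto
  then have nz: "w \<noteq> 0" "1 - w \<noteq> 0" by auto
  have "(\<lambda>m. (of_real (ln (real m)) - (\<Sum>n<m. inverse ((1 - w) + of_nat n))) - (of_real (ln (real m)) - (\<Sum>n<m. inverse (w + of_nat n)))) \<longlonglongrightarrow> Digamma (1 - w) - Digamma w"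
    by (intro tendsto_diff Digamma_LIMSEQ nz)
  moreover have "inverse ((1 - w) + of_nat n) = - (1 / (w - of_nat n - 1))" for n
    by (metis (no_types, lifting) inverse_eq_divide minus_diff_eq minus_divide_right add.commute diff_add_eq_diff_diff_swap diff_diff_eq2 add_diff_eq diff_diff_add)
  ultimately show ?thesis
    using Digamma_reflection[OF assms] by (simp add: sum_negf inverse_eq_divide add.commute)
qed

section \<open>The Eisenstein series of weight 2\<close>

text \<open>The imaginary part of \<open>m z + k\<close> controls \<open>m\<close>, and then the
  triangle inequality controls \<open>k\<close>. The summand \<open>1\<close> is affordable because
  a nonzero integer pair has an entry of modulus at least \<open>1\<close>.\<close>

lemma lattice_point_bounds:
  fixes z :: complex
  assumes "Im z > 0"
  shows "\<exists>K>0. \<forall>m k. (m, k) \<noteq> (0, 0) \<longrightarrow> 1 + \<bar>real_of_int m\<bar> \<le> K * norm (of_int m * z + of_int k)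
    \<and> 1 + \<bar>real_of_int k\<bar> \<le> K * norm (of_int m * z + of_int k)"
proof -
  define K where "K = 1 + (1 + norm z) / Im z"
  have K: "K > 0" unfolding K_def using assms by (intro add_pos_nonneg) auto
  have m: "\<bar>real_of_int m\<bar> \<le> K * norm (of_int m * z + of_int k)" for m k
  proof -
    have "\<bar>real_of_int m\<bar> * Im z = \<bar>Im (of_int m * z + of_int k)\<bar>" using assms by (simp add: abs_mult)
    also have "\<dots> \<le> norm (of_int m * z + of_int k)" by (rule abs_Im_le_cmod)
    finally have "\<bar>real_of_int m\<bar> \<le> norm (of_int m * z + of_int k) / Im z"
      using assms by (simp add: pos_le_divide_eq)
    also have "\<dots> \<le> K * norm (of_int m * z + of_int k)"
      unfolding K_def using assms by (simp add: field_simps)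
    finally show ?thesis .
  qed
  have k: "\<bar>real_of_int k\<bar> \<le> K * norm (of_int m * z + of_int k)" for m k
  proof -
    have "\<bar>real_of_int m\<bar> * Im z = \<bar>Im (of_int m * z + of_int k)\<bar>" using assms by (simp add: abs_mult)
    also have "\<dots> \<le> norm (of_int m * z + of_int k)" by (rule abs_Im_le_cmod)
    finally have *: "\<bar>real_of_int m\<bar> \<le> norm (of_int m * z + of_int k) / Im z"
      using assms by (simp add: pos_le_divide_eq)
    have "\<bar>real_of_int k\<bar> = norm ((of_int m * z + of_int k) - of_int m * z)" by simp
    also have "\<dots> \<le> norm (of_int m * z + of_int k) + norm (of_int m * z)" by (rule norm_triangle_ineq4)
    also have "\<dots> = norm (of_int m * z + of_int k) + \<bar>real_of_int m\<bar> * norm z" by (simp add: norm_mult)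
    also have "\<dots> \<le> norm (of_int m * z + of_int k) + (norm (of_int m * z + of_int k) / Im z) * norm z"
      using * by (intro add_left_mono mult_right_mono) auto
    also have "\<dots> \<le> K * norm (of_int m * z + of_int k)"
      unfolding K_def using assms by (simp add: field_simps)
    finally show ?thesis .
  qed
  have one: "1 \<le> K * norm (of_int m * z + of_int k)" if "(m, k) \<noteq> (0, 0)" for m k :: int
  proof (cases "m = 0")
    case True then have "k \<noteq> 0" using that by auto
    then have "1 \<le> \<bar>real_of_int k\<bar>" by linarith
    then show ?thesis using k[of k m] by linarith
  next
    case False then have "1 \<le> \<bar>real_of_int m\<bar>" by linarith
    then show ?thesis using m[of m k] by linarith
  qed
  show ?thesis
  proof (intro exI[of _ "2 * K"] conjI allI impI)
    fix m k :: int assume "(m, k) \<noteq> (0, 0)"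
    then show "1 + \<bar>real_of_int m\<bar> \<le> 2 * K * norm (of_int m * z + of_int k)"
      "1 + \<bar>real_of_int k\<bar> \<le> 2 * K * norm (of_int m * z + of_int k)"
      using one[of m k] m[of m k] k[of k m] by linarith+
  qed (use K in simp)
qed

text \<open>The summand of the conditionally convergent Eisenstein series of weight 2, minus a telescoping
  term; the difference is \<open>1 / (w\<^sup>2 (w + 1))\<close> off the junk values \<open>w = 0, -1\<close>.\<close>

definition eis_diff :: "complex \<Rightarrow> int \<Rightarrow> int \<Rightarrow> complex" where
  "eis_diff z m k = 1 / (of_int m * z + of_int k)\<^sup>2 -
     (1 / (of_int m * z + of_int k) - 1 / (of_int m * z + of_int (k + 1)))"

lemma summable_int_three_halves: "(\<lambda>m::int. (1 + \<bar>real_of_int m\<bar>) powr (-3/2)) summable_on UNIV"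
proof -
  have 1: "(\<lambda>n. (1 + real n) powr (-3/2)) summable_on UNIV"
    using summable_Suc_iff[of "\<lambda>n. real n powr (-3/2)"]
    by (subst summable_on_UNIV_nonneg_real_iff) (auto simp: summable_real_powr_iff)
  have 2: "(\<lambda>n. (2 + real n) powr (-3/2)) summable_on UNIV"
    by (rule summable_on_comparison_test[OF 1]) (auto intro: powr_mono2')
  have "\<bar>- real n - 1\<bar> = 1 + real n" for n by linarith
  then show ?thesis
    using has_sum_int_split[of "\<lambda>m. (1 + \<bar>real_of_int m\<bar>) powr (-3/2)", simplified] has_sum_infsum[OF 1] has_sum_infsum[OF 2]
    unfolding summable_on_def by (auto simp flip: add.assoc)
qed

text \<open>Away from two exceptional points the term is \<open>1 / (w^2 (w + 1))\<close>, of the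
  order of an inverse cube of the lattice norm. The cube is shared evenly between \<open>m\<close>
  and \<open>k\<close>; the resulting exponent \<open>3/2\<close> exceeds \<open>1\<close> in each
  variable, so the product is summable.\<close>

lemma eis_diff_bound:
  assumes "Im z > 0"
  shows "\<exists>C. \<forall>m k. norm (eis_diff z m k) \<le>
    C * ((1 + \<bar>real_of_int m\<bar>) powr (-3/2) * (1 + \<bar>real_of_int k\<bar>) powr (-3/2))"
proof -
  obtain K where K1: "K > 0" and K': "\<forall>m k. (m, k) \<noteq> (0, 0) \<longrightarrow>
      1 + \<bar>real_of_int m\<bar> \<le> K * norm (of_int m * z + of_int k) \<and>
      1 + \<bar>real_of_int k\<bar> \<le> K * norm (of_int m * z + of_int k)"
    using lattice_point_bounds[OF assms] by blast
  have K: "K > 0"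
    "1 + \<bar>real_of_int m\<bar> \<le> K * norm (of_int m * z + of_int k)"
    "1 + \<bar>real_of_int k\<bar> \<le> K * norm (of_int m * z + of_int k)" if "(m, k) \<noteq> (0, 0)" for m k
    using K1 K'[rule_format, OF that] by simp_all
  let ?b = "\<lambda>m k. (1 + \<bar>real_of_int m\<bar>) powr (-3/2) * (1 + \<bar>real_of_int k\<bar>) powr (-3/2)"
  have gen: "norm (eis_diff z m k) \<le> (2 * K) ^ 3 * ?b m k" if "(m, k) \<noteq> (0, 0)" "(m, k) \<noteq> (0, -1)" for m k
  proof -
    define w where "w = of_int m * z + of_int k"
    define a b where "a = 1 + \<bar>real_of_int m\<bar>" and "b = 1 + \<bar>real_of_int k\<bar>"
    have ab: "a > 0" "b > 0" by (auto simp: a_def b_def)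
    have w1: "of_int m * z + of_int (k + 1) = w + 1" by (simp add: w_def)
    have A: "a \<le> 2 * K * norm w" "b \<le> 2 * K * norm w"
      using K(2)[OF that(1)] K(3)[OF that(1)] ab unfolding w_def[symmetric] a_def[symmetric] b_def[symmetric]
      by linarith+
    have ne: "(m, k + 1) \<noteq> (0, 0)" using that(2) by auto
    have "a \<le> K * norm (w + 1)" using K(2)[OF ne] unfolding w1 a_def .
    moreover have "1 + \<bar>real_of_int (k + 1)\<bar> \<le> K * norm (w + 1)" using K(3)[OF ne] unfolding w1 .
    moreover have "b \<le> 2 * (1 + \<bar>real_of_int (k + 1)\<bar>)" unfolding b_def by (smt (verit) of_int_1 of_int_add)
    ultimately have "a \<le> K * norm (w + 1)" "b \<le> 2 * (K * norm (w + 1))" "0 < K * norm (w + 1)"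
      using ab(1) by (fastforce intro: order_trans, meson order_trans mult_left_mono zero_le_numeral, argo)
    then have B: "a \<le> 2 * K * norm (w + 1)" "b \<le> 2 * K * norm (w + 1)"
      by linarith+
    have nz: "w \<noteq> 0" "w + 1 \<noteq> 0" using A B ab by auto
    have "eis_diff z m k = 1 / (w\<^sup>2 * (w + 1))"
    proof -
      have "1 / w\<^sup>2 - (1 / w - 1 / v) = 1 / (w\<^sup>2 * v)" if "v \<noteq> 0" "v = w + 1" for v
        using nz(1) that(1) by (simp add: divide_simps power2_eq_square) (simp add: that(2) algebra_simps)
      then show ?thesis unfolding eis_diff_def w1 w_def[symmetric] using nz(2) by blast
    qed
    then have e: "norm (eis_diff z m k) = 1 / (norm w ^ 2 * norm (w + 1))"
      by (simp add: norm_divide norm_mult norm_power)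
    \<comment> \<open>The fractional power is avoided by proving the squared inequality: three
      factors \<open>a\<close> and three factors \<open>b\<close> are matched with four factors
      \<open>norm w\<close> and two factors \<open>norm (w + 1)\<close>.\<close>
    have "(a * b) * ((a * b) * (a * b)) \<le> ((2 * K * norm w) * (2 * K * norm w)) * (((2 * K * norm w) * (2 * K * norm w)) * ((2 * K * norm (w + 1)) * (2 * K * norm (w + 1))))"
      using ab A B K1 by (intro mult_mono mult_nonneg_nonneg) auto
    also have "\<dots> = ((2 * K) ^ 3 * (norm w ^ 2 * norm (w + 1))) ^ 2"
      by (simp add: power2_eq_square power3_eq_cube algebra_simps)
    finally have "(a * b) ^ 3 \<le> ((2 * K) ^ 3 * (norm w ^ 2 * norm (w + 1))) ^ 2"
      by (simp add: power3_eq_cube mult.assoc)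
    moreover have "(a * b) ^ 3 = ((a * b) powr (3/2)) ^ 2"
      using ab powr_realpow[of "a * b" 3] powr_realpow[of "(a * b) powr (3/2)" 2] by (simp add: powr_powr)
    ultimately have "(a * b) powr (3/2) \<le> (2 * K) ^ 3 * (norm w ^ 2 * norm (w + 1))"
      using K1 by (intro power2_le_imp_le[of "(a * b) powr (3/2)"]) auto
    then have "1 / (norm w ^ 2 * norm (w + 1)) \<le> (2 * K) ^ 3 * (1 / (a * b) powr (3/2))"
      using nz ab by (simp add: field_simps)
    also have "1 / (a * b) powr (3/2) = a powr (-3/2) * b powr (-3/2)"
      using ab by (simp add: powr_mult powr_minus field_simps)
    finally show ?thesis unfolding e a_def b_def .
  qed
  \<comment> \<open>At \<open>(0, 0)\<close> and \<open>(0, -1)\<close> a denominator vanishes and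
    division by zero yields \<open>0\<close>. These two values are absorbed into the constant;
    \<open>2 powr (3/2)\<close> undoes the weight at \<open>k = -1\<close>.\<close>
  define C where "C = (2 * K) ^ 3 + norm (eis_diff z 0 0) + norm (eis_diff z 0 (-1)) * 2 powr (3/2)"
  have "norm (eis_diff z m k) \<le> C * ?b m k" for m k
  proof (cases "(m, k) = (0, 0) \<or> (m, k) = (0, -1)")
    case True
    have "(2 * K) ^ 3 + norm (eis_diff z 0 (-1)) * 2 powr (3/2) \<ge> 0" using K1 by (intro add_nonneg_nonneg) auto
    moreover have "2 powr (3/2) * 2 powr (-(3/2)) = (1::real)" by (simp flip: powr_add)
    then have e: "x * 2 powr (3/2) * 2 powr (-(3/2)) = x" for x :: real
      by (simp add: mult.assoc)
    moreover have "((2 * K) ^ 3 + norm (eis_diff z 0 0)) * 2 powr (-3/2) \<ge> 0"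
      using K1 by (intro mult_nonneg_nonneg add_nonneg_nonneg) auto
    ultimately show ?thesis using True unfolding C_def by (auto simp: distrib_right e)
  next
    case False
    then have "norm (eis_diff z m k) \<le> (2 * K) ^ 3 * ?b m k" by (intro gen) auto
    also have "\<dots> \<le> C * ?b m k" unfolding C_def by (intro mult_right_mono) auto
    finally show ?thesis .
  qed
  then show ?thesis by blast
qed

lemma eis_diff_summable:
  assumes "Im z > 0"
  shows "(\<lambda>(m, k). eis_diff z m k) summable_on (UNIV \<times> UNIV)"
proof -
  obtain C where C: "\<forall>m k. norm (eis_diff z m k) \<le>
    C * ((1 + \<bar>real_of_int m\<bar>) powr (-3/2) * (1 + \<bar>real_of_int k\<bar>) powr (-3/2))"
    using eis_diff_bound[OF assms] ..
  let ?g = "\<lambda>m::int. (1 + \<bar>real_of_int m\<bar>) powr (-3/2)"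
  have "(\<lambda>(m, k). ?g m * ?g k) summable_on (UNIV \<times> UNIV)"
  proof (rule summable_on_SigmaI[where g="\<lambda>m. ?g m * infsum ?g UNIV"])
    show "((\<lambda>k. case (m, k) of (m, k) \<Rightarrow> ?g m * ?g k) has_sum ?g m * infsum ?g UNIV) UNIV" for m
      unfolding prod.case by (rule has_sum_cmult_right[OF has_sum_infsum[OF summable_int_three_halves]])
    show "(\<lambda>m. ?g m * infsum ?g UNIV) summable_on UNIV"
      by (rule summable_on_cmult_left[OF summable_int_three_halves])
  qed auto
  then have "(\<lambda>p. C * (case p of (m, k) \<Rightarrow> ?g m * ?g k)) summable_on (UNIV \<times> UNIV)"
    by (rule summable_on_cmult_right)
  then show ?thesis
    by (rule abs_summable_summable[OF Infinite_Sum.abs_summable_on_comparison_test'[where f="\<lambda>(m, k). eis_diff z m k"]])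
       (use C in auto)
qed

text \<open>Lets an unconditional sum be evaluated along the same half-open symmetric ranges for
  which the telescoping sums and the cotangent limit are available.\<close>

lemma has_sum_int_symmetric:
  fixes f :: "int \<Rightarrow> 'a :: {topological_comm_monoid_add}"
  assumes "(f has_sum S) UNIV"
  shows "(\<lambda>N. \<Sum>k\<in>{- int N..<int N}. f k) \<longlonglongrightarrow> S"
proof -
  have "filterlim (\<lambda>N. {- int N..<int N}) (finite_subsets_at_top UNIV) sequentially"
  proof (subst filterlim_finite_subsets_at_top, intro allI impI)
    fix X :: "int set" assume X: "finite X \<and> X \<subseteq> UNIV"
    show "\<forall>\<^sub>F N in sequentially. finite {- int N..<int N} \<and> X \<subseteq> {- int N..<int N} \<and> {- int N..<int N} \<subseteq> UNIV"
    proof (rule eventually_sequentiallyI)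
      fix N assume N: "N \<ge> nat (\<Sum>x\<in>X. \<bar>x\<bar>) + 1"
      have "x \<in> {- int N..<int N}" if "x \<in> X" for x
      proof -
        have "\<bar>x\<bar> \<le> (\<Sum>x\<in>X. \<bar>x\<bar>)" using X that by (intro member_le_sum) auto
        then show ?thesis using N by auto
      qed
      then show "finite {- int N..<int N} \<and> X \<subseteq> {- int N..<int N} \<and> {- int N..<int N} \<subseteq> UNIV" by auto
    qed
  qed
  then show ?thesis
    using assms unfolding has_sum_def by (rule filterlim_compose[rotated])
qed

lemma sum_int_symmetric_split:
  "(\<Sum>k\<in>{- int N..<int N}. f k) = (\<Sum>n<N. f (int n)) + (\<Sum>n<N. f (- int n - 1))"
proof (induction N)
  case (Suc N)
  have "{- int (Suc N)..<int (Suc N)} = insert (int N) (insert (- int N - 1) {- int N..<int N})" by auto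
  then show ?case using Suc by (simp add: ac_simps)
qed simp

lemma sum_int_symmetric_telescope:
  fixes f :: "int \<Rightarrow> 'a :: ab_group_add"
  shows "(\<Sum>k\<in>{- int N..<int N}. f k - f (k + 1)) = f (- int N) - f (int N)"
proof (induction N)
  case (Suc N)
  have "{- int (Suc N)..<int (Suc N)} = insert (int N) (insert (- int N - 1) {- int N..<int N})" by auto
  moreover have "- int N - 1 = - 1 - int N" by simp
  ultimately show ?case using Suc by (simp only: sum.insert finite_insert finite_atLeastLessThan_int) (simp add: algebra_simps)
qed simp

lemma Im_multiple_not_Ints:
  assumes "Im z \<noteq> 0" "m \<noteq> 0"
  shows "of_int m * z \<notin> \<int>" "of_int m / z \<notin> \<int>"
proof -
  have i: "Im w = 0" if "w \<in> \<int>" for w :: complex using that by (auto simp: Ints_def)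
  show "of_int m * z \<notin> \<int>"
    using i[of "of_int m * z"] assms by auto
  show "of_int m / z \<notin> \<int>"
    using i[of "of_int m / z"] assms by (auto simp: Im_divide complex_eq_iff)
qed

text \<open>For integral \<open>w\<close> one summand is \<open>1 / 0 = 0\<close>, which is the
  usual omission of the origin; thus \<open>eis_row 0\<close> is \<open>2 zeta(2)\<close>.\<close>

definition eis_row :: "complex \<Rightarrow> complex" where
  "eis_row w = (\<Sum>\<^sub>\<infinity>k::int. 1 / (w + of_int k)\<^sup>2)"

text \<open>Eisenstein's order of summation. In the normalisation with constant term
  \<open>1\<close> this is \<open>(pi^2 / 3) E_2\<close>.\<close>

definition eis2 :: "complex \<Rightarrow> complex" where
  "eis2 z = (\<Sum>\<^sub>\<infinity>m::int. eis_row (of_int m * z))"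

lemma eis_row_eq: "w \<notin> \<int> \<Longrightarrow> eis_row w = (of_real pi / sin (of_real pi * w))\<^sup>2"
  unfolding eis_row_def by (rule infsumI[OF has_sum_int_inverse_square])

lemma has_sum_minus:
  fixes f g :: "'a \<Rightarrow> 'b :: topological_ab_group_add"
  assumes "(f has_sum a) A" "(g has_sum b) A"
  shows "((\<lambda>x. f x - g x) has_sum (a - b)) A"
proof -
  have "((\<lambda>x. - g x) has_sum (- b)) A" using assms(2) by (simp add: has_sum_uminus)
  then show ?thesis using has_sum_add[OF assms(1)] by fastforce
qed

lemma eis_row_0_sums: "((\<lambda>k::int. 1 / (of_int k :: complex)\<^sup>2) has_sum of_real (pi\<^sup>2 / 3)) UNIV"
proof -
  have 1: "((\<lambda>n. complex_of_real (1 / real (Suc n) ^ 2)) has_sum of_real (pi\<^sup>2 / 6)) UNIV"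
    using norm_summable_imp_has_sum[OF _ inverse_squares_sums] inverse_squares_sums
    by (subst has_sum_of_real_iff) (auto simp: sums_iff)
  then have "((\<lambda>n. complex_of_real (1 / real n ^ 2)) has_sum of_real (pi\<^sup>2 / 6)) (range Suc)"
    by (subst has_sum_reindex) (auto simp: o_def)
  then have 0: "((\<lambda>n. complex_of_real (1 / real n ^ 2)) has_sum of_real (pi\<^sup>2 / 6)) UNIV"
    by (rule has_sum_cong_neutral[THEN iffD1, rotated -1]) (auto simp: image_iff, metis not0_implies_Suc)
  have "((\<lambda>k::int. 1 / (of_int k :: complex)\<^sup>2) has_sum of_real (pi\<^sup>2 / 6) + of_real (pi\<^sup>2 / 6)) UNIV"
  proof (rule has_sum_int_split)
    have "(- complex_of_nat n - 1)\<^sup>2 = (1 + of_nat n)\<^sup>2" for n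
      by (simp add: power2_eq_square algebra_simps)
    then show "((\<lambda>n. 1 / (of_int (- int n - 1) :: complex)\<^sup>2) has_sum of_real (pi\<^sup>2 / 6)) UNIV"
      using 1 by simp
  qed (use 0 in simp)
  then show ?thesis by (simp flip: of_real_add)
qed

lemma eis_row_0: "eis_row 0 = of_real (pi\<^sup>2 / 3)"
  unfolding eis_row_def by (rule infsumI) (use eis_row_0_sums in simp)

lemma eis_row_minus: "eis_row (- w) = eis_row w"
proof -
  have "eis_row (- w) = (\<Sum>\<^sub>\<infinity>k\<in>range uminus. 1 / (- w + of_int k)\<^sup>2)"
    unfolding eis_row_def by simp
  also have "\<dots> = (\<Sum>\<^sub>\<infinity>k::int. 1 / (- w + of_int (- k))\<^sup>2)"
    by (subst infsum_reindex[OF inj_uminus]) (simp only: o_def)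
  also have "\<dots> = (\<Sum>\<^sub>\<infinity>k::int. 1 / (w + of_int k)\<^sup>2)"
    by (intro infsum_cong) (simp add: power2_eq_square algebra_simps)
  finally show ?thesis unfolding eis_row_def .
qed

lemma eis_row_has_sum: 
  assumes "Im z \<noteq> 0"
  shows "((\<lambda>k::int. 1 / (of_int m * z + of_int k)\<^sup>2) has_sum eis_row (of_int m * z)) UNIV"
proof (cases "m = 0")
  case True then show ?thesis using eis_row_0_sums unfolding eis_row_0[symmetric] by simp
next
  case False
  then show ?thesis
    using has_sum_int_inverse_square eis_row_eq Im_multiple_not_Ints(1)[OF assms] by metis
qed

text \<open>Along a row the subtracted part telescopes, and its boundary terms
  \<open>1 / (m z - N)\<close> and \<open>1 / (m z + N)\<close> tend to \<open>0\<close>. The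
  default values cause no trouble, since \<open>eis_diff\<close> is literally the square term minus
  the telescoping difference.\<close>

lemma eis_diff_row:
  assumes "Im z > 0"
  shows "(\<Sum>\<^sub>\<infinity>k. eis_diff z m k) = eis_row (of_int m * z)"
proof -
  let ?g = "\<lambda>k. 1 / (of_int m * z + of_int k)"
  have s1: "eis_diff z m summable_on UNIV"
    by (rule summable_on_SigmaD1[OF eis_diff_summable[OF assms]]) auto
  have s2: "((\<lambda>k. 1 / (of_int m * z + of_int k)\<^sup>2) has_sum eis_row (of_int m * z)) UNIV"
    using assms by (intro eis_row_has_sum) auto
  have e: "1 / (of_int m * z + of_int k)\<^sup>2 - eis_diff z m k = ?g k - ?g (k + 1)" for k
    by (simp add: eis_diff_def)
  have d: "((\<lambda>k. ?g k - ?g (k + 1)) has_sum (eis_row (of_int m * z) - (\<Sum>\<^sub>\<infinity>k. eis_diff z m k))) UNIV"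
    using has_sum_minus[OF s2 has_sum_infsum[OF s1]] unfolding e .
  have "(\<lambda>N. ?g (- int N) - ?g (int N)) \<longlonglongrightarrow> eis_row (of_int m * z) - (\<Sum>\<^sub>\<infinity>k. eis_diff z m k)"
    using has_sum_int_symmetric[OF d] unfolding sum_int_symmetric_telescope[of ?g] .
  moreover have "(\<lambda>N. ?g (- int N) - ?g (int N)) \<longlonglongrightarrow> 0 - 0"
  proof (rule tendsto_diff)
    have "filterlim (\<lambda>N. complex_of_nat N) at_infinity sequentially" by (rule tendsto_of_nat)
    then show "(\<lambda>N. ?g (int N)) \<longlonglongrightarrow> 0"
      by (intro tendsto_divide_0[OF tendsto_const]) (auto intro: tendsto_add_filterlim_at_infinity)
    have "filterlim (\<lambda>N. - complex_of_nat N) at_infinity sequentially"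
      using tendsto_of_nat[where ?'a=complex] by (simp add: filterlim_at_infinity_conv_norm_at_top)
    then show "(\<lambda>N. ?g (- int N)) \<longlonglongrightarrow> 0"
      by (intro tendsto_divide_0[OF tendsto_const])
         (use tendsto_add_filterlim_at_infinity[OF tendsto_const] in fastforce)
  qed
  ultimately show ?thesis using LIMSEQ_unique by fastforce
qed

text \<open>The symmetric sum of \<open>1 / (m z + k)\<close> over \<open>m\<close>. For
  \<open>k = 0\<close> the terms \<open>m\<close> and \<open>- m\<close> cancel and
  \<open>m = 0\<close> contributes the default \<open>0\<close>, hence the separate value.\<close>

definition eis_cot :: "complex \<Rightarrow> int \<Rightarrow> complex" where
  "eis_cot z k = (if k = 0 then 0 else of_real pi * cot (of_real pi * of_int k / z) / z)"

lemma eis_cot_limit: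
  assumes "Im z > 0"
  shows "(\<lambda>M. \<Sum>m\<in>{- int M..<int M}. 1 / (of_int m * z + of_int k)) \<longlonglongrightarrow> eis_cot z k"
proof (cases "k = 0")
  case True
  have "(\<Sum>m\<in>{- int M..<int M}. 1 / (of_int m * z)) = - (1 / of_nat M) / z" for M
  proof (induction M)
    case (Suc M)
    have "{- int (Suc M)..<int (Suc M)} = insert (int M) (insert (- int M - 1) {- int M..<int M})" by auto
    moreover have "of_int (- int M - 1) = - complex_of_nat (Suc M)" by simp
    ultimately show ?case using Suc by (simp del: of_nat_Suc)
  qed simp
  moreover have "(\<lambda>M. - (1 / complex_of_nat M) / z) \<longlonglongrightarrow> - 0 / z"
    by (intro tendsto_divide tendsto_minus lim_1_over_n tendsto_const) (use assms in auto)
  ultimately show ?thesis using True by (simp add: eis_cot_def)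
next
  case False
  have z: "z \<noteq> 0" using assms by auto
  define w where "w = of_int k / z"
  have w: "w \<notin> \<int>" unfolding w_def using Im_multiple_not_Ints[OF _ False, of z] assms by auto
  have e: "1 / (of_int m * z + of_int k) = (1 / (w + of_int m)) / z" for m
  proof -
    have "(w + of_int m) * z = of_int m * z + of_int k" unfolding w_def using z by (simp add: distrib_right)
    then show ?thesis by (metis divide_divide_eq_left)
  qed
  have "(\<lambda>M. ((\<Sum>n<M. 1 / (w + of_nat n)) + (\<Sum>n<M. 1 / (w - of_nat n - 1))) / z) \<longlonglongrightarrow> of_real pi * cot (of_real pi * w) / z"
    by (intro tendsto_divide cot_partial_fractions w tendsto_const z)
  moreover have "(\<Sum>m\<in>{- int M..<int M}. 1 / (of_int m * z + of_int k)) =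
     ((\<Sum>n<M. 1 / (w + of_nat n)) + (\<Sum>n<M. 1 / (w - of_nat n - 1))) / z" for M
    unfolding e sum_divide_distrib[symmetric] sum_int_symmetric_split by (simp add: add_diff_eq)
  ultimately show ?thesis using False by (simp add: eis_cot_def w_def)
qed

text \<open>In a column the subtracted part does not telescope; its sum is a difference of two
  cotangents. Writing \<open>m z + k = z (m - k (- 1 / z))\<close> turns the square part into a row
  sum at \<open>- 1 / z\<close>.\<close>

lemma eis_diff_col:
  assumes "Im z > 0"
  shows "(\<Sum>\<^sub>\<infinity>m. eis_diff z m k) = eis_row (of_int (- k) * (- 1 / z)) / z\<^sup>2 - (eis_cot z k - eis_cot z (k + 1))"
proof -
  let ?g = "\<lambda>m k. 1 / (of_int m * z + of_int k)"
  have z: "z \<noteq> 0" using assms by auto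
  have s1: "(\<lambda>m. eis_diff z m k) summable_on UNIV"
    by (rule summable_on_SigmaD1[OF summable_on_swap[THEN iffD1, OF eis_diff_summable[OF assms]], simplified])
  have i: "Im (- 1 / z) \<noteq> 0" using assms by (simp add: Im_divide)
  have "((\<lambda>m. (1 / (of_int (-k) * (- 1 / z) + of_int m)\<^sup>2) / z\<^sup>2) has_sum eis_row (of_int (-k) * (- 1 / z)) / z\<^sup>2) UNIV"
    using eis_row_has_sum[OF i, of "- k"] by (rule has_sum_divide_const)
  moreover have "(1 / (of_int (-k) * (- 1 / z) + of_int m)\<^sup>2) / z\<^sup>2 = 1 / (of_int m * z + of_int k)\<^sup>2" for m
  proof -
    have "(of_int (-k) * (- 1 / z) + of_int m) * z = of_int m * z + of_int k"
      using z by (simp add: field_simps)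
    then show ?thesis by (metis divide_divide_eq_left power_mult_distrib)
  qed
  ultimately have s2: "((\<lambda>m. 1 / (of_int m * z + of_int k)\<^sup>2) has_sum eis_row (of_int (-k) * (- 1 / z)) / z\<^sup>2) UNIV"
    by simp
  have e: "1 / (of_int m * z + of_int k)\<^sup>2 - eis_diff z m k = ?g m k - ?g m (k + 1)" for m
    by (simp add: eis_diff_def)
  have d: "((\<lambda>m. ?g m k - ?g m (k + 1)) has_sum (eis_row (of_int (-k) * (- 1 / z)) / z\<^sup>2 - (\<Sum>\<^sub>\<infinity>m. eis_diff z m k))) UNIV"
    using has_sum_minus[OF s2 has_sum_infsum[OF s1]] unfolding e .
  have "(\<lambda>N. (\<Sum>m\<in>{- int N..<int N}. ?g m k) - (\<Sum>m\<in>{- int N..<int N}. ?g m (k + 1)))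
      \<longlonglongrightarrow> eis_row (of_int (-k) * (- 1 / z)) / z\<^sup>2 - (\<Sum>\<^sub>\<infinity>m. eis_diff z m k)"
    using has_sum_int_symmetric[OF d] by (simp only: sum_subtractf)
  moreover have "(\<lambda>N. (\<Sum>m\<in>{- int N..<int N}. ?g m k) - (\<Sum>m\<in>{- int N..<int N}. ?g m (k + 1)))
      \<longlonglongrightarrow> eis_cot z k - eis_cot z (k + 1)"
    by (intro tendsto_diff eis_cot_limit assms)
  ultimately have "eis_row (of_int (-k) * (- 1 / z)) / z\<^sup>2 - (\<Sum>\<^sub>\<infinity>m. eis_diff z m k) = eis_cot z k - eis_cot z (k + 1)"
    by (rule LIMSEQ_unique)
  then show ?thesis by (simp add: algebra_simps)
qed

text \<open>\<open>Im (N / z)\<close> tends to minus infinity, where the cotangent tends to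
  \<open>\<i>\<close>. This boundary value does not vanish, and it is the whole source of the
  anomaly.\<close>

lemma eis_cot_tendsto:
  assumes "Im z > 0"
  shows "(\<lambda>N. eis_cot z (int N)) \<longlonglongrightarrow> \<i> * of_real pi / z"
proof -
  define q where "q = exp (- 2 * \<i> * of_real pi / z)"
  have z: "z \<noteq> 0" using assms by auto
  have "norm q < 1"
  proof -
    have "(Re z)\<^sup>2 + (Im z)\<^sup>2 > 0" using assms by (intro add_nonneg_pos) auto
    then show ?thesis unfolding q_def using assms by (simp add: Re_divide norm_exp_eq_Re)
  qed
  then have q: "(\<lambda>N. q ^ N) \<longlonglongrightarrow> 0" by (rule LIMSEQ_power_zero)
  have "cot w = \<i> * (1 + exp (- 2 * \<i> * w)) / (1 - exp (- 2 * \<i> * w))" for w :: complex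
  proof -
    have "exp (\<i> * w) * exp (- 2 * \<i> * w) = exp (- (\<i> * w))" by (simp flip: exp_add)
    then have "\<i> * (1 + exp (- 2 * \<i> * w)) / (1 - exp (- 2 * \<i> * w)) =
        \<i> * (exp (\<i> * w) + exp (- (\<i> * w))) / (exp (\<i> * w) - exp (- (\<i> * w)))"
      using mult_divide_mult_cancel_left[of "exp (\<i> * w)" "\<i> * (1 + exp (- 2 * \<i> * w))" "1 - exp (- 2 * \<i> * w)"]
      by (simp add: algebra_simps)
    moreover have "((a + b) / 2) / ((a - b) / (2 * \<i>)) = \<i> * (a + b) / (a - b)" for a b :: complex
      by (cases "a = b") (simp_all add: field_simps)
    ultimately show ?thesis
      by (simp add: cot_def sin_exp_eq cos_exp_eq)
  qed
  then have "eis_cot z (int N) = of_real pi * (\<i> * (1 + q ^ N) / (1 - q ^ N)) / z" if "N > 0" for N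
    using that by (simp add: eis_cot_def q_def mult_ac flip: exp_of_nat_mult)
  then have "\<forall>\<^sub>F N in sequentially. of_real pi * (\<i> * (1 + q ^ N) / (1 - q ^ N)) / z = eis_cot z (int N)"
    by (auto intro!: eventually_sequentiallyI[of 1])
  moreover have "(\<lambda>N. of_real pi * (\<i> * (1 + q ^ N) / (1 - q ^ N)) / z) \<longlonglongrightarrow> of_real pi * (\<i> * (1 + 0) / (1 - 0)) / z"
    by (intro tendsto_intros q) (use z in auto)
  ultimately show ?thesis
    using tendsto_cong by (fastforce simp: mult_ac)
qed

text \<open>The absolutely convergent double sum of \<open>eis_diff\<close> equals \<open>eis2 z\<close> when summed by rows; summed by
  columns it is \<open>eis2 (- 1 / z) / z\<^sup>2\<close> plus a telescoping cotangent sum, which is the anomaly.\<close>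

theorem eis2_S:
  assumes "Im z > 0"
  shows "eis2 (- 1 / z) = z\<^sup>2 * eis2 z - 2 * \<i> * of_real pi * z"
proof -
  have z: "z \<noteq> 0" using assms by auto
  have i: "Im (- 1 / z) > 0" using assms by (simp add: Im_divide power2_eq_square sum_squares_gt_zero_iff)
  have s: "(\<lambda>m. eis_row (of_int m * w)) summable_on UNIV" if "Im w > 0" for w
    using summable_on_Sigma_banach[OF eis_diff_summable[OF that]] eis_diff_row[OF that] by simp
  have s': "(\<lambda>k. eis_row (of_int (- k) * (- 1 / z))) summable_on UNIV"
    "(\<Sum>\<^sub>\<infinity>k. eis_row (of_int (- k) * (- 1 / z))) = eis2 (- 1 / z)"
    using s[OF i] summable_on_reindex[of uminus "UNIV :: int set" "\<lambda>m. eis_row (of_int m * (- 1 / z))"]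
      infsum_reindex[of uminus "UNIV :: int set" "\<lambda>m. eis_row (of_int m * (- 1 / z))"]
    by (simp_all add: o_def eis2_def)
  have a: "((\<lambda>k. eis_row (of_int (- k) * (- 1 / z)) / z\<^sup>2) has_sum eis2 (- 1 / z) / z\<^sup>2) UNIV"
    using has_sum_divide_const[OF has_sum_infsum[OF s'(1)]] s'(2) by metis
  have "(\<lambda>(k, m). eis_diff z m k) summable_on (UNIV \<times> UNIV)"
    using summable_on_swap[THEN iffD1, OF eis_diff_summable[OF assms]] by simp
  from summable_on_Sigma_banach[OF this]
  have b: "(\<lambda>k. \<Sum>\<^sub>\<infinity>m. eis_diff z m k) summable_on UNIV" by simp
  have "(\<Sum>\<^sub>\<infinity>k. \<Sum>\<^sub>\<infinity>m. eis_diff z m k) = eis2 z"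
    using infsum_swap_banach[OF eis_diff_summable[OF assms]] eis_diff_row[OF assms] by (simp add: eis2_def)
  with has_sum_minus[OF a has_sum_infsum[OF b]]
  have d: "((\<lambda>k. eis_cot z k - eis_cot z (k + 1)) has_sum (eis2 (- 1 / z) / z\<^sup>2 - eis2 z)) UNIV"
    unfolding eis_diff_col[OF assms] by simp
  have "(\<lambda>N. eis_cot z (- int N) - eis_cot z (int N)) \<longlonglongrightarrow> eis2 (- 1 / z) / z\<^sup>2 - eis2 z"
    using has_sum_int_symmetric[OF d] unfolding sum_int_symmetric_telescope[of "eis_cot z"] .
  \<comment> \<open>The cotangent is odd, so the two ends of the telescoping sum add up instead of
    cancelling.\<close>
  moreover have "eis_cot z (- int N) - eis_cot z (int N) = - 2 * eis_cot z (int N)" for N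
    by (simp add: eis_cot_def)
  ultimately have "(\<lambda>N. - 2 * eis_cot z (int N)) \<longlonglongrightarrow> eis2 (- 1 / z) / z\<^sup>2 - eis2 z" by simp
  moreover have "(\<lambda>N. - 2 * eis_cot z (int N)) \<longlonglongrightarrow> - 2 * (\<i> * of_real pi / z)"
    by (intro tendsto_mult tendsto_const eis_cot_tendsto assms)
  ultimately have "eis2 (- 1 / z) / z\<^sup>2 - eis2 z = - 2 * (\<i> * of_real pi / z)"
    by (rule LIMSEQ_unique)
  then have "eis2 (- 1 / z) / z\<^sup>2 = eis2 z - 2 * (\<i> * of_real pi / z)" by (simp add: algebra_simps)
  then have "eis2 (- 1 / z) = (eis2 z - 2 * (\<i> * of_real pi / z)) * z\<^sup>2"
    using z nonzero_divide_eq_eq[of "z\<^sup>2"] by simp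
  then show ?thesis using z by (simp add: left_diff_distrib power2_eq_square)
qed

section \<open>The Lambert series\<close>

definition e2pi :: "complex \<Rightarrow> complex" where
  "e2pi w = exp (2 * of_real pi * \<i> * w)"

lemma norm_e2pi: "norm (e2pi w) = exp (- 2 * pi * Im w)"
  by (simp add: e2pi_def norm_exp_eq_Re)

lemma e2pi_of_nat_mult: "e2pi (of_nat n * z) = e2pi z ^ n"
  by (simp add: e2pi_def mult_ac flip: exp_of_nat_mult)

lemma e2pi_add: "e2pi (w + z) = e2pi w * e2pi z"
  by (simp add: e2pi_def distrib_left exp_add)

lemma e2pi_of_int [simp]: "e2pi (of_int k) = 1"
  by (auto simp: e2pi_def exp_eq_1)

lemma e2pi_cnj: "e2pi (- cnj w) = cnj (e2pi w)"
  by (simp add: e2pi_def exp_cnj)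

lemma norm_e2pi_less_1: "Im z > 0 \<Longrightarrow> norm (e2pi z) < 1"
  by (simp add: norm_e2pi)

lemma summable_polynomial_geometric:
  fixes r :: real
  assumes "0 \<le> r" "r < 1"
  shows "summable (\<lambda>n. (1 + real n) ^ k * r ^ n)"
proof -
  have "(\<lambda>n. (1 + inverse (real (Suc n))) ^ k * r) \<longlonglongrightarrow> (1 + 0) ^ k * r"
    by (intro tendsto_intros LIMSEQ_inverse_real_of_nat)
  then have "\<forall>\<^sub>F n in sequentially. (1 + inverse (real (Suc n))) ^ k * r < (1 + r) / 2"
    using assms by (intro order_tendstoD) auto
  then obtain N where N: "\<And>n. n \<ge> N \<Longrightarrow> (1 + inverse (real (Suc n))) ^ k * r < (1 + r) / 2"
    unfolding eventually_sequentially by blast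
  show ?thesis
  proof (rule summable_ratio_test[of "(1 + r) / 2" N])
    show "(1 + r) / 2 < 1" using assms by simp
    fix n assume n: "n \<ge> N"
    have "1 + real (Suc n) = (1 + inverse (real (Suc n))) * (1 + real n)" by (simp add: field_simps)
    then have "(1 + real (Suc n)) ^ k * r ^ Suc n = ((1 + inverse (real (Suc n))) ^ k * r) * ((1 + real n) ^ k * r ^ n)"
      by (simp add: power_mult_distrib)
    also have "\<dots> \<le> ((1 + r) / 2) * ((1 + real n) ^ k * r ^ n)"
      using N[OF n] assms by (intro mult_right_mono) auto
    finally show "norm ((1 + real (Suc n)) ^ k * r ^ Suc n) \<le> (1 + r) / 2 * norm ((1 + real n) ^ k * r ^ n)"
      using assms by simp
  qed
qed

definition tempered :: "(nat \<Rightarrow> complex) \<Rightarrow> bool" where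
  "tempered c \<longleftrightarrow> (\<exists>C k. \<forall>n. norm (c n) \<le> C * (1 + real n) ^ k)"

definition qser :: "(nat \<Rightarrow> complex) \<Rightarrow> complex \<Rightarrow> complex" where
  "qser c z = (\<Sum>n. c n * e2pi (of_nat n * z))"

lemma tempered_summable_power:
  assumes "tempered c" "0 \<le> r" "r < 1"
  shows "summable (\<lambda>n. norm (c n) * r ^ n)"
proof -
  obtain C k where C: "\<forall>n. norm (c n) \<le> C * (1 + real n) ^ k"
    using assms(1) unfolding tempered_def by blast
  have "summable (\<lambda>n. C * ((1 + real n) ^ k * r ^ n))"
    by (intro summable_mult summable_polynomial_geometric assms)
  then show ?thesis
  proof (rule summable_comparison_test_ev[rotated], intro always_eventually allI)
    fix n
    have "norm (c n) * r ^ n \<le> (C * (1 + real n) ^ k) * r ^ n"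
      using C assms(2) by (intro mult_right_mono) auto
    then show "norm (norm (c n) * r ^ n) \<le> C * ((1 + real n) ^ k * r ^ n)"
      using assms(2) by (simp add: mult.assoc)
  qed
qed

lemma qser_summable:
  assumes "tempered c" "Im z > 0"
  shows "summable (\<lambda>n. norm (c n * e2pi (of_nat n * z)))"
  using tempered_summable_power[OF assms(1), of "norm (e2pi z)"] norm_e2pi_less_1[OF assms(2)]
  by (simp add: norm_mult e2pi_of_nat_mult norm_power)

text \<open>Substitution \<open>n = d m\<close>. The function \<open>g\<close> receives the product
  as its argument, so that the lemma serves both the Lambert series and the Dirichlet series of
  \<open>sigma1\<close>.\<close>

lemma has_sum_divisors:
  fixes g :: "nat \<Rightarrow> nat \<Rightarrow> 'a :: {topological_comm_monoid_add,t3_space}"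
  assumes "((\<lambda>(d, m). g d (d * m)) has_sum S) ({1..} \<times> {1..})"
  shows "((\<lambda>n. \<Sum>d | d dvd n. g d n) has_sum S) {1..}"
proof -
  have "bij_betw (\<lambda>(n::nat, d). (d, n div d)) (Sigma {1..} (\<lambda>n. {d. d dvd n})) ({1..} \<times> {1..})"
  proof (rule bij_betwI[where g="\<lambda>(d, m). (d * m, d)"])
    show "(\<lambda>(d::nat, m). (d * m, d)) \<in> {1..} \<times> {1..} \<rightarrow> (SIGMA n:{1..}. {d. d dvd n})"
      by (auto simp: Suc_le_eq)
  qed (auto simp: Suc_le_eq elim!: dvdE)
  from has_sum_reindex_bij_betw[OF this] assms
  have "((\<lambda>p. case (case p of (n, d) \<Rightarrow> (d, n div d)) of (d, m) \<Rightarrow> g d (d * m)) has_sum S) (Sigma {1..} (\<lambda>n. {d. d dvd n}))"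
    by blast
  then have "((\<lambda>(n, d). g d n) has_sum S) (Sigma {1..} (\<lambda>n. {d. d dvd n}))"
    by (rule has_sum_cong[THEN iffD1, rotated]) auto
  then show ?thesis
  proof (rule has_sum_SigmaD)
    fix n :: nat assume "n \<in> {1..}"
    then have "finite {d. d dvd n}" by auto
    then show "((\<lambda>d. case (n, d) of (n, d) \<Rightarrow> g d n) has_sum (\<Sum>d | d dvd n. g d n)) {d. d dvd n}"
      by (simp add: has_sum_finite)
  qed
qed

lemma sigma1_0 [simp]: "sigma1 0 = 0"
  by (simp add: sigma1_def)

lemma sigma1_le_square: "sigma1 n \<le> n\<^sup>2"
proof (cases "n = 0")
  case False
  then have "{d. d dvd n} \<subseteq> {1..n}" by (auto dest: dvd_imp_le intro: Suc_leI dvd_pos_nat)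
  then have "sigma1 n \<le> (\<Sum>d\<in>{1..n}. d)" unfolding sigma1_def by (intro sum_mono2) auto
  also have "\<dots> \<le> (\<Sum>d\<in>{1..n}. n)" by (intro sum_mono) auto
  finally show ?thesis by (simp add: power2_eq_square)
qed simp

lemma tempered_sigma1: "tempered (\<lambda>n. of_nat (sigma1 n))"
  unfolding tempered_def
proof (rule exI[of _ "1::real"], rule exI[of _ "2::nat"], rule allI)
  fix n
  have "real (sigma1 n) \<le> real (n\<^sup>2)" using sigma1_le_square of_nat_le_iff by blast
  also have "\<dots> \<le> (1 + real n)\<^sup>2" by (simp add: power2_eq_square algebra_simps)
  finally show "norm (of_nat (sigma1 n) :: complex) \<le> 1 * (1 + real n)\<^sup>2" by simp
qed

text \<open>The function \<open>F\<close> of the overview; it equals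
  \<open>(1 - E_2) / 24\<close>.\<close>

definition sigser :: "complex \<Rightarrow> complex" where
  "sigser = qser (\<lambda>n. of_nat (sigma1 n))"

lemma has_sum_from_one_iff:
  fixes f :: "nat \<Rightarrow> 'a :: topological_comm_monoid_add"
  assumes "f 0 = 0"
  shows "(f has_sum S) {1..} \<longleftrightarrow> (f has_sum S) UNIV"
  by (rule has_sum_cong_neutral) (use assms in \<open>auto simp: not_le\<close>)

lemma geometric_deriv_has_sum:
  fixes z :: complex
  assumes "norm z < 1"
  shows "((\<lambda>d. of_nat d * z ^ d) has_sum (z / (1 - z)\<^sup>2)) UNIV"
    "((\<lambda>d. norm (of_nat d * z ^ d)) has_sum (norm z / (1 - norm z)\<^sup>2)) UNIV"
proof -
  have gen: "(\<lambda>d. of_nat d * w ^ d) sums (w / (1 - w)\<^sup>2)" if "norm w < 1" for w :: "'a :: {real_normed_field,banach}"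
  proof -
    have "(\<lambda>n. w * (of_nat (Suc n) * w ^ n)) sums (w * (1 / (1 - w)\<^sup>2))"
      by (intro sums_mult geometric_deriv_sums that)
    then have "(\<lambda>n. of_nat (Suc n) * w ^ Suc n) sums (w / (1 - w)\<^sup>2)" by (simp add: mult_ac)
    then show ?thesis using sums_Suc_iff[of "\<lambda>d. of_nat d * w ^ d"] by simp
  qed
  have s: "(\<lambda>d. norm (of_nat d * z ^ d)) sums (norm z / (1 - norm z)\<^sup>2)"
    using gen[of "norm z"] assms by (simp add: norm_mult norm_power)
  then show "((\<lambda>d. norm (of_nat d * z ^ d)) has_sum (norm z / (1 - norm z)\<^sup>2)) UNIV"
    by (intro norm_summable_imp_has_sum) (auto simp: sums_iff)
  show "((\<lambda>d. of_nat d * z ^ d) has_sum (z / (1 - z)\<^sup>2)) UNIV"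
    by (intro norm_summable_imp_has_sum gen assms sums_summable[OF s])
qed

text \<open>Both expansions come from the double series of \<open>d q^(m d)\<close>: summing over
  \<open>d\<close> first gives the Lambert terms, collecting equal products \<open>m d\<close> gives
  \<open>sigma1\<close>. Absolute summability follows from
  \<open>1 - \<bar>q\<bar>^m \<ge> 1 - \<bar>q\<bar>\<close>; its Lambert form is kept as a third
  claim because the later size estimates are made term by term.\<close>

lemma lambert_has_sum:
  assumes "Im z > 0"
  shows "((\<lambda>m. e2pi z ^ m / (1 - e2pi z ^ m)\<^sup>2) has_sum sigser z) {1..}"
    and "((\<lambda>n. of_nat (sigma1 n) * e2pi z ^ n) has_sum sigser z) UNIV"
    and "(\<lambda>m. norm (e2pi z ^ m / (1 - e2pi z ^ m)\<^sup>2)) summable_on {1..}"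
proof -
  let ?q = "e2pi z"
  have q: "norm ?q < 1" using assms by (rule norm_e2pi_less_1)
  show 1: "((\<lambda>n. of_nat (sigma1 n) * ?q ^ n) has_sum sigser z) UNIV"
    using qser_summable[OF tempered_sigma1 assms] unfolding sigser_def qser_def e2pi_of_nat_mult
    by (metis norm_summable_imp_has_sum summable_sums summable_norm_cancel)
  have qm: "norm (?q ^ m) < 1" if "m \<ge> 1" for m
    using that q by (simp add: norm_power power_less_one_iff)
  have h: "((\<lambda>d. norm (of_nat d * ?q ^ (m * d))) has_sum (norm (?q ^ m) / (1 - norm (?q ^ m))\<^sup>2)) {1..}"
    "((\<lambda>d. of_nat d * ?q ^ (m * d)) has_sum (?q ^ m / (1 - ?q ^ m)\<^sup>2)) {1..}" if "m \<ge> 1" for m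
    using geometric_deriv_has_sum[OF qm[OF that]]
    by (subst has_sum_from_one_iff; simp add: power_mult mult.commute[of _ m])+
  have sg: "(\<lambda>m. norm (?q ^ m) / (1 - norm (?q ^ m))\<^sup>2) summable_on {1..}"
  proof (rule summable_on_comparison_test)
    have "(\<lambda>m. norm ?q ^ m * (1 / (1 - norm ?q)\<^sup>2)) summable_on UNIV"
      by (rule summable_on_cmult_left[OF norm_summable_imp_summable_on]) (use q in \<open>auto simp: norm_power\<close>)
    then show "(\<lambda>m. norm ?q ^ m * (1 / (1 - norm ?q)\<^sup>2)) summable_on {1..}"
      by (rule summable_on_subset) auto
    fix m :: nat assume "m \<in> {1..}"
    then have m1: "norm (?q ^ m) < 1" and "norm (?q ^ m) \<le> norm ?q" using qm[of m] q power_decreasing[of 1 m "norm ?q"] by (simp_all add: norm_power)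
    then have "(1 - norm ?q)\<^sup>2 \<le> (1 - norm (?q ^ m))\<^sup>2" using q by (intro power_mono) auto
    then have "norm (?q ^ m) / (1 - norm (?q ^ m))\<^sup>2 \<le> norm (?q ^ m) / (1 - norm ?q)\<^sup>2"
      using q m1 by (intro divide_left_mono mult_pos_pos zero_less_power) auto
    then show "norm (?q ^ m) / (1 - norm (?q ^ m))\<^sup>2 \<le> norm ?q ^ m * (1 / (1 - norm ?q)\<^sup>2)"
      by (simp add: norm_power)
  qed auto
  show "(\<lambda>m. norm (?q ^ m / (1 - ?q ^ m)\<^sup>2)) summable_on {1..}"
  proof (rule Infinite_Sum.abs_summable_on_comparison_test'[OF sg])
    fix m :: nat assume "m \<in> {1..}"
    then have m: "norm (?q ^ m) < 1" using qm by auto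
    have "(1 - norm (?q ^ m)) ^ 2 \<le> norm (1 - ?q ^ m) ^ 2"
      using m norm_triangle_ineq2[of 1 "?q ^ m"] by (intro power_mono) auto
    then show "norm (?q ^ m / (1 - ?q ^ m)\<^sup>2) \<le> norm (?q ^ m) / (1 - norm (?q ^ m))\<^sup>2"
      using m unfolding norm_divide norm_power[of "1 - ?q ^ m"] by (intro divide_left_mono mult_pos_pos) (auto intro: less_le_trans[of 0 "(1 - norm (?q ^ m))\<^sup>2"])
  qed
  have "(\<lambda>(m, d). norm (of_nat d * ?q ^ (m * d))) summable_on ({1..} \<times> {1..})"
    by (rule summable_on_SigmaI[where g="\<lambda>m. norm (?q ^ m) / (1 - norm (?q ^ m))\<^sup>2"]) (use h sg in auto)
  then have abs: "(\<lambda>(m, d). of_nat d * ?q ^ (m * d)) summable_on ({1..} \<times> {1..})"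
    by (rule_tac abs_summable_summable) (simp add: case_prod_unfold)
  then have "(\<lambda>(d, m). of_nat d * ?q ^ (d * m)) summable_on ({1..} \<times> {1..})"
    using summable_on_swap[of "\<lambda>(m, d). of_nat d * ?q ^ (m * d)"] by (simp add: mult.commute)
  then obtain S where S: "((\<lambda>(d, m). of_nat d * ?q ^ (d * m)) has_sum S) ({1..} \<times> {1..})"
    unfolding summable_on_def by blast
  from has_sum_divisors[of "\<lambda>d n. of_nat d * ?q ^ n", OF S]
  have "((\<lambda>n. of_nat (sigma1 n) * ?q ^ n) has_sum S) {1..}"
    by (simp add: sigma1_def sum_distrib_right)
  with 1 have "S = sigser z" using has_sum_unique by (subst (asm) has_sum_from_one_iff) auto
  moreover have "((\<lambda>(m, d). of_nat d * ?q ^ (m * d)) has_sum S) ({1..} \<times> {1..})"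
    using S has_sum_swap[of "\<lambda>(d, m). of_nat d * ?q ^ (d * m)"] by (simp add: mult.commute)
  then have "((\<lambda>m. ?q ^ m / (1 - ?q ^ m)\<^sup>2) has_sum S) {1..}"
    by (rule has_sum_SigmaD) (use h in auto)
  ultimately show "((\<lambda>m. ?q ^ m / (1 - ?q ^ m)\<^sup>2) has_sum sigser z) {1..}" by simp
qed

text \<open>The bridge from powers of \<open>q\<close> to the sine, used for the q-expansion of
  \<open>eis2\<close>, for the size of the Lambert terms and for the closed form of
  \<open>ker 1\<close>.\<close>

lemma e2pi_over_square: "e2pi w / (1 - e2pi w)\<^sup>2 = - 1 / (4 * (sin (of_real pi * w))\<^sup>2)"
proof -
  let ?a = "exp (\<i> * (of_real pi * w))"
  have q: "e2pi w = ?a\<^sup>2" by (simp add: e2pi_def mult_ac flip: exp_double)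
  have a: "?a \<noteq> 0" by simp
  have s: "sin (of_real pi * w) = (?a - inverse ?a) / (2 * \<i>)"
    unfolding sin_exp_eq by (simp add: exp_minus)
  have gen: "a\<^sup>2 / (1 - a\<^sup>2)\<^sup>2 = - 1 / (4 * ((a - inverse a) / (2 * \<i>))\<^sup>2)" if "a \<noteq> 0" for a :: complex
  proof -
    have "4 * ((a - inverse a) / (2 * \<i>))\<^sup>2 = - ((a - inverse a)\<^sup>2)" by (simp add: power_divide power_mult_distrib)
    also have "\<dots> = - ((1 - a\<^sup>2)\<^sup>2 / a\<^sup>2)" using that by (simp add: power2_eq_square field_simps)
    finally show ?thesis by simp
  qed
  show ?thesis unfolding q s using gen[OF a] .
qed

text \<open>Row \<open>0\<close> gives the constant term. The rows \<open>m\<close> and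
  \<open>- m\<close> agree, and each is \<open>- 4 pi^2\<close> times the Lambert term of index
  \<open>m\<close>, which accounts for the factor \<open>8\<close>.\<close>

lemma eis2_eq_sigser:
  assumes "Im z > 0"
  shows "eis2 z = of_real (pi\<^sup>2 / 3) - 8 * of_real pi ^ 2 * sigser z"
proof -
  have r: "eis_row (of_nat m * z) = - 4 * of_real pi ^ 2 * (e2pi z ^ m / (1 - e2pi z ^ m)\<^sup>2)" if "m \<ge> 1" for m
  proof -
    have "of_nat m * z \<notin> \<int>" using Im_multiple_not_Ints(1)[of z "int m"] assms that by auto
    then show ?thesis
      unfolding e2pi_of_nat_mult[symmetric] e2pi_over_square by (simp add: eis_row_eq power_divide)
  qed
  have h: "((\<lambda>m. - 4 * of_real pi ^ 2 * (e2pi z ^ m / (1 - e2pi z ^ m)\<^sup>2)) has_sum - 4 * of_real pi ^ 2 * sigser z) {1..}"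
    by (rule has_sum_cmult_right[OF lambert_has_sum(1)[OF assms]])
  have h1: "((\<lambda>m. eis_row (of_nat m * z)) has_sum - 4 * of_real pi ^ 2 * sigser z) {1..}"
    by (rule has_sum_cong[THEN iffD1, OF _ h]) (use r in auto)
  have "((\<lambda>m. eis_row (of_nat m * z)) has_sum (\<Sum>m\<in>{0}. eis_row (of_nat m * z)) + - 4 * of_real pi ^ 2 * sigser z) ({0} \<union> {1..})"
    by (rule has_sum_Un_disjoint[OF has_sum_finite h1]) auto
  moreover have "{0} \<union> {1..} = (UNIV :: nat set)" by auto
  ultimately have h0: "((\<lambda>m. eis_row (of_nat m * z)) has_sum of_real (pi\<^sup>2 / 3) + - 4 * of_real pi ^ 2 * sigser z) UNIV"
    by (simp add: eis_row_0)
  have "range Suc = {1..}" by (auto simp: image_iff Suc_le_eq gr0_conv_Suc)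
  then have "((\<lambda>n. eis_row (of_nat (Suc n) * z)) has_sum - 4 * of_real pi ^ 2 * sigser z) UNIV"
    using h1 has_sum_reindex[of Suc UNIV "\<lambda>m. eis_row (of_nat m * z)"] by (simp add: o_def)
  moreover have "eis_row (of_int (- int n - 1) * z) = eis_row (of_nat (Suc n) * z)" for n
  proof -
    have "of_int (- int n - 1) * z = - (of_nat (Suc n) * z)" by (simp add: algebra_simps)
    then show ?thesis using eis_row_minus by metis
  qed
  ultimately have "((\<lambda>n. eis_row (of_int (- int n - 1) * z)) has_sum - 4 * of_real pi ^ 2 * sigser z) UNIV"
    by simp
  moreover have "((\<lambda>n. eis_row (of_int (int n) * z)) has_sum of_real (pi\<^sup>2 / 3) + - 4 * of_real pi ^ 2 * sigser z) UNIV"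
    using h0 by (simp only: of_int_of_nat_eq)
  ultimately have "((\<lambda>m. eis_row (of_int m * z)) has_sum of_real (pi\<^sup>2 / 3) + - 4 * of_real pi ^ 2 * sigser z + - 4 * of_real pi ^ 2 * sigser z) UNIV"
    by (intro has_sum_int_split)
  then show ?thesis unfolding eis2_def by (simp add: infsumI)
qed

section \<open>Continued fractions\<close>

text \<open>With the classical values at index \<open>-1\<close> (numerator \<open>1\<close>,
  denominator \<open>0\<close>) the recursion, the determinant and the Moebius relation hold
  uniformly from \<open>n = 0\<close> on.\<close>

definition cf_num_prev :: "real \<Rightarrow> nat \<Rightarrow> int" where
  "cf_num_prev x n = (if n = 0 then 1 else cf_num x (n - 1))"

definition cf_den_prev :: "real \<Rightarrow> nat \<Rightarrow> int" where
  "cf_den_prev x n = (if n = 0 then 0 else cf_den x (n - 1))"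

lemma cf_num_Suc: "cf_num x (Suc n) = cf_quot x (Suc n) * cf_num x n + cf_num_prev x n"
  by (cases n) (auto simp: cf_num_prev_def)

lemma cf_den_Suc: "cf_den x (Suc n) = cf_quot x (Suc n) * cf_den x n + cf_den_prev x n"
  by (cases n) (auto simp: cf_den_prev_def)

lemma cf_num_prev_Suc [simp]: "cf_num_prev x (Suc n) = cf_num x n"
  and cf_den_prev_Suc [simp]: "cf_den_prev x (Suc n) = cf_den x n"
  by (simp_all add: cf_num_prev_def cf_den_prev_def)

lemma cf_prev_0 [simp]: "cf_num_prev x 0 = 1" "cf_den_prev x 0 = 0"
  by (simp_all add: cf_num_prev_def cf_den_prev_def)

lemma cf_det: "cf_num x n * cf_den_prev x n - cf_num_prev x n * cf_den x n = - ((- 1) ^ n)"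
  by (cases n) (use cf_num_den_det in simp_all)

lemma cf_complete_Suc_gt_1:
  assumes "x \<notin> \<rat>"
  shows "cf_complete x (Suc n) > 1"
proof -
  have "cf_complete x n \<notin> \<int>"
    using cf_complete_irrational[OF assms] Ints_subset_Rats by blast
  then have "frac (cf_complete x n) > 0" by (simp add: frac_gt_0_iff)
  moreover have "frac (cf_complete x n) < 1" by (rule frac_lt_1)
  ultimately show ?thesis by simp
qed

lemma cf_complete_step: "cf_complete x n = of_int (cf_quot x n) + 1 / cf_complete x (Suc n)"
  by (simp add: cf_quot_def frac_def)

lemma cf_quot_le_complete: "of_int (cf_quot x n) \<le> cf_complete x n"
  by (simp add: cf_quot_def)

lemma cf_den_ge_1: "x \<notin> \<rat> \<Longrightarrow> real_of_int (cf_den x n) \<ge> 1"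
  using cf_den_pos[of x n] by simp

lemma cf_den_prev_bounds:
  assumes "x \<notin> \<rat>"
  shows "0 \<le> cf_den_prev x n" "cf_den_prev x n \<le> cf_den x n"
proof -
  show 0: "0 \<le> cf_den_prev x n" for n using cf_den_pos[OF assms, of "n - 1"] by (simp add: cf_den_prev_def)
  show "cf_den_prev x n \<le> cf_den x n"
  proof (cases n)
    case (Suc m)
    have "1 * cf_den x m \<le> cf_quot x (Suc m) * cf_den x m"
      using cf_quot_pos[OF assms, of "Suc m"] cf_den_pos[OF assms, of m] by (intro mult_right_mono) auto
    then show ?thesis unfolding Suc cf_den_Suc using 0[of m] by simp
  qed simp
qed

lemma cf_den_ge: 
  assumes "x \<notin> \<rat>"
  shows "int n \<le> cf_den x n"
proof (induction n rule: induct_nat_012)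
  case 1 then show ?case using cf_quot_pos[OF assms, of 1] by simp
next
  case (ge2 n)
  have "1 * cf_den x (Suc n) \<le> cf_quot x (Suc (Suc n)) * cf_den x (Suc n)"
    using cf_quot_pos[OF assms, of "Suc (Suc n)"] cf_den_pos[OF assms, of "Suc n"] by (intro mult_right_mono) auto
  with ge2 show ?case using cf_den_pos[OF assms, of n] unfolding cf_den.simps by linarith
qed simp

text \<open>The classical expression of \<open>x\<close> through a complete quotient, multiplied out
  to avoid denominators. The induction substitutes \<open>a + 1 / t\<close> for the current complete
  quotient.\<close>

lemma cf_complete_moebius:
  assumes "x \<notin> \<rat>"
  shows "x * (of_int (cf_den x n) * cf_complete x (Suc n) + of_int (cf_den_prev x n)) =
    of_int (cf_num x n) * cf_complete x (Suc n) + of_int (cf_num_prev x n)"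
proof (induction n)
  case 0
  define t where "t = cf_complete x (Suc 0)"
  have t: "t > 1" unfolding t_def by (rule cf_complete_Suc_gt_1[OF assms])
  have "x = of_int (cf_quot x 0) + 1 / t" using cf_complete_step[of x 0] unfolding t_def by simp
  then have "x * t = (of_int (cf_quot x 0) + 1 / t) * t" by metis
  also have "\<dots> = of_int (cf_quot x 0) * t + 1" using t by (simp add: field_simps)
  finally show ?case unfolding t_def[symmetric] by simp
next
  case (Suc n)
  define t where "t = cf_complete x (Suc (Suc n))"
  have t: "t > 1" unfolding t_def by (rule cf_complete_Suc_gt_1[OF assms])
  have s: "cf_complete x (Suc n) = of_int (cf_quot x (Suc n)) + 1 / t"
    unfolding t_def by (rule cf_complete_step)
  have gen: "(A * (a + 1 / t) + B) * t = (a * A + B) * t + A" for A a B :: real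
    using t by (simp add: algebra_simps)
  have "x * ((of_int (cf_den x n) * (of_int (cf_quot x (Suc n)) + 1 / t) + of_int (cf_den_prev x n)) * t) =
    (of_int (cf_num x n) * (of_int (cf_quot x (Suc n)) + 1 / t) + of_int (cf_num_prev x n)) * t"
    using Suc unfolding s by (simp only: mult.assoc[symmetric])
  then show ?case unfolding t_def[symmetric] cf_num_Suc cf_den_Suc gen by simp
qed

text \<open>The reciprocal of the error \<open>\<bar>q x - p\<bar>\<close> of the convergent
  \<open>p / q\<close> (see \<open>cf_error_abs\<close>).\<close>

definition cf_height :: "real \<Rightarrow> nat \<Rightarrow> real" where
  "cf_height x n = of_int (cf_den x n) * cf_complete x (Suc n) + of_int (cf_den_prev x n)"

lemma cf_height_bounds:
  assumes "x \<notin> \<rat>"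
  shows "of_int (cf_den x n) * cf_complete x (Suc n) \<le> cf_height x n"
    "cf_height x n \<le> 2 * of_int (cf_den x n) * cf_complete x (Suc n)" "cf_height x n > 1"
    "cf_height x n > of_int (cf_den x n)"
proof -
  note t = cf_complete_Suc_gt_1[OF assms, of n] and q = cf_den_ge_1[OF assms, of n]
  have q': "0 \<le> real_of_int (cf_den_prev x n)" "real_of_int (cf_den_prev x n) \<le> of_int (cf_den x n)"
    using cf_den_prev_bounds[OF assms, of n] by simp_all
  have "of_int (cf_den x n) * 1 < of_int (cf_den x n) * cf_complete x (Suc n)"
    using q t by (intro mult_strict_left_mono) auto
  then show "of_int (cf_den x n) * cf_complete x (Suc n) \<le> cf_height x n"
    "cf_height x n \<le> 2 * of_int (cf_den x n) * cf_complete x (Suc n)"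
    "cf_height x n > 1" "cf_height x n > of_int (cf_den x n)"
    unfolding cf_height_def using q q' by linarith+
qed

lemma cf_error:
  assumes "x \<notin> \<rat>"
  shows "of_int (cf_den x n) * x - of_int (cf_num x n) = (- 1) ^ n / cf_height x n"
proof -
  have h: "cf_height x n > 0" using cf_height_bounds(3)[OF assms, of n] by simp
  have m: "x * cf_height x n = of_int (cf_num x n) * cf_complete x (Suc n) + of_int (cf_num_prev x n)"
    unfolding cf_height_def by (rule cf_complete_moebius[OF assms])
  have "(of_int (cf_den x n) * x - of_int (cf_num x n)) * cf_height x n =
      of_int (cf_den x n) * (x * cf_height x n) - of_int (cf_num x n) * cf_height x n"
    by (simp add: algebra_simps)
  also have "\<dots> = of_int (- (cf_num x n * cf_den_prev x n - cf_num_prev x n * cf_den x n))"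
    unfolding m unfolding cf_height_def by (simp add: algebra_simps)
  also have "\<dots> = (- 1) ^ n" unfolding cf_det by simp
  finally show ?thesis using h by (simp add: field_simps)
qed

lemma cf_error_abs:
  assumes "x \<notin> \<rat>"
  shows "\<bar>of_int (cf_den x n) * x - of_int (cf_num x n)\<bar> = 1 / cf_height x n"
    "\<bar>x - of_int (cf_num x n) / of_int (cf_den x n)\<bar> = 1 / (of_int (cf_den x n) * cf_height x n)"
proof -
  have h: "cf_height x n > 0" using cf_height_bounds(3)[OF assms, of n] by simp
  show 1: "\<bar>of_int (cf_den x n) * x - of_int (cf_num x n)\<bar> = 1 / cf_height x n"
    unfolding cf_error[OF assms] using h by (simp add: abs_divide power_abs)
  have q: "real_of_int (cf_den x n) > 0" using cf_den_ge_1[OF assms, of n] by simp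
  then have "x - of_int (cf_num x n) / of_int (cf_den x n) = (of_int (cf_den x n) * x - of_int (cf_num x n)) / of_int (cf_den x n)"
    by (simp add: field_simps)
  then have "\<bar>x - of_int (cf_num x n) / of_int (cf_den x n)\<bar> = \<bar>of_int (cf_den x n) * x - of_int (cf_num x n)\<bar> / of_int (cf_den x n)"
    using q by (simp add: abs_divide)
  then show "\<bar>x - of_int (cf_num x n) / of_int (cf_den x n)\<bar> = 1 / (of_int (cf_den x n) * cf_height x n)"
    unfolding 1 by (simp add: mult.commute)
qed

lemma kappa_height:
  assumes "x \<notin> \<rat>" "cf_den x n > 1"
  shows "of_int (cf_den x n) powr (kappa x n) = of_int (cf_den x n) * cf_height x n"
proof -
  have e: "of_int (cf_den x n) powr (- kappa x n) = 1 / (of_int (cf_den x n) * cf_height x n)"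
    using kappa_eq[OF assms] cf_error_abs(2)[OF assms(1), of n] by simp
  have "of_int (cf_den x n) powr (kappa x n) = 1 / of_int (cf_den x n) powr (- kappa x n)"
    by (simp add: powr_minus_divide)
  then show ?thesis unfolding e by simp
qed

lemma kappa_ge_2:
  assumes "x \<notin> \<rat>" "cf_den x n > 1"
  shows "kappa x n \<ge> 2"
proof -
  let ?q = "real_of_int (cf_den x n)"
  have q: "?q > 1" using assms(2) by simp
  have "?q powr 2 = ?q * ?q" using q by (simp add: powr_numeral power2_eq_square)
  also have "\<dots> \<le> ?q * cf_height x n"
    using cf_height_bounds(4)[OF assms(1), of n] q by (intro mult_left_mono) auto
  also have "\<dots> = ?q powr (kappa x n)" by (rule kappa_height[OF assms, symmetric])
  finally show ?thesis using powr_le_cancel_iff[of ?q 2 "kappa x n"] q by blast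
qed

lemma cf_den_mono:
  assumes "x \<notin> \<rat>" "m \<le> n"
  shows "cf_den x m \<le> cf_den x n"
proof (rule lift_Suc_mono_le[OF _ assms(2)])
  show "cf_den x n \<le> cf_den x (Suc n)" for n
    using cf_den_prev_bounds(2)[OF assms(1), of "Suc n"] by simp
qed

text \<open>Lagrange's argument. Two consecutive convergents form a basis of the integer lattice, so
  \<open>(m, k)\<close> has integer coordinates \<open>u\<close>, \<open>v\<close>. The range of
  \<open>m\<close> forces \<open>u\<close> to be nonzero and \<open>u\<close>, \<open>v\<close> not
  to have the same sign; as consecutive errors alternate in sign, the two contributions cannot
  cancel.\<close>

lemma best_approximation:
  fixes m k :: int
  assumes "x \<notin> \<rat>" "1 \<le> m" "m < cf_den x (Suc n)"
  shows "1 / cf_height x n \<le> \<bar>of_int m * x - of_int k\<bar>"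
proof -
  define p q p' q' where "p = cf_num x n" and "q = cf_den x n" and "p' = cf_num x (Suc n)" and "q' = cf_den x (Suc n)"
  define s where "s = (- 1 :: int) ^ n"
  have ss: "s * s = 1" unfolding s_def by (simp flip: power_mult_distrib)
  have det: "p' * q - p * q' = s" unfolding p_def q_def p'_def q'_def s_def by (rule cf_num_den_det)
  \<comment> \<open>Cramer's rule; the determinant \<open>s\<close> is \<open>1\<close> or
    \<open>-1\<close> and hence its own inverse.\<close>
  define u v where "u = s * (p' * m - q' * k)" and "v = s * (q * k - p * m)"
  have m: "m = u * q + v * q'"
  proof -
    have "u * q + v * q' = s * (m * (p' * q - p * q'))" unfolding u_def v_def by (simp add: algebra_simps)
    then show ?thesis unfolding det using ss by (simp add: algebra_simps)
  qed
  have k: "k = u * p + v * p'"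
  proof -
    have "u * p + v * p' = s * (k * (p' * q - p * q'))" unfolding u_def v_def by (simp add: algebra_simps)
    then show ?thesis unfolding det using ss by (simp add: algebra_simps)
  qed
  have q: "q > 0" "q' > 0" unfolding q_def q'_def using cf_den_pos[OF assms(1)] by auto
  let ?e = "1 / cf_height x n" and ?e' = "1 / cf_height x (Suc n)"
  have e: "?e > 0" "?e' > 0" using less_trans[OF zero_less_one cf_height_bounds(3)[OF assms(1)]] by simp_all
  have "of_int m * x - of_int k = of_int u * (of_int q * x - of_int p) + of_int v * (of_int q' * x - of_int p')"
    unfolding m k by (simp add: algebra_simps)
  also have "\<dots> = (- 1) ^ n * (of_int u * ?e - of_int v * ?e')"
  proof -
    have e1: "of_int q * x - of_int p = (- 1) ^ n * ?e"
      unfolding p_def q_def cf_error[OF assms(1), of n] by simp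
    have e2: "of_int q' * x - of_int p' = - ((- 1) ^ n * ?e')"
      unfolding p'_def q'_def cf_error[OF assms(1), of "Suc n"] by simp
    show ?thesis unfolding e1 e2 by (simp add: algebra_simps)
  qed
  finally have a: "\<bar>of_int m * x - of_int k\<bar> = \<bar>of_int u * ?e - of_int v * ?e'\<bar>"
    by (simp add: abs_mult power_abs)
  have u0: "u \<noteq> 0"
  proof
    assume "u = 0"
    then have "m = v * q'" using m by simp
    then have "v \<ge> 1" using assms(2) q by (smt (verit) mult_nonpos_nonneg)
    then have "1 * q' \<le> v * q'" using q by (intro mult_right_mono) auto
    then show False using \<open>m = v * q'\<close> assms(3) q'_def by simp
  qed
  have opp: "u \<ge> 1 \<and> v \<le> 0 \<or> u \<le> -1 \<and> v \<ge> 0"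
  proof (rule ccontr)
    assume "\<not> ?thesis"
    then consider "u \<ge> 1" "v \<ge> 1" | "u \<le> -1" "v \<le> -1" using u0 by linarith
    then show False
    proof cases
      case 1
      then have "0 \<le> u * q" "1 * q' \<le> v * q'" using q by (auto intro: mult_right_mono)
      then show False using m assms(3) q'_def by simp
    next
      case 2
      then have "u * q \<le> 0" "v * q' \<le> 0" using q by (auto intro: mult_nonpos_nonneg)
      then show False using m assms(2) by simp
    qed
  qed
  then show ?thesis
  proof
    assume uv: "u \<ge> 1 \<and> v \<le> 0"
    then have "1 * ?e \<le> of_int u * ?e" "of_int v * ?e' \<le> 0"
      using e by (intro mult_right_mono mult_nonpos_nonneg; simp)+
    then show ?thesis unfolding a by linarith
  next
    assume uv: "u \<le> -1 \<and> v \<ge> 0"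
    then have "of_int u * ?e \<le> (- 1) * ?e" "0 \<le> of_int v * ?e'"
      using e by (intro mult_right_mono mult_nonneg_nonneg; simp)+
    then show ?thesis unfolding a by linarith
  qed
qed

text \<open>For \<open>m\<close> between two consecutive denominators the best approximation
  property gives the bound \<open>1 / cf_height x n\<close>, and \<open>kappa x n < r\<close> bounds
  the height by a power of the smaller denominator, hence of \<open>m\<close>. The finitely many
  initial denominators only affect \<open>c\<close>.\<close>

lemma diophantine_lower_bound:
  assumes "x \<notin> \<rat>" "mu x < ereal r" "r \<ge> 1"
  shows "\<exists>c>0. \<forall>m k. 1 \<le> m \<longrightarrow> c * of_int m powr (1 - r) \<le> \<bar>of_int m * x - of_int k\<bar>"
proof -
  have "\<forall>\<^sub>F n in sequentially. ereal (kappa x n) < ereal r"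
    using assms(2) unfolding mu_def by (metis Limsup_lessD)
  then obtain N where N: "\<And>n. n \<ge> N \<Longrightarrow> kappa x n < r"
    unfolding eventually_sequentially by auto
  \<comment> \<open>The \<open>2\<close> makes the denominators beyond \<open>N'\<close> exceed
    \<open>1\<close>, where \<open>kappa\<close> is not a junk value.\<close>
  define N' where "N' = max N 2"
  define c where "c = min 1 (1 / cf_height x N')"
  have c: "c > 0" "c \<le> 1" "c \<le> 1 / cf_height x N'" unfolding c_def
    using cf_height_bounds(3)[OF assms(1), of N'] by auto
  have "c * of_int m powr (1 - r) \<le> \<bar>of_int m * x - of_int k\<bar>" if m: "1 \<le> m" for m k :: int
  proof (cases "m < cf_den x (Suc N')")
    case True
    have "of_int m powr (1 - r) \<le> 1 powr (1 - r)" using m assms(3) by (intro powr_mono2') auto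
    then have "c * of_int m powr (1 - r) \<le> c * 1" using c by (intro mult_left_mono) auto
    then show ?thesis using c best_approximation[OF assms(1) m True, of k] by linarith
  next
    case False
    have ex: "\<exists>n. m < cf_den x (Suc n)"
      using cf_den_ge[OF assms(1), of "Suc (nat m)"] m by (intro exI[of _ "nat m"]) linarith
    define n where "n = (LEAST n. m < cf_den x (Suc n))"
    have n: "m < cf_den x (Suc n)" unfolding n_def by (rule LeastI_ex[OF ex])
    have nN: "n > N'"
    proof (rule ccontr)
      assume "\<not> n > N'"
      then have nn: "n \<le> N'" by simp
      have "cf_den x (Suc n) \<le> cf_den x (Suc N')" using nn by (intro cf_den_mono assms) simp
      then show False using False n by simp
    qed
    then obtain n' where n': "n = Suc n'" by (cases n) auto
    have "\<not> m < cf_den x (Suc n')" using not_less_Least[of n' "\<lambda>n. m < cf_den x (Suc n)"] n' unfolding n_def by simp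
    then have qm: "cf_den x n \<le> m" using n' by simp
    have q1: "cf_den x n > 1" using cf_den_ge[OF assms(1), of n] nN unfolding N'_def by linarith
    let ?q = "real_of_int (cf_den x n)"
    have q: "?q > 1" using q1 by simp
    have "?q * cf_height x n = ?q powr (kappa x n)" by (rule kappa_height[OF assms(1) q1, symmetric])
    also have "\<dots> \<le> ?q powr r" using N[of n] nN q unfolding N'_def by (intro powr_mono) auto
    finally have "cf_height x n \<le> ?q powr r / ?q" using q by (simp add: field_simps)
    also have "\<dots> = ?q powr (r - 1)" using q by (simp add: powr_diff)
    also have "\<dots> \<le> of_int m powr (r - 1)" using qm q assms(3) by (intro powr_mono2) auto
    finally have "1 / of_int m powr (r - 1) \<le> 1 / cf_height x n"
      using cf_height_bounds(3)[OF assms(1), of n] m by (intro divide_left_mono mult_pos_pos) auto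
    moreover have "c * of_int m powr (1 - r) \<le> 1 * of_int m powr (1 - r)" using c by (intro mult_right_mono) auto
    moreover have "of_int m powr (1 - r) = 1 / real_of_int m powr (r - 1)"
      using powr_minus[of "real_of_int m" "r - 1"] by (simp add: divide_inverse)
    ultimately show ?thesis using best_approximation[OF assms(1) m n, of k] by linarith
  qed
  then show ?thesis using c(1) by blast
qed

section \<open>Large values of the Lambert series\<close>

text \<open>This is \<open>pi^2 / 3\<close> times the completed series
  \<open>E_2(z) - 3 / (pi Im z)\<close>, hence the correction \<open>pi / Im z\<close>.\<close>

definition eis2_star :: "complex \<Rightarrow> complex" where
  "eis2_star z = eis2 z - of_real (pi / Im z)"

lemma e2pi_add_of_int [simp]: "e2pi (z + of_int k) = e2pi z"
  by (simp add: e2pi_add)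

lemma sigser_add_of_int: "sigser (z + of_int k) = sigser z"
  unfolding sigser_def qser_def e2pi_of_nat_mult by simp

lemma sigser_cnj:
  assumes "Im z > 0"
  shows "sigser (- cnj z) = cnj (sigser z)"
proof -
  have "(\<lambda>n. of_nat (sigma1 n) * e2pi (of_nat n * z)) sums sigser z"
    unfolding sigser_def qser_def
    by (rule summable_sums[OF summable_norm_cancel[OF qser_summable[OF tempered_sigma1 assms]]])
  then have "(\<lambda>n. cnj (of_nat (sigma1 n) * e2pi (of_nat n * z))) sums cnj (sigser z)"
    by (simp only: sums_cnj)
  then show ?thesis
    unfolding sigser_def qser_def e2pi_of_nat_mult e2pi_cnj by (simp add: sums_iff)
qed

lemma eis2_star_norm:
  assumes "Im z > 0"
  shows "norm (eis2_star (z + of_int k)) = norm (eis2_star z)"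
    "norm (eis2_star (- cnj z)) = norm (eis2_star z)"
proof -
  show "norm (eis2_star (z + of_int k)) = norm (eis2_star z)"
    using assms by (simp add: eis2_star_def eis2_eq_sigser sigser_add_of_int)
  have "eis2_star (- cnj z) = cnj (eis2_star z)"
    using assms by (simp add: eis2_star_def eis2_eq_sigser sigser_cnj)
  then show "norm (eis2_star (- cnj z)) = norm (eis2_star z)" by simp
qed

text \<open>The correction at \<open>- 1 / z\<close> carries the factor
  \<open>\<bar>z\<bar>^2 = z cnj z\<close> instead of \<open>z^2\<close>, and
  \<open>z (z - cnj z) = 2 \<i> z Im z\<close> produces exactly the anomaly of
  \<open>eis2_S\<close>.\<close>

lemma eis2_star_S:
  assumes "Im z > 0"
  shows "eis2_star (- 1 / z) = z\<^sup>2 * eis2_star z"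
proof -
  have z: "z \<noteq> 0" using assms by auto
  have "Im (- 1 / z) = Im z / (norm z)\<^sup>2"
    by (simp add: Im_divide cmod_power2)
  then have "of_real (pi / Im (- 1 / z)) = of_real (pi / Im z) * (z * cnj z)"
    using assms by (simp add: complex_norm_square[symmetric] del: of_real_power)
  then have "eis2_star (- 1 / z) = z\<^sup>2 * eis2 z - (2 * \<i> * of_real pi * z + of_real (pi / Im z) * (z * cnj z))"
    unfolding eis2_star_def eis2_S[OF assms] by simp
  also have "2 * \<i> * of_real pi * z = of_real (pi / Im z) * (z * (z - cnj z))"
    using assms by (simp add: complex_diff_cnj field_simps)
  finally show ?thesis by (simp add: eis2_star_def algebra_simps power2_eq_square)
qed

text \<open>The map is \<open>z\<close> to \<open>- 1 / z\<close>, then the reflection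
  \<open>- cnj\<close>, then an integral translation. The first divides \<open>Im w\<close> by
  \<open>(norm w)^2\<close> and multiplies the modulus of \<open>eis2_star\<close> by the same
  factor; the others change neither.\<close>

lemma eis2_star_step:
  assumes "Im w > 0"
  shows "Im (of_int a + 1 / cnj w) > 0"
    "Im (of_int a + 1 / cnj w) * norm (eis2_star (of_int a + 1 / cnj w)) = Im w * norm (eis2_star w)"
proof -
  have w: "w \<noteq> 0" using assms by auto
  have e: "1 / cnj w = - cnj (- 1 / w)" by simp
  have i: "Im (- 1 / w) = Im w / (norm w)\<^sup>2" by (simp add: Im_divide cmod_power2)
  then have p: "Im (- 1 / w) > 0" using assms w by simp
  have i': "Im (of_int a + 1 / cnj w) = Im (- 1 / w)" by (simp add: Im_divide)
  then show "Im (of_int a + 1 / cnj w) > 0" using p by (simp only: i')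
  have "Im (- cnj u) = Im u" for u by simp
  then have p': "Im (- cnj (- 1 / w)) > 0" using p by (simp only:)
  have "norm (eis2_star (of_int a + 1 / cnj w)) = norm (eis2_star (- 1 / w))"
    unfolding e using eis2_star_norm(1)[OF p', of a] eis2_star_norm(2)[OF p] by (metis add.commute)
  also have "\<dots> = (norm w)\<^sup>2 * norm (eis2_star w)"
    unfolding eis2_star_S[OF assms] by (simp add: norm_mult norm_power)
  finally show "Im (of_int a + 1 / cnj w) * norm (eis2_star (of_int a + 1 / cnj w)) = Im w * norm (eis2_star w)"
    unfolding i' i using w by simp
qed

text \<open>The map \<open>w \<mapsto> [a\<^sub>0; a\<^sub>1, \<dots>, a\<^sub>n\<^sub>-\<^sub>1, w]\<close>, reflected in the real axis at each
  step so that it preserves the upper half plane.\<close>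

fun cf_point :: "real \<Rightarrow> nat \<Rightarrow> complex \<Rightarrow> complex" where
  "cf_point x 0 w = w"
| "cf_point x (Suc n) w = cf_point x n (of_int (cf_quot x n) + 1 / cnj w)"

lemma cf_point_invariant:
  assumes "Im w > 0"
  shows "Im (cf_point x n w) > 0 \<and>
    Im (cf_point x n w) * norm (eis2_star (cf_point x n w)) = Im w * norm (eis2_star w)"
  using assms
proof (induction n arbitrary: w)
  case (Suc n)
  then show ?case using Suc.IH[OF eis2_star_step(1)[OF Suc.prems, of "cf_quot x n"]]
      eis2_star_step(2)[OF Suc.prems, of "cf_quot x n"] by simp
qed simp

definition cf_moebius :: "real \<Rightarrow> nat \<Rightarrow> complex \<Rightarrow> complex" where
  "cf_moebius x n w = (of_int (cf_num x n) * w + of_int (cf_num_prev x n)) /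
    (of_int (cf_den x n) * w + of_int (cf_den_prev x n))"

text \<open>There are \<open>n + 1\<close> reflections, so exactly one conjugation survives when
  \<open>n\<close> is even.\<close>

lemma cf_point_eq_moebius:
  assumes "w \<noteq> 0"  "Im w > 0"
  shows "cf_point x (Suc n) w = (if even n then cnj (cf_moebius x n w) else cf_moebius x n w)"
  using assms
proof (induction n arbitrary: w)
  case 0
  then show ?case by (simp add: cf_moebius_def field_simps)
next
  case (Suc n)
  let ?v = "of_int (cf_quot x (Suc n)) + 1 / cnj w"
  have v: "Im ?v > 0" using eis2_star_step(1)[OF Suc.prems(2)] .
  then have v0: "?v \<noteq> 0" by (metis less_irrefl zero_complex.simps(2))
  have w: "cnj w \<noteq> 0" using Suc.prems by simp
  have gen: "(A * (a + 1 / u) + B) * u = (a * A + B) * u + A" if "u \<noteq> 0" for A a B u :: complex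
    using that by (simp add: algebra_simps)
  have "cf_moebius x n ?v = ((of_int (cf_num x n) * ?v + of_int (cf_num_prev x n)) * cnj w) /
    ((of_int (cf_den x n) * ?v + of_int (cf_den_prev x n)) * cnj w)"
    unfolding cf_moebius_def using w by simp
  also have "\<dots> = cf_moebius x (Suc n) (cnj w)"
    unfolding gen[OF w] by (simp add: cf_moebius_def cf_num_Suc cf_den_Suc)
  also have "\<dots> = cnj (cf_moebius x (Suc n) w)" by (simp add: cf_moebius_def)
  finally have "cf_moebius x n ?v = cnj (cf_moebius x (Suc n) w)" .
  then show ?case using Suc.IH[OF v0 v] by simp
qed

text \<open>With \<open>u = 2 pi t \<ge> 42\<close>, the estimate \<open>exp u \<ge> u^2 / 2\<close>
  gives \<open>r \<le> 1 / 882\<close>. Bounding \<open>sigma1 n\<close> by \<open>n^2\<close> and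
  then by \<open>4^n\<close> leaves a geometric series of sum at most
  \<open>4 / 878\<close>.\<close>

lemma norm_sigser_imaginary_axis:
  assumes "t \<ge> 7"
  shows "norm (sigser (\<i> * of_real t)) \<le> 1 / 200"
proof -
  let ?z = "\<i> * complex_of_real t"
  define r where "r = exp (- 2 * pi * t)"
  have "1 + 2 * pi * t + (2 * pi * t)\<^sup>2 / 2 \<le> exp (2 * pi * t)"
    using assms by (intro exp_lower_Taylor_quadratic) auto
  moreover have "2 * 3 * 7 \<le> 2 * pi * t" using assms pi_gt3 by (intro mult_mono) auto
  moreover from this have "1764 \<le> (2 * pi * t)\<^sup>2" using power_mono[of 42 "2 * pi * t" 2] by simp
  ultimately have e: "882 \<le> exp (2 * pi * t)" by linarith
  have "r = 1 / exp (2 * pi * t)" unfolding r_def by (simp add: exp_minus divide_inverse)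
  also have "\<dots> \<le> 1 / 882" using e by (intro divide_left_mono) auto
  finally have r: "0 < r" "r \<le> 1 / 882" unfolding r_def by auto
  have n: "norm (of_nat (sigma1 n) * e2pi (of_nat n * ?z)) \<le> (if n = 0 then 0 else (4 * r) ^ n)" for n
  proof (cases "n = 0")
    case False
    have "norm (of_nat (sigma1 n) * e2pi (of_nat n * ?z)) = real (sigma1 n) * r ^ n"
      by (simp add: norm_mult norm_e2pi r_def mult_ac flip: exp_of_nat_mult)
    also have "\<dots> \<le> 4 ^ n * r ^ n"
    proof (intro mult_right_mono)
      have "sigma1 n \<le> n\<^sup>2" by (rule sigma1_le_square)
      also have "\<dots> \<le> (2 ^ n)\<^sup>2" by (intro power_mono) auto
      also have "\<dots> = 4 ^ n" by (simp add: power2_eq_square flip: power_mult_distrib)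
      finally show "real (sigma1 n) \<le> 4 ^ n" by (metis of_nat_le_iff of_nat_numeral of_nat_power)
    qed (use r in auto)
    finally show ?thesis using False by (simp add: power_mult_distrib)
  qed simp
  have "(\<lambda>n. (4 * r) * (4 * r) ^ n) sums ((4 * r) * (1 / (1 - 4 * r)))"
    using r by (intro sums_mult geometric_sums) auto
  then have s: "(\<lambda>n. if n = 0 then 0 else (4 * r) ^ n) sums ((4 * r) / (1 - 4 * r))"
    using sums_Suc_iff[of "\<lambda>n. if n = 0 then 0 else (4 * r) ^ n"] by simp
  have "norm (sigser ?z) \<le> (4 * r) / (1 - 4 * r)"
    unfolding sigser_def qser_def
    using norm_suminf_le[OF n sums_summable[OF s]] s by (simp add: sums_iff)
  also have "\<dots> \<le> 1 / 200" using r by (simp add: field_simps)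
  finally show ?thesis .
qed

text \<open>The Moebius map of the continued fraction sends the real point \<open>t\<close> to
  \<open>x\<close>, so it, or its conjugate, sends \<open>\<i> t\<close> to a point of the upper
  half plane near \<open>x\<close>. The invariant \<open>Im z * norm (eis2_star z)\<close> carries
  the value there, and returning from \<open>eis2_star\<close> to \<open>sigser\<close> costs only
  bounded terms.\<close>

theorem sigser_lower_bound:
  assumes "x \<notin> \<rat>" "cf_complete x (Suc n) \<ge> 7"
  defines "t \<equiv> cf_complete x (Suc n)" and "q \<equiv> real_of_int (cf_den x n)"
  shows "\<exists>z. Im z > 0 \<and> Im z \<le> 1 / (q\<^sup>2 * t) \<and> 1 / (2 * q\<^sup>2 * t) \<le> Im z \<and>
    norm (z - of_real x) \<le> 2 * Im z \<and> Im z * norm (sigser z) \<ge> t / 50"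
proof -
  define q' where "q' = real_of_int (cf_den_prev x n)"
  define p p' where "p = real_of_int (cf_num x n)" and "p' = real_of_int (cf_num_prev x n)"
  define w where "w = \<i> * complex_of_real t"
  define z where "z = cf_point x (Suc n) w"
  have t: "t \<ge> 7" unfolding t_def by fact
  have q: "q \<ge> 1" unfolding q_def using cf_den_ge_1[OF assms(1)] .
  have q': "0 \<le> q'" "q' \<le> q" unfolding q'_def q_def using cf_den_prev_bounds[OF assms(1), of n] by auto
  have w: "Im w > 0" "w \<noteq> 0" unfolding w_def using t by (auto simp: complex_eq_iff)
  have zI: "Im z > 0" and inv: "Im z * norm (eis2_star z) = t * norm (eis2_star w)"
    using cf_point_invariant[OF w(1), of x "Suc n"] unfolding z_def[symmetric] by (auto simp: w_def)
  have zc: "z = (if even n then cnj (cf_moebius x n w) else cf_moebius x n w)"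
    unfolding z_def by (rule cf_point_eq_moebius[OF w(2,1)])
  have M: "cf_moebius x n w = (of_real p * w + of_real p') / (of_real q * w + of_real q')"
    by (simp add: cf_moebius_def p_def p'_def q_def q'_def)
  have D: "(q * t)\<^sup>2 + q'\<^sup>2 > 0" using q t by (intro add_pos_nonneg) auto
  have det: "p * q' - p' * q = - ((- 1) ^ n)"
    unfolding p_def p'_def q_def q'_def using cf_det[of x n] by (metis of_int_1 of_int_diff of_int_minus of_int_mult of_int_power)
  have "Im (cf_moebius x n w) = (p * q' - p' * q) * t / ((q * t)\<^sup>2 + q'\<^sup>2)"
    unfolding M unfolding w_def by (simp add: Im_divide power2_eq_square algebra_simps)
  then have Imz: "Im z = t / ((q * t)\<^sup>2 + q'\<^sup>2)"
    unfolding zc det by simp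
  have u1: "(q * t)\<^sup>2 + q'\<^sup>2 \<le> 2 * q\<^sup>2 * t\<^sup>2"
  proof -
    have "q * 1 \<le> q * t" using q t by (intro mult_left_mono) auto
    then have "q' \<le> q * t" using q' by linarith
    then have "q'\<^sup>2 \<le> (q * t)\<^sup>2" using q' by (intro power_mono)
    then show ?thesis by (simp add: power_mult_distrib)
  qed
  have "t / (2 * q\<^sup>2 * t\<^sup>2) \<le> Im z" unfolding Imz using u1 D t by (intro divide_left_mono) auto
  then have c1: "1 / (2 * q\<^sup>2 * t) \<le> Im z" using t by (simp add: power2_eq_square)
  have "Im z \<le> t / (q * t)\<^sup>2" unfolding Imz using D t q by (intro divide_left_mono) auto
  also have "\<dots> = 1 / (q\<^sup>2 * t)" using t by (simp add: power2_eq_square)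
  finally have c2: "Im z \<le> 1 / (q\<^sup>2 * t)" .
  have "norm (z - of_real x) = norm (cf_moebius x n w - of_real x)"
  proof -
    have "cnj (cf_moebius x n w) - of_real x = cnj (cf_moebius x n w - of_real x)" by simp
    then show ?thesis unfolding zc by (metis complex_mod_cnj)
  qed
  also have "\<dots> \<le> 2 * Im z"
  proof -
    \<comment> \<open>The difference of the images of \<open>w\<close> and \<open>t\<close> is, up
      to sign, \<open>(w - t) / (b h)\<close>, with \<open>b\<close> and \<open>h\<close> the two
      Moebius denominators. Since \<open>norm b \<le> h\<close>, replacing \<open>h\<close> by
      \<open>norm b\<close> turns this into a multiple of
      \<open>Im z = t / (norm b)^2\<close>.\<close>
    define h where "h = q * t + q'"
    have h: "h > 0" unfolding h_def using q q' t by (intro add_pos_nonneg) auto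
    have xh: "x * h = p * t + p'"
      unfolding h_def p_def p'_def q_def q'_def t_def by (rule cf_complete_moebius[OF assms(1)])
    define b where "b = of_real q * w + of_real q'"
    have nb: "(norm b)\<^sup>2 = (q * t)\<^sup>2 + q'\<^sup>2" unfolding b_def w_def by (simp add: cmod_power2)
    then have b0: "b \<noteq> 0" using D by auto
    have "(norm b)\<^sup>2 \<le> h\<^sup>2" unfolding nb h_def using q q' t by (simp add: power2_sum)
    then have bh: "norm b \<le> h" using h by (intro power2_le_imp_le[of "norm b"]) auto
    have "(cf_moebius x n w - of_real x) * (b * of_real h) = (of_real p * w + of_real p') * of_real h - b * of_real (x * h)"
      unfolding M b_def[symmetric] using b0 by (simp add: field_simps)
    also have "\<dots> = of_real (p * q' - p' * q) * (w - of_real t)"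
      unfolding xh unfolding b_def h_def by (simp add: algebra_simps)
    finally have "norm ((cf_moebius x n w - of_real x) * (b * of_real h)) = norm (of_real (p * q' - p' * q) * (w - of_real t))"
      by simp
    then have "norm (cf_moebius x n w - of_real x) * (norm b * h) = norm (w - of_real t)"
      using h unfolding det norm_mult norm_of_real by (simp add: power_abs)
    also have "\<dots> \<le> norm w + norm (complex_of_real t)" by (rule norm_triangle_ineq4)
    also have "\<dots> = 2 * t" using t by (simp add: w_def norm_mult)
    finally have "norm (cf_moebius x n w - of_real x) * (norm b * h) \<le> 2 * t" .
    moreover have "norm (cf_moebius x n w - of_real x) * (norm b * norm b) \<le> norm (cf_moebius x n w - of_real x) * (norm b * h)"
      using bh by (intro mult_left_mono) auto
    ultimately have "norm (cf_moebius x n w - of_real x) * (norm b)\<^sup>2 \<le> 2 * t" by (simp add: power2_eq_square)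
    then show ?thesis unfolding Imz nb using D by (simp add: field_simps)
  qed
  finally have c3: "norm (z - of_real x) \<le> 2 * Im z" .
  have pi: "pi \<ge> 3" "pi > 0" "pi \<le> pi\<^sup>2 / 3" using pi_gt3 by (auto simp: power2_eq_square)
  have "norm (of_real (pi\<^sup>2 / 3 - pi / t) :: complex) \<le> norm (eis2_star w) + norm (8 * of_real pi ^ 2 * sigser w)"
  proof -
    have "eis2_star w + 8 * of_real pi ^ 2 * sigser w = of_real (pi\<^sup>2 / 3 - pi / t)"
      using w(1) by (simp add: eis2_star_def eis2_eq_sigser w_def)
    then show ?thesis by (metis norm_triangle_ineq)
  qed
  moreover have "norm (8 * of_real pi ^ 2 * sigser w) \<le> 8 * pi\<^sup>2 * (1 / 200)"
    using norm_sigser_imaginary_axis[OF t] unfolding w_def norm_mult by (intro mult_mono) (auto simp: norm_power)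
  moreover have "pi / t \<le> pi\<^sup>2 / 3 / 7" using pi t by (intro frac_le) auto
  ultimately have "norm (eis2_star w) \<ge> pi\<^sup>2 / 3 - pi\<^sup>2 / 3 / 7 - 8 * pi\<^sup>2 * (1 / 200)"
    by (simp add: norm_of_real del: of_real_diff) 
  \<comment> \<open>Numerically \<open>1/3 - 1/21 - 1/25 > 24/100\<close>.\<close>
  then have sw: "norm (eis2_star w) \<ge> pi\<^sup>2 * (24 / 100)" using pi by (simp add: field_simps)
  have "norm (eis2_star z) \<le> pi\<^sup>2 / 3 + 8 * pi\<^sup>2 * norm (sigser z) + pi / Im z"
  proof -
    have "norm (eis2_star z) = norm (of_real (pi\<^sup>2 / 3) - 8 * of_real pi ^ 2 * sigser z - of_real (pi / Im z))"
      using zI by (simp add: eis2_star_def eis2_eq_sigser)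
    also have "\<dots> \<le> norm (complex_of_real (pi\<^sup>2 / 3)) + norm (8 * of_real pi ^ 2 * sigser z) + norm (complex_of_real (pi / Im z))"
      by (meson add_right_mono norm_triangle_ineq4 order_trans)
    also have "\<dots> = pi\<^sup>2 / 3 + 8 * pi\<^sup>2 * norm (sigser z) + pi / Im z"
    proof -
      have "norm (complex_of_real (pi / Im z)) = pi / Im z" unfolding norm_of_real using zI by simp
      then show ?thesis by (simp add: norm_mult norm_power del: of_real_divide)
    qed
    finally show ?thesis .
  qed
  then have "Im z * norm (eis2_star z) \<le> Im z * (pi\<^sup>2 / 3 + 8 * pi\<^sup>2 * norm (sigser z) + pi / Im z)"
    using zI by (intro mult_left_mono) auto
  also have "\<dots> = Im z * (pi\<^sup>2 / 3) + 8 * pi\<^sup>2 * (Im z * norm (sigser z)) + pi"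
    using zI by (simp add: field_simps)
  also have "Im z * (pi\<^sup>2 / 3) \<le> (1 / 7) * (pi\<^sup>2 / 3)"
  proof (rule mult_right_mono)
    have "1 * 7 \<le> q\<^sup>2 * t" using q t by (intro mult_mono) auto
    then have "1 / (q\<^sup>2 * t) \<le> 1 / 7" by (intro divide_left_mono) auto
    then show "Im z \<le> 1 / 7" using c2 by linarith
  qed simp
  finally have "t * norm (eis2_star w) \<le> (1 / 7) * (pi\<^sup>2 / 3) + 8 * pi\<^sup>2 * (Im z * norm (sigser z)) + pi\<^sup>2 / 3"
    using inv pi by linarith
  moreover have "t * (pi\<^sup>2 * (24 / 100)) \<le> t * norm (eis2_star w)" using sw t by (intro mult_left_mono) auto
  moreover have "pi\<^sup>2 * (8 / 21) = (1 / 7) * (pi\<^sup>2 / 3) + pi\<^sup>2 / 3" by simp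
  ultimately have "pi\<^sup>2 * (t * (24 / 100)) \<le> pi\<^sup>2 * (8 / 21 + 8 * (Im z * norm (sigser z)))"
    by (simp add: algebra_simps)
  then have "t * (24 / 100) \<le> 8 / 21 + 8 * (Im z * norm (sigser z))"
    using pi by (simp only: mult_le_cancel_left_pos zero_less_power)
  \<comment> \<open>The claim needs \<open>24/100 t - 8/21 \<ge> 8/50 t\<close>, that is
    \<open>8/100 t \<ge> 8/21\<close>, which \<open>t \<ge> 7\<close> ensures.\<close>
  then have "Im z * norm (sigser z) \<ge> t / 50" using t by linarith
  then show ?thesis using zI c1 c2 c3 by blast
qed

section \<open>Upper bounds for the Lambert series\<close>

text \<open>Each cell \<open>i \<eta> \<le> \<bar>v\<bar> < (i + 1) \<eta>\<close> holds at most one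
  point on either side of \<open>0\<close>, so the map to cell index and sign is injective; the two
  signs cause the factor \<open>2\<close>.\<close>

lemma sum_spaced_points_le:
  fixes v g :: "'a \<Rightarrow> real" and G :: "nat \<Rightarrow> real"
  assumes "finite B" "\<eta> > 0"
    and sep: "\<And>m m'. m \<in> B \<Longrightarrow> m' \<in> B \<Longrightarrow> m \<noteq> m' \<Longrightarrow> \<eta> \<le> \<bar>v m - v m'\<bar>"
    and G: "summable G" "\<And>i. G i \<ge> 0"
    and g: "\<And>m i. m \<in> B \<Longrightarrow> real i * \<eta> \<le> \<bar>v m\<bar> \<Longrightarrow> \<bar>v m\<bar> < (real i + 1) * \<eta> \<Longrightarrow> g m \<le> G i"
  shows "(\<Sum>m\<in>B. g m) \<le> 2 * suminf G"
proof -
  define I where "I m = nat \<lfloor>\<bar>v m\<bar> / \<eta>\<rfloor>" for m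
  have I: "real (I m) * \<eta> \<le> \<bar>v m\<bar>" "\<bar>v m\<bar> < (real (I m) + 1) * \<eta>" for m
  proof -
    have "real (I m) = of_int \<lfloor>\<bar>v m\<bar> / \<eta>\<rfloor>" unfolding I_def using assms(2) by simp
    then have "real (I m) \<le> \<bar>v m\<bar> / \<eta>" "\<bar>v m\<bar> / \<eta> < real (I m) + 1" by linarith+
    then show "real (I m) * \<eta> \<le> \<bar>v m\<bar>" "\<bar>v m\<bar> < (real (I m) + 1) * \<eta>"
      using assms(2) by (simp_all add: field_simps)
  qed
  have inj: "inj_on (\<lambda>m. (I m, v m \<ge> 0)) B"
  proof (rule inj_onI, rule ccontr)
    fix m m' assume m: "m \<in> B" "m' \<in> B" "(I m, v m \<ge> 0) = (I m', v m' \<ge> 0)" "m \<noteq> m'"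
    then have "\<bar>v m - v m'\<bar> = \<bar>\<bar>v m\<bar> - \<bar>v m'\<bar>\<bar>" by auto
    moreover have "\<bar>v m\<bar> - \<bar>v m'\<bar> < \<eta>" "\<bar>v m'\<bar> - \<bar>v m\<bar> < \<eta>"
      using I[of m] I[of m'] m(3) by (auto simp: algebra_simps)
    ultimately show False using sep[OF m(1,2,4)] by linarith
  qed
  define N where "N = Suc (Max (insert 0 (I ` B)))"
  have N: "I m < N" if "m \<in> B" for m
    unfolding N_def using that assms(1) by (simp add: less_Suc_eq_le)
  have "(\<Sum>m\<in>B. g m) \<le> (\<Sum>m\<in>B. G (I m))" using I g by (intro sum_mono) blast
  also have "\<dots> = (\<Sum>p\<in>(\<lambda>m. (I m, v m \<ge> 0)) ` B. G (fst p))"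
    by (subst sum.reindex[OF inj]) simp
  also have "\<dots> \<le> (\<Sum>p\<in>{..<N} \<times> (UNIV :: bool set). G (fst p))"
    by (intro sum_mono2) (use N G in auto)
  also have "\<dots> = (\<Sum>i<N. \<Sum>b\<in>(UNIV :: bool set). G i)" by (subst sum.cartesian_product) (simp add: case_prod_unfold)
  also have "\<dots> = 2 * (\<Sum>i<N. G i)" by (simp add: sum_distrib_left)
  also have "(\<Sum>i<N. G i) \<le> suminf G" using G by (intro sum_le_suminf) auto
  finally show ?thesis by simp
qed

text \<open>After reduction to \<open>\<bar>v\<bar> \<le> 1/2\<close>, the argument
  \<open>y = \<bar>pi v\<bar>\<close> is at most \<open>1.6\<close>. Hence the Taylor error
  \<open>y^3 / 6\<close> is at most \<open>y / 2\<close>, and the remaining \<open>y / 2\<close> is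
  at least \<open>\<bar>v\<bar>\<close>.\<close>

lemma abs_sin_ge_dist_int: "\<bar>u - of_int (round u)\<bar> \<le> \<bar>sin (pi * u)\<bar>"
proof -
  define v where "v = u - of_int (round u)"
  have v: "\<bar>v\<bar> \<le> 1/2" unfolding v_def using of_int_round_abs_le[of u] by linarith
  have "pi * u = pi * v + pi * of_int (round u)" unfolding v_def by (simp add: algebra_simps)
  then have "sin (pi * u) = sin (pi * v) * (if even (round u) then 1 else - 1)"
    by (simp add: sin_add sin_npi_int cos_npi_int)
  then have "\<bar>sin (pi * u)\<bar> = \<bar>sin (pi * v)\<bar>" by simp
  moreover have "\<bar>sin (pi * v)\<bar> \<ge> \<bar>v\<bar>"
  proof -
    let ?y = "\<bar>pi * v\<bar>"
    have "\<bar>sin (pi * v) - (\<Sum>m<3. sin_coeff m * (pi * v) ^ m)\<bar> \<le> inverse (fact 3) * ?y ^ 3"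
      by (rule Maclaurin_sin_bound)
    then have 1: "\<bar>sin (pi * v) - pi * v\<bar> \<le> ?y ^ 3 / 6"
      by (simp add: eval_nat_numeral sin_coeff_def fact_numeral)
    have "pi \<le> 3.2" using pi_less_4 pi_approx by simp
    then have y: "?y \<le> 1.6" using v by (simp add: abs_mult) (use mult_mono[of pi "3.2" "\<bar>v\<bar>" "1/2"] in simp)
    then have "?y ^ 2 \<le> 1.6 ^ 2" by (intro power_mono) auto
    then have "?y * ?y ^ 2 \<le> ?y * 3" by (intro mult_left_mono) (auto simp: power2_eq_square)
    moreover have "?y ^ 3 = ?y * ?y ^ 2" by (simp only: power3_eq_cube power2_eq_square mult.assoc)
    ultimately have "?y ^ 3 / 6 \<le> ?y / 2" by linarith
    moreover have "?y / 2 \<ge> \<bar>v\<bar>" using pi_gt3 by (simp add: abs_mult) (use mult_right_mono[of 2 pi "\<bar>v\<bar>"] in simp)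
    ultimately show ?thesis using 1 by linarith
  qed
  ultimately show ?thesis unfolding v_def by simp
qed

text \<open>Below \<open>1\<close> the linear bound wins, above \<open>1\<close> the quadratic
  Taylor polynomial of \<open>exp\<close>. An exponent strictly between \<open>1\<close> and
  \<open>2\<close> is what later makes the sum over blocks converge.\<close>

lemma sinh_ge_powr:
  fixes v e :: real
  assumes "v > 0" "1 \<le> e" "e \<le> 2"
  shows "v \<le> sinh v" "v powr e / 4 \<le> sinh v"
proof -
  have 1: "exp v \<ge> 1 + v + v\<^sup>2 / 2" using assms by (intro exp_lower_Taylor_quadratic) auto
  have s: "sinh v = (exp v - exp (- v)) / 2" by (simp add: sinh_def)
  show 2: "v \<le> sinh v"
  proof -
    have "(\<lambda>x. sinh x - x) 0 \<le> (\<lambda>x. sinh x - x) v"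
    proof (rule DERIV_nonneg_imp_nondecreasing[of 0 v "\<lambda>x. sinh x - x"])
      fix y :: real
      show "\<exists>z. ((\<lambda>x. sinh x - x) has_real_derivative z) (at y) \<and> 0 \<le> z"
        by (intro exI[of _ "cosh y - 1"]) (auto intro!: derivative_eq_intros simp: cosh_real_ge_1)
    qed (use assms in auto)
    then show ?thesis by simp
  qed
  show "v powr e / 4 \<le> sinh v"
  proof (cases "v \<le> 1")
    case True
    have "v powr e \<le> v powr 1" using assms True by (intro powr_mono') auto
    then show ?thesis using 2 assms by simp
  next
    case False
    have "v powr e \<le> v powr 2" using assms False by (intro powr_mono) auto
    then have "v powr e \<le> v\<^sup>2" using assms by simp
    moreover have "exp (- v) \<le> 1" using assms by simp
    ultimately have "v powr e / 2 \<le> exp v - exp (- v)" using 1 assms by linarith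
    then show ?thesis unfolding s by simp
  qed
qed

lemma norm_sin_squared_eq:
  "(sin (Re w))\<^sup>2 + (sinh (Im w))\<^sup>2 = (norm (sin w))\<^sup>2"
proof -
  have "(norm (sin w))\<^sup>2 = (exp (2 * Im w) + inverse (exp (2 * Im w)) - 2 * cos (2 * Re w)) / 4"
    by (rule norm_sin_squared)
  moreover have "cos (2 * Re w) = 1 - 2 * (sin (Re w))\<^sup>2" using cos_double_sin by auto
  moreover have "(sinh (Im w))\<^sup>2 = (exp (2 * Im w) + inverse (exp (2 * Im w)) - 2) / 4"
  proof -
    have "exp (2 * Im w) = (exp (Im w))\<^sup>2" by (simp add: exp_double)
    then show ?thesis by (simp add: sinh_def exp_minus power2_eq_square field_simps)
  qed
  moreover have "N = (E + J - 2 * c) / 4 \<Longrightarrow> c = 1 - 2 * s \<Longrightarrow> h = (E + J - 2) / 4 \<Longrightarrow> s + h = N"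
    for N E J c s h :: real by (simp add: field_simps)
  ultimately show ?thesis by blast
qed

definition sig_term :: "complex \<Rightarrow> nat \<Rightarrow> real" where
  "sig_term z m = norm (e2pi z ^ m / (1 - e2pi z ^ m)\<^sup>2)"

lemma sig_term_nonneg [simp]: "sig_term z m \<ge> 0"
  by (simp add: sig_term_def)

lemma sig_term_0 [simp]: "sig_term z 0 = 0"
  by (simp add: sig_term_def)

lemma sigser_le_sig_term:
  assumes "Im z > 0"
  shows "summable (sig_term z)" "norm (sigser z) \<le> suminf (sig_term z)"
proof -
  have s: "sig_term z summable_on {1..}"
  proof -
    have "sig_term z = (\<lambda>m. norm (e2pi z ^ m / (1 - e2pi z ^ m)\<^sup>2))" by (simp add: fun_eq_iff sig_term_def)
    then show ?thesis using lambert_has_sum(3)[OF assms] by simp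
  qed
  then have h: "(sig_term z has_sum infsum (sig_term z) {1..}) UNIV"
    by (subst has_sum_from_one_iff[symmetric]) auto
  then have sums: "sig_term z sums infsum (sig_term z) {1..}" by (rule has_sum_imp_sums)
  then show "summable (sig_term z)" by (rule sums_summable)
  have "norm (infsum (\<lambda>m. e2pi z ^ m / (1 - e2pi z ^ m)\<^sup>2) {1..}) \<le> infsum (sig_term z) {1..}"
    unfolding sig_term_def by (rule norm_infsum_bound[OF lambert_has_sum(3)[OF assms]])
  then show "norm (sigser z) \<le> suminf (sig_term z)"
    using infsumI[OF lambert_has_sum(1)[OF assms]] sums by (simp add: sums_iff)
qed

definition near_int :: "real \<Rightarrow> real" where
  "near_int u = u - of_int (round u)"

text \<open>The identity \<open>norm_sin_squared_eq\<close> separates the horizontal distance of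
  \<open>m b\<close> from the integers and the height \<open>m a\<close>, which are then exploited
  independently.\<close>

lemma sig_term_le:
  assumes "a > 0" "m > 0"
  shows "sig_term (Complex b a) m \<le> 1 / (4 * ((near_int (real m * b))\<^sup>2 + (sinh (pi * (real m * a)))\<^sup>2))"
proof -
  let ?z = "Complex b a"
  let ?S = "(sin (pi * (real m * b)))\<^sup>2 + (sinh (pi * (real m * a)))\<^sup>2"
  have "sig_term ?z m = norm (- 1 / (4 * (sin (of_real pi * (of_nat m * ?z)))\<^sup>2))"
    unfolding sig_term_def e2pi_of_nat_mult[symmetric] e2pi_over_square ..
  also have "\<dots> = 1 / (4 * (norm (sin (of_real pi * (of_nat m * ?z))))\<^sup>2)"
    by (simp add: norm_divide norm_mult norm_power)
  also have "(norm (sin (of_real pi * (of_nat m * ?z))))\<^sup>2 = ?S"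
    unfolding norm_sin_squared_eq[symmetric] by simp
  also have "1 / (4 * ?S) \<le> 1 / (4 * ((near_int (real m * b))\<^sup>2 + (sinh (pi * (real m * a)))\<^sup>2))"
  proof -
    have "pi * (real m * a) > 0" using assms by simp
    then have "sinh (pi * (real m * a)) > 0" by (rule sinh_real_pos_iff[THEN iffD2])
    then have p: "(sinh (pi * (real m * a)))\<^sup>2 > 0" by (rule zero_less_power)
    have "(near_int (real m * b))\<^sup>2 \<le> (sin (pi * (real m * b)))\<^sup>2"
      unfolding near_int_def using abs_sin_ge_dist_int abs_le_square_iff by blast
    then show ?thesis using p
      by (intro divide_left_mono mult_pos_pos add_nonneg_pos mult_left_mono add_right_mono) auto
  qed
  finally show ?thesis .
qed

lemma near_int_diff_ge:
  assumes "\<And>k::int. \<eta> \<le> \<bar>u - w - of_int k\<bar>"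
  shows "\<eta> \<le> \<bar>near_int u - near_int w\<bar>"
  using assms[of "round u - round w"] by (simp add: near_int_def algebra_simps)

text \<open>Weighted arithmetic-geometric mean inequality without the sharp constant. It divides the
  available decay between two summation indices.\<close>

lemma weighted_product_le_sum:
  fixes A B l :: real
  assumes "A > 0" "B > 0" "0 \<le> l" "l \<le> 1"
  shows "A powr l * B powr (1 - l) \<le> A + B"
proof -
  have "A powr l * B powr (1 - l) \<le> (A + B) powr l * (A + B) powr (1 - l)"
    using assms by (intro mult_mono powr_mono2) auto
  also have "\<dots> = A + B" using assms by (simp flip: powr_add)
  finally show ?thesis .
qed

text \<open>Term of a zeta series, with \<open>max\<close> giving index \<open>0\<close> the value
  \<open>1\<close> rather than the default \<open>0 powr (- p) = 0\<close>.\<close>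

definition pterm :: "real \<Rightarrow> nat \<Rightarrow> real" where
  "pterm p i = max 1 (real i) powr (- p)"

lemma pterm_nonneg [simp]: "pterm p i \<ge> 0"
  by (simp add: pterm_def)

lemma pterm_pos: "i \<noteq> 0 \<Longrightarrow> pterm p i = real i powr (- p)"
  by (simp add: pterm_def max_def)

lemma summable_pterm:
  assumes "p > 1"
  shows "summable (pterm p)"
proof -
  have "summable (\<lambda>i. real i powr (- p))" using assms by (simp add: summable_real_powr_iff)
  then show ?thesis
    by (rule summable_comparison_test_ev[rotated])
       (auto intro!: eventually_sequentiallyI[of 1] simp: pterm_def max_def)
qed

lemma sig_term_le_powr:
  assumes "a > 0" "m > 0" "0 < \<delta>" "\<delta> \<le> 1"
  shows "sig_term (Complex b a) m \<le> 4 * (real m * a) powr (- 2 - 2 * \<delta>)"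
proof -
  let ?y = "real m * a"
  have y: "?y > 0" using assms by simp
  have s: "?y powr (1 + \<delta>) / 4 \<le> sinh ?y" using assms y by (intro sinh_ge_powr) auto
  also have "sinh ?y \<le> sinh (pi * ?y)" using y pi_gt3 by (simp add: mult_le_cancel_right1)
  finally have sq: "(?y powr (1 + \<delta>) / 4)\<^sup>2 \<le> (sinh (pi * ?y))\<^sup>2" using y by (intro power_mono) auto
  have sq': "(?y powr (1 + \<delta>) / 4)\<^sup>2 = ?y powr (2 + 2 * \<delta>) / 16"
    using y by (simp add: power2_eq_square flip: powr_add)
  have "?y powr (2 + 2 * \<delta>) / 4 \<le> 4 * ((near_int (real m * b))\<^sup>2 + (sinh (pi * ?y))\<^sup>2)"
  proof -
    have "p / 4 \<le> 4 * (v + q)" if "p / 16 \<le> q" "0 \<le> v" for p q v :: real using that by simp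
    from this[OF sq[unfolded sq'] zero_le_power2] show ?thesis .
  qed
  then have "1 / (4 * ((near_int (real m * b))\<^sup>2 + (sinh (pi * ?y))\<^sup>2)) \<le> 1 / (?y powr (2 + 2 * \<delta>) / 4)"
    by (intro frac_le) (use assms in auto)
  also have "\<dots> = 4 * ?y powr (- (2 + 2 * \<delta>))" unfolding powr_minus_divide by simp
  finally show ?thesis using sig_term_le[OF assms(1,2), of b] by simp
qed

text \<open>Uses only the \<open>sinh\<close> part of the denominators. The loss
  \<open>2 * \<delta>\<close> is included so that the bound has the same shape as the improved one,
  of which it is the case \<open>\<theta> = 0\<close>.\<close>

lemma sigser_trivial_bound:
  assumes "0 < \<delta>" "\<delta> \<le> 1"
  shows "\<exists>C\<ge>0. \<forall>z. Im z > 0 \<longrightarrow> norm (sigser z) \<le> C * Im z powr (- 2 - 2 * \<delta>)"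
proof (intro exI[of _ "4 * suminf (pterm (2 + 2 * \<delta>))"] conjI allI impI)
  have s: "summable (pterm (2 + 2 * \<delta>))" using assms by (intro summable_pterm) auto
  then show "4 * suminf (pterm (2 + 2 * \<delta>)) \<ge> 0" by (simp add: suminf_nonneg)
  fix z assume z: "Im z > 0"
  define a b where "a = Im z" and "b = Re z"
  have ab: "z = Complex b a" "a > 0" using z by (simp_all add: a_def b_def)
  have t: "sig_term z m \<le> 4 * a powr (- 2 - 2 * \<delta>) * pterm (2 + 2 * \<delta>) m" for m
  proof (cases "m = 0")
    case False
    then have "sig_term z m \<le> 4 * (real m * a) powr (- 2 - 2 * \<delta>)"
      using sig_term_le_powr[of a m \<delta> b] assms ab by simp
    also have "\<dots> = 4 * a powr (- 2 - 2 * \<delta>) * pterm (2 + 2 * \<delta>) m"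
      using ab False by (simp add: pterm_pos powr_mult)
    finally show ?thesis .
  qed simp
  have "norm (sigser z) \<le> suminf (sig_term z)" by (rule sigser_le_sig_term[OF z])
  also have "\<dots> \<le> (\<Sum>m. 4 * a powr (- 2 - 2 * \<delta>) * pterm (2 + 2 * \<delta>) m)"
    by (intro suminf_le t sigser_le_sig_term z summable_mult s)
  also have "\<dots> = 4 * suminf (pterm (2 + 2 * \<delta>)) * a powr (- 2 - 2 * \<delta>)"
    using suminf_mult[OF s, of "4 * a powr (- 2 - 2 * \<delta>)"] by (simp add: mult_ac)
  finally show "norm (sigser z) \<le> 4 * suminf (pterm (2 + 2 * \<delta>)) * Im z powr (- 2 - 2 * \<delta>)"
    unfolding a_def .
qed

text \<open>In the block number \<open>k > 0\<close> the \<open>sinh\<close> part of the denominator is compared with a power of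
  \<open>k L a\<close> above \<open>2\<close>; the weighted product then has exponent \<open>1 + \<delta>\<close> in both the spacing index and \<open>k\<close>,
  so that both sums converge.\<close>

lemma sig_term_block_le:
  assumes "\<eta> > 0" "L \<ge> 1" "a > 0" "0 < \<delta>" "\<delta> \<le> 1/3" "k > 0"
    and sep: "\<And>j (i::int). 1 \<le> j \<Longrightarrow> j < L \<Longrightarrow> \<eta> \<le> \<bar>real j * b - of_int i\<bar>"
  shows "(\<Sum>m\<in>{k * L..<k * L + L}. sig_term (Complex b a) m) \<le>
    2 * (1 / (real L * a)\<^sup>2) * pterm 2 k +
    2 * suminf (pterm (1 + \<delta>)) * (\<eta> * (real L * a)) powr (- 1 - \<delta>) * pterm (1 + \<delta>) k"
    and "(\<Sum>m\<in>{0..<L}. sig_term (Complex b a) m) \<le> 2 * (1 / \<eta>\<^sup>2) * suminf (pterm 2)"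
proof -
  let ?f = "sig_term (Complex b a)"
  define v where "v m = near_int (real m * b)" for m
  \<comment> \<open>Two indices of one block differ by some \<open>j\<close> with
    \<open>1 \<le> j < L\<close>, so the hypothesis on multiples of \<open>b\<close> separates their
    points modulo \<open>1\<close>.\<close>
  have vsep: "\<eta> \<le> \<bar>v m - v m'\<bar>" if "m \<in> {l..<l + L}" "m' \<in> {l..<l + L}" "m \<noteq> m'" for m m' l
    unfolding v_def
  proof (rule near_int_diff_ge)
    fix i :: int
    show "\<eta> \<le> \<bar>real m * b - real m' * b - of_int i\<bar>"
    proof (cases "m > m'")
      case True
      then have "\<eta> \<le> \<bar>real (m - m') * b - of_int i\<bar>" using that by (intro sep) auto
      then show ?thesis using True by (simp add: of_nat_diff algebra_simps)
    next
      case False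
      then have "\<eta> \<le> \<bar>real (m' - m) * b - of_int (- i)\<bar>" using that by (intro sep) auto
      also have "real (m' - m) * b - of_int (- i) = - (real m * b - real m' * b - of_int i)"
        using False by (simp add: of_nat_diff algebra_simps)
      finally show ?thesis by simp
    qed
  qed
  show "(\<Sum>m\<in>{0..<L}. ?f m) \<le> 2 * (1 / \<eta>\<^sup>2) * suminf (pterm 2)"
  proof -
    have "(\<Sum>m\<in>{0..<L}. ?f m) \<le> 2 * (\<Sum>i. (1 / \<eta>\<^sup>2) * pterm 2 i)"
    proof (rule sum_spaced_points_le[where v=v and \<eta>=\<eta>])
      show "summable (\<lambda>i. (1 / \<eta>\<^sup>2) * pterm 2 i)" by (intro summable_mult summable_pterm) simp
      show "\<eta> \<le> \<bar>v m - v m'\<bar>" if "m \<in> {0..<L}" "m' \<in> {0..<L}" "m \<noteq> m'" for m m'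
        using vsep[of m 0 m'] that by simp
      fix m i assume m: "m \<in> {0..<L}" and i: "real i * \<eta> \<le> \<bar>v m\<bar>"
      show "?f m \<le> 1 / \<eta>\<^sup>2 * pterm 2 i"
      proof (cases "m = 0")
        case False
        \<comment> \<open>In the block starting at \<open>0\<close> the index \<open>m\<close> is
          itself an admissible \<open>j\<close>. The central cell is therefore empty, and no help
          from the \<open>sinh\<close> part is needed.\<close>
        have "\<eta> \<le> \<bar>v m\<bar>" unfolding v_def near_int_def using m False by (intro sep) auto
        then have w: "max 1 (real i) * \<eta> \<le> \<bar>v m\<bar>" using i by (simp add: max_def)
        have "(max 1 (real i) * \<eta>)\<^sup>2 \<le> \<bar>v m\<bar>\<^sup>2" using w assms(1) by (intro power_mono mult_nonneg_nonneg) auto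
        also have "\<dots> \<le> 4 * ((v m)\<^sup>2 + (sinh (pi * (real m * a)))\<^sup>2)"
          using zero_le_power2[of "v m"] zero_le_power2[of "sinh (pi * (real m * a))"] unfolding power2_abs by argo
        finally have "1 / (4 * ((v m)\<^sup>2 + (sinh (pi * (real m * a)))\<^sup>2)) \<le> 1 / (max 1 (real i) * \<eta>)\<^sup>2"
          by (intro frac_le) (use assms(1) in auto)
        also have "\<dots> = 1 / \<eta>\<^sup>2 * pterm 2 i"
          by (simp add: pterm_def powr_minus_divide power_mult_distrib)
        finally show ?thesis using sig_term_le[OF assms(3), of m b] False unfolding v_def by simp
      qed simp
    qed (use assms in auto)
    also have "\<dots> = 2 * (1 / \<eta>\<^sup>2) * suminf (pterm 2)"
      using suminf_mult[OF summable_pterm[of 2], of "1 / \<eta>\<^sup>2"] by simp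
    finally show ?thesis .
  qed
  show "(\<Sum>m\<in>{k * L..<k * L + L}. ?f m) \<le>
    2 * (1 / (real L * a)\<^sup>2) * pterm 2 k +
    2 * suminf (pterm (1 + \<delta>)) * (\<eta> * (real L * a)) powr (- 1 - \<delta>) * pterm (1 + \<delta>) k"
  proof -
    define y where "y = real k * (real L * a)"
    have y: "y > 0" unfolding y_def using assms by simp
    \<comment> \<open>Chosen so that raising \<open>y powr e\<close> to the weight
      \<open>1 - \<delta>\<close> leaves \<open>y powr (1 + \<delta>)\<close>; the condition
      \<open>\<delta> \<le> 1/3\<close> is exactly \<open>e \<le> 2\<close>.\<close>
    define e where "e = (1 + \<delta>) / (1 - \<delta>)"
    have e: "1 \<le> e" "e \<le> 2" "e * (1 - \<delta>) = 1 + \<delta>" unfolding e_def using assms by (auto simp: field_simps)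
    have sy: "y \<le> sinh y" "y powr e / 4 \<le> sinh y" using sinh_ge_powr[OF y e(1,2)] by auto
    \<comment> \<open>In the central cell the spacing says nothing, so only the height is used
      there; that is the extra term at \<open>i = 0\<close>.\<close>
    define G where "G i = (if i = 0 then 1 / y\<^sup>2 else 0) + (\<eta> * y) powr (- 1 - \<delta>) * pterm (1 + \<delta>) i" for i
    have s0: "(\<lambda>i. if i = (0::nat) then 1 / y\<^sup>2 else 0) sums (1 / y\<^sup>2)" using sums_single[of 0 "\<lambda>_. 1 / y\<^sup>2"] by simp
    have sp: "summable (pterm (1 + \<delta>))" using assms by (intro summable_pterm) auto
    have sG: "G sums (1 / y\<^sup>2 + (\<eta> * y) powr (- 1 - \<delta>) * suminf (pterm (1 + \<delta>)))"
      unfolding G_def by (intro sums_add s0 sums_mult summable_sums sp)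
    have "(\<Sum>m\<in>{k * L..<k * L + L}. ?f m) \<le> 2 * suminf G"
    proof (rule sum_spaced_points_le[where v=v and \<eta>=\<eta>])
      show "G i \<ge> 0" for i unfolding G_def by simp
      fix m i assume m: "m \<in> {k * L..<k * L + L}" and i: "real i * \<eta> \<le> \<bar>v m\<bar>"
      have m0: "m > 0" using m assms by (auto intro: less_le_trans[of 0 "k * L"])
      have "real (k * L) * a \<le> real m * a" using m assms(3) by (intro mult_right_mono) (auto simp flip: of_nat_mult)
      then have "y \<le> real m * a" unfolding y_def by (simp add: mult.assoc)
      also have "\<dots> \<le> pi * (real m * a)"
        using mult_right_mono[of 1 pi "real m * a"] pi_gt3 assms(3) by simp
      finally have "sinh y \<le> sinh (pi * (real m * a))" by simp
      then have sm: "(sinh y)\<^sup>2 \<le> (sinh (pi * (real m * a)))\<^sup>2" using y by (intro power_mono) auto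
      have fm: "?f m \<le> 1 / (4 * ((v m)\<^sup>2 + (sinh (pi * (real m * a)))\<^sup>2))"
        unfolding v_def by (rule sig_term_le[OF assms(3) m0])
      show "?f m \<le> G i"
      proof (cases "i = 0")
        case True
        have "y\<^sup>2 \<le> (sinh y)\<^sup>2" using sy y by (intro power_mono) auto
        then have "y\<^sup>2 \<le> 4 * ((v m)\<^sup>2 + (sinh (pi * (real m * a)))\<^sup>2)"
        proof -
          have "p \<le> 4 * (w + q)" if "p \<le> q" "0 \<le> p" "0 \<le> w" for p q w :: real using that by simp
          then show ?thesis
            using order_trans[OF \<open>y\<^sup>2 \<le> (sinh y)\<^sup>2\<close> sm] zero_le_power2[of "v m"] zero_le_power2[of y] by blast
        qed
        then have "1 / (4 * ((v m)\<^sup>2 + (sinh (pi * (real m * a)))\<^sup>2)) \<le> 1 / y\<^sup>2"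
          using y by (intro frac_le) auto
        with fm have "?f m \<le> 1 / y\<^sup>2" by (rule order_trans)
        also have "\<dots> \<le> G i" unfolding G_def using True by simp
        finally show ?thesis .
      next
        case False
        \<comment> \<open>\<open>A\<close> is the horizontal and \<open>B\<close> the vertical part.
          The weight \<open>(1 + \<delta>) / 2\<close> on the square \<open>A\<close> gives exponent
          \<open>1 + \<delta>\<close> in \<open>i\<close>, just above the threshold of
          convergence.\<close>
        define A where "A = (real i * \<eta>)\<^sup>2"
        define B where "B = (sinh y)\<^sup>2"
        have iy: "real i * \<eta> > 0" using False assms(1) by simp
        have "sinh y > 0" using y by simp
        then have AB: "A > 0" "B > 0" unfolding A_def B_def using zero_less_power iy by blast+
        have "A \<le> \<bar>v m\<bar>\<^sup>2" unfolding A_def using i iy by (intro power_mono) auto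
        then have "A + B \<le> (v m)\<^sup>2 + (sinh (pi * (real m * a)))\<^sup>2" using sm unfolding B_def by simp
        moreover have "A powr ((1 + \<delta>) / 2) * B powr (1 - (1 + \<delta>) / 2) \<le> A + B"
          using assms AB by (intro weighted_product_le_sum) auto
        moreover have "A powr ((1 + \<delta>) / 2) = (real i * \<eta>) powr (1 + \<delta>)"
        proof -
          have "real 2 * ((1 + \<delta>) / 2) = 1 + \<delta>" by simp
          then show ?thesis unfolding A_def powr_realpow[OF iy, symmetric] powr_powr by (simp only:)
        qed
        moreover have "B powr (1 - (1 + \<delta>) / 2) \<ge> y powr (1 + \<delta>) / 4"
        proof -
          have sp: "sinh y > 0" using y by simp
          have "B powr (1 - (1 + \<delta>) / 2) = sinh y powr (1 - \<delta>)"
          proof -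
            have "real 2 * (1 - (1 + \<delta>) / 2) = 1 - \<delta>" by (simp add: field_simps)
            then show ?thesis unfolding B_def powr_realpow[OF sp, symmetric] powr_powr by (simp only:)
          qed
          also have "\<dots> \<ge> (y powr e / 4) powr (1 - \<delta>)" using sy assms by (intro powr_mono2) auto
          also have "(y powr e / 4) powr (1 - \<delta>) = y powr (1 + \<delta>) / 4 powr (1 - \<delta>)"
            by (simp add: powr_divide powr_powr e(3))
          also have "4 powr (1 - \<delta>) \<le> (4 :: real) powr 1" using assms by (intro powr_mono) auto
          then have "y powr (1 + \<delta>) / 4 \<le> y powr (1 + \<delta>) / 4 powr (1 - \<delta>)"
            by (intro divide_left_mono) auto
          finally show ?thesis by linarith
        qed
        then have "(real i * \<eta>) powr (1 + \<delta>) * (y powr (1 + \<delta>) / 4) \<le> (real i * \<eta>) powr (1 + \<delta>) * B powr (1 - (1 + \<delta>) / 2)"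
          by (intro mult_left_mono) auto
        ultimately have "(real i * \<eta>) powr (1 + \<delta>) * y powr (1 + \<delta>) \<le> 4 * ((v m)\<^sup>2 + (sinh (pi * (real m * a)))\<^sup>2)"
          by simp
        then have "1 / (4 * ((v m)\<^sup>2 + (sinh (pi * (real m * a)))\<^sup>2)) \<le> 1 / ((real i * \<eta>) powr (1 + \<delta>) * y powr (1 + \<delta>))"
          by (intro frac_le) (use False assms(1) y in auto)
        also have "\<dots> = (\<eta> * y) powr (- (1 + \<delta>)) * pterm (1 + \<delta>) i"
          using iy y assms(1) False by (simp add: pterm_pos powr_mult powr_minus_divide[of _ "1 + \<delta>", simplified])
        finally show ?thesis using fm False unfolding G_def by simp
      qed
    qed (use assms vsep sG in \<open>auto simp: sums_iff\<close>)
    also have "suminf G = 1 / y\<^sup>2 + (\<eta> * y) powr (- 1 - \<delta>) * suminf (pterm (1 + \<delta>))"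
      using sG by (simp add: sums_iff)
    also have "1 / y\<^sup>2 = 1 / (real L * a)\<^sup>2 * pterm 2 k"
      using assms(6) by (simp add: y_def pterm_pos powr_minus_divide power_mult_distrib)
    also have "(\<eta> * y) powr (- 1 - \<delta>) = (\<eta> * (real L * a)) powr (- 1 - \<delta>) * pterm (1 + \<delta>) k"
      using assms by (simp add: y_def pterm_pos powr_mult)
    finally show ?thesis by (simp add: algebra_simps)
  qed
qed

text \<open>Sums the block estimates. The initial block yields \<open>1 / \<eta>^2\<close>; over the
  others the block number runs through convergent zeta series of orders \<open>2\<close> and
  \<open>1 + \<delta>\<close>.\<close>

lemma sigser_spaced_bound:
  assumes "0 < \<delta>" "\<delta> \<le> 1/3"
  shows "\<exists>C\<ge>0. \<forall>\<eta> L a b. \<eta> > 0 \<longrightarrow> L \<ge> 1 \<longrightarrow> a > 0 \<longrightarrow>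
    (\<forall>j (i::int). 1 \<le> j \<longrightarrow> j < L \<longrightarrow> \<eta> \<le> \<bar>real j * b - of_int i\<bar>) \<longrightarrow>
    norm (sigser (Complex b a)) \<le> C * (1 / \<eta>\<^sup>2 + 1 / (real L * a)\<^sup>2 + (\<eta> * (real L * a)) powr (- 1 - \<delta>))"
proof -
  define Z Y where "Z = suminf (pterm 2)" and "Y = suminf (pterm (1 + \<delta>))"
  have s2: "summable (pterm 2)" and sd: "summable (pterm (1 + \<delta>))"
    using assms by (auto intro!: summable_pterm)
  have ZY: "Z \<ge> 0" "Y \<ge> 0" unfolding Z_def Y_def using s2 sd by (auto intro: suminf_nonneg)
  define C where "C = 2 * Z + 2 * Y * Y"
  have C: "C \<ge> 0" unfolding C_def using ZY by auto
  have "norm (sigser (Complex b a)) \<le> C * (1 / \<eta>\<^sup>2 + 1 / (real L * a)\<^sup>2 + (\<eta> * (real L * a)) powr (- 1 - \<delta>))"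
    if as: "\<eta> > 0" "L \<ge> 1" "a > 0" and sep: "\<forall>j (i::int). 1 \<le> j \<longrightarrow> j < L \<longrightarrow> \<eta> \<le> \<bar>real j * b - of_int i\<bar>"
    for \<eta> a b :: real and L :: nat
  proof -
    let ?f = "sig_term (Complex b a)"
    define P Q R where "P = 1 / \<eta>\<^sup>2" and "Q = 1 / (real L * a)\<^sup>2" and "R = (\<eta> * (real L * a)) powr (- 1 - \<delta>)"
    have PQR: "P \<ge> 0" "Q \<ge> 0" "R \<ge> 0" unfolding P_def Q_def R_def by auto
    have sep': "\<And>j (i::int). 1 \<le> j \<Longrightarrow> j < L \<Longrightarrow> \<eta> \<le> \<bar>real j * b - of_int i\<bar>" using sep by blast
    define H where "H k = (if k = 0 then 2 * P * Z else 0) + (2 * Q * pterm 2 k + 2 * Y * R * pterm (1 + \<delta>) k)" for k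
    have s0: "(\<lambda>k. if k = (0::nat) then 2 * P * Z else 0) sums (2 * P * Z)" using sums_single[of 0 "\<lambda>_. 2 * P * Z"] by simp
    have sH: "H sums (2 * P * Z + (2 * Q * Z + 2 * Y * R * Y))"
      unfolding H_def using s2 sd by (intro sums_add s0 sums_mult) (auto simp: Z_def Y_def summable_sums)
    have H0: "H k \<ge> 0" for k unfolding H_def using PQR ZY by auto
    have blk: "(\<Sum>m\<in>{k * L..<k * L + L}. ?f m) \<le> H k" for k
    proof (cases "k = 0")
      case True
      have "2 * Q * pterm 2 0 + 2 * Y * R * pterm (1 + \<delta>) 0 \<ge> 0" using PQR ZY by auto
      then show ?thesis
        using sig_term_block_le(2)[OF as assms zero_less_one sep'] True
        unfolding H_def P_def Z_def by simp
    next
      case False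
      then have "k > 0" by simp
      from sig_term_block_le(1)[OF as assms this sep'] show ?thesis
        using False unfolding H_def Q_def R_def Y_def by simp
    qed
    have z: "Im (Complex b a) > 0" using as by simp
    have "norm (sigser (Complex b a)) \<le> suminf ?f" by (rule sigser_le_sig_term[OF z])
    also have "\<dots> \<le> suminf H"
    proof (rule suminf_le_const[OF sigser_le_sig_term(1)[OF z]])
      fix n
      have "sum ?f {..<n} \<le> sum ?f {..<n * L}" using as(2) by (intro sum_mono2) auto
      also have "\<dots> = (\<Sum>k<n. \<Sum>m\<in>{k * L..<k * L + L}. ?f m)" by (rule sum.nat_group[symmetric])
      also have "\<dots> \<le> (\<Sum>k<n. H k)" by (intro sum_mono blk)
      also have "\<dots> \<le> suminf H" using sH H0 by (intro sum_le_suminf) (auto simp: sums_iff)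
      finally show "sum ?f {..<n} \<le> suminf H" .
    qed
    also have "\<dots> = 2 * P * Z + (2 * Q * Z + 2 * Y * R * Y)" using sH by (simp add: sums_iff)
    also have "\<dots> \<le> C * (P + Q + R)"
    proof -
      have "C * (P + Q + R) - (2 * P * Z + (2 * Q * Z + 2 * Y * R * Y)) = 2 * Y * Y * P + 2 * Y * Y * Q + 2 * Z * R"
        unfolding C_def by (simp add: algebra_simps)
      moreover have "2 * Y * Y * P + 2 * Y * Y * Q + 2 * Z * R \<ge> 0" using PQR ZY by auto
      ultimately show ?thesis by linarith
    qed
    finally show ?thesis unfolding P_def Q_def R_def .
  qed
  then show ?thesis using C by blast
qed

text \<open>Blocks of length \<open>L\<close> comparable to \<open>R powr (- 1 / r)\<close> keep the
  multiples of \<open>Re z\<close> separated by \<open>L R\<close>. All three terms of the spaced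
  bound are then at most \<open>1 / L^2\<close> times the trivial bound, and \<open>1 / L^2\<close>
  is of order \<open>R powr (2 / r)\<close>.\<close>

lemma sigser_near_diophantine:
  assumes "0 < \<delta>" "\<delta> \<le> 1/3" "r \<ge> 1" "c > 0"
    and dio: "\<forall>m k. 1 \<le> m \<longrightarrow> c * of_int m powr (1 - r) \<le> \<bar>of_int m * x - of_int k\<bar>"
  shows "\<exists>C\<ge>0. \<forall>z R. Im z > 0 \<longrightarrow> Im z \<le> R \<longrightarrow> \<bar>Re z - x\<bar> \<le> R \<longrightarrow>
    norm (sigser z) \<le> C * Im z powr (- 2 - 2 * \<delta>) * R powr (2 / r)"
proof -
  obtain C1 where C1: "C1 \<ge> 0" "\<forall>z. Im z > 0 \<longrightarrow> norm (sigser z) \<le> C1 * Im z powr (- 2 - 2 * \<delta>)"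
    using sigser_trivial_bound[of \<delta>] assms by auto
  obtain C2 where C2: "C2 \<ge> 0" "\<forall>\<eta> L a b. \<eta> > 0 \<longrightarrow> L \<ge> 1 \<longrightarrow> a > 0 \<longrightarrow>
    (\<forall>j (i::int). 1 \<le> j \<longrightarrow> j < L \<longrightarrow> \<eta> \<le> \<bar>real j * b - of_int i\<bar>) \<longrightarrow>
    norm (sigser (Complex b a)) \<le> C2 * (1 / \<eta>\<^sup>2 + 1 / (real L * a)\<^sup>2 + (\<eta> * (real L * a)) powr (- 1 - \<delta>))"
    using sigser_spaced_bound[OF assms(1,2)] by auto
  \<comment> \<open>For \<open>R \<ge> R0\<close> the factor \<open>R powr (2 / r)\<close> is
    bounded below and the trivial bound suffices; below \<open>R0\<close> one has
    \<open>R < 1\<close> and \<open>c / (2 * R) \<ge> 1\<close>.\<close>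
  define R0 where "R0 = min 1 (c / 2)"
  have R0: "R0 > 0" "R0 \<le> 1" "R0 \<le> c / 2" unfolding R0_def using assms by auto
  define C where "C = C1 / R0 powr (2 / r) + 12 * C2 * (2 / c) powr (2 / r)"
  have nn: "C1 / R0 powr (2 / r) \<ge> 0" "12 * C2 * (2 / c) powr (2 / r) \<ge> 0" using C1 C2 by auto
  have "norm (sigser z) \<le> C * Im z powr (- 2 - 2 * \<delta>) * R powr (2 / r)"
    if z: "Im z > 0" "Im z \<le> R" "\<bar>Re z - x\<bar> \<le> R" for z R
  proof (cases "R \<ge> R0")
    case True
    have "norm (sigser z) \<le> C1 * Im z powr (- 2 - 2 * \<delta>)" using C1 z by auto
    also have "\<dots> = C1 / R0 powr (2 / r) * Im z powr (- 2 - 2 * \<delta>) * R0 powr (2 / r)" using R0 by simp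
    also have "\<dots> \<le> C1 / R0 powr (2 / r) * Im z powr (- 2 - 2 * \<delta>) * R powr (2 / r)"
      using True R0 assms C1 by (intro mult_left_mono powr_mono2 mult_nonneg_nonneg nn) auto
    also have "\<dots> \<le> C * Im z powr (- 2 - 2 * \<delta>) * R powr (2 / r)"
      unfolding C_def using nn by (intro mult_right_mono) auto
    finally show ?thesis .
  next
    case False
    define a b where "a = Im z" and "b = Re z"
    have zab: "z = Complex b a" by (simp add: a_def b_def)
    have a: "a > 0" "a \<le> R" and b: "\<bar>b - x\<bar> \<le> R" using z by (auto simp: a_def b_def)
    have R: "R > 0" "R < 1" "R < c / 2" using a False R0 by linarith+
    \<comment> \<open>Solves \<open>c X powr (1 - r) = 2 X R\<close>. For \<open>j \<le> X\<close>
      the Diophantine bound is at least \<open>2 X R\<close>, and replacing \<open>x\<close> by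
      \<open>b\<close> costs at most \<open>j R \<le> X R\<close>.\<close>
    define X where "X = (c / (2 * R)) powr (1 / r)"
    have cR: "c / (2 * R) \<ge> 1" using R by (simp add: field_simps)
    then have X1: "X \<ge> 1" unfolding X_def using assms by (intro ge_one_powr_ge_zero) auto
    have Xr: "X powr r = c / (2 * R)" unfolding X_def using cR assms R by (simp add: powr_powr)
    define L where "L = nat \<lfloor>X\<rfloor>"
    have "real L = of_int \<lfloor>X\<rfloor>" "\<lfloor>X\<rfloor> \<ge> 1" unfolding L_def using X1 by simp_all
    then have L: "L \<ge> 1" "real L \<le> X" "X \<le> 2 * real L" by linarith+
    define \<eta> where "\<eta> = real L * R"
    have eta: "\<eta> > 0" unfolding \<eta>_def using L R by auto
    have sep: "\<eta> \<le> \<bar>real j * b - of_int i\<bar>" if j: "1 \<le> j" "j < L" for j and i :: int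
    proof -
      have jX: "real j \<le> X" "real j \<ge> 1" using j L by auto
      have "c * real j powr (1 - r) \<le> \<bar>real j * x - of_int i\<bar>" using dio[rule_format, of "int j" i] j by simp
      also have "\<dots> \<le> \<bar>real j * b - of_int i\<bar> + real j * \<bar>b - x\<bar>"
      proof -
        have "real j * x - of_int i = (real j * b - of_int i) - real j * (b - x)" by (simp add: algebra_simps)
        then show ?thesis using abs_triangle_ineq4[of "real j * b - of_int i" "real j * (b - x)"] by (simp add: abs_mult)
      qed
      also have "real j * \<bar>b - x\<bar> \<le> real j * R" using b by (intro mult_left_mono) auto
      finally have 1: "c * real j powr (1 - r) - real j * R \<le> \<bar>real j * b - of_int i\<bar>" by linarith
      have "X powr (1 - r) \<le> real j powr (1 - r)" using jX assms by (intro powr_mono2') auto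
      moreover have "X powr (1 - r) = X * (2 * R / c)"
        using X1 Xr by (simp add: powr_diff)
      ultimately have "c * (X * (2 * R / c)) \<le> c * real j powr (1 - r)" using assms by (intro mult_left_mono) auto
      then have "2 * (X * R) \<le> c * real j powr (1 - r)" using assms by simp
      moreover have "real j * R \<le> X * R" "real L * R \<le> X * R" using jX L R by (auto intro: mult_right_mono)
      ultimately show ?thesis using 1 unfolding \<eta>_def by linarith
    qed
    have La: "real L * a > 0" using L a by auto
    have B: "norm (sigser z) \<le> C2 * (1 / \<eta>\<^sup>2 + 1 / (real L * a)\<^sup>2 + (\<eta> * (real L * a)) powr (- 1 - \<delta>))"
      unfolding zab using C2(2) eta L(1) a(1) sep by blast
    define K where "K = (1 / (real L)\<^sup>2) * a powr (- 2 - 2 * \<delta>)"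
    have K1: "1 / (real L * a)\<^sup>2 \<le> K"
    proof -
      have "a powr (- 2) \<le> a powr (- 2 - 2 * \<delta>)" using a R assms by (intro powr_mono') auto
      moreover have "a powr (- 2) = 1 / a\<^sup>2" using a by (simp add: powr_minus_divide)
      ultimately have "1 / (real L)\<^sup>2 * (1 / a\<^sup>2) \<le> K" unfolding K_def by (intro mult_left_mono) auto
      then show ?thesis by (simp add: power_mult_distrib)
    qed
    have LaE: "real L * a \<le> \<eta>" unfolding \<eta>_def using a by (intro mult_left_mono) auto
    have "(real L * a)\<^sup>2 \<le> \<eta>\<^sup>2" using LaE La by (intro power_mono) auto
    then have "1 / \<eta>\<^sup>2 \<le> 1 / (real L * a)\<^sup>2" by (intro frac_le) (use L a in auto)
    then have K2: "1 / \<eta>\<^sup>2 \<le> K" using K1 by linarith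
    have K3: "(\<eta> * (real L * a)) powr (- 1 - \<delta>) \<le> K"
    proof -
      have "(real L * a) * (real L * a) \<le> \<eta> * (real L * a)" using LaE La by (intro mult_right_mono) auto
      then have "(\<eta> * (real L * a)) powr (- 1 - \<delta>) \<le> ((real L * a) * (real L * a)) powr (- 1 - \<delta>)"
        using La assms by (intro powr_mono2') auto
      also have "\<dots> = (real L * a) powr (- 2 - 2 * \<delta>)"
      proof -
        have "(u * u) powr (- 1 - \<delta>) = u powr (- 2 - 2 * \<delta>)" if "u > 0" for u :: real
          using that by (simp add: powr_mult flip: powr_add)
        then show ?thesis using La by blast
      qed
      also have "\<dots> = real L powr (- 2 - 2 * \<delta>) * a powr (- 2 - 2 * \<delta>)" using L a by (simp add: powr_mult)
      also have "\<dots> \<le> (1 / (real L)\<^sup>2) * a powr (- 2 - 2 * \<delta>)"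
      proof (rule mult_right_mono)
        have "real L powr (- 2 - 2 * \<delta>) \<le> real L powr (- 2)" using L assms by (intro powr_mono) auto
        also have "real L powr (- 2) = 1 / (real L)\<^sup>2" using L by (simp add: powr_minus_divide)
        finally show "real L powr (- 2 - 2 * \<delta>) \<le> 1 / (real L)\<^sup>2" .
      qed simp
      finally show ?thesis unfolding K_def .
    qed
    have "norm (sigser z) \<le> C2 * (3 * K)"
      using B by (rule order_trans) (use K1 K2 K3 C2 in \<open>intro mult_left_mono; linarith\<close>)
    also have "K \<le> 4 * (2 / c) powr (2 / r) * R powr (2 / r) * a powr (- 2 - 2 * \<delta>)"
    proof -
      have "X\<^sup>2 \<le> (2 * real L)\<^sup>2" using L X1 by (intro power_mono) auto
      then have "1 / (real L)\<^sup>2 \<le> 4 / X\<^sup>2" using L X1 by (simp add: field_simps)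
      also have "X\<^sup>2 = (c / (2 * R)) powr (2 / r)"
        unfolding X_def using cR by (simp add: power2_eq_square flip: powr_add)
      also have "4 / (c / (2 * R)) powr (2 / r) = 4 * ((2 / c) powr (2 / r) * R powr (2 / r))"
        using R assms by (simp add: powr_divide powr_mult)
      finally show ?thesis unfolding K_def by (intro mult_right_mono) auto
    qed
    then have "C2 * (3 * K) \<le> C2 * (3 * (4 * (2 / c) powr (2 / r) * R powr (2 / r) * a powr (- 2 - 2 * \<delta>)))"
      using C2 by (intro mult_left_mono) auto
    also have "\<dots> = 12 * C2 * (2 / c) powr (2 / r) * Im z powr (- 2 - 2 * \<delta>) * R powr (2 / r)"
      by (simp add: a_def)
    also have "\<dots> \<le> C * Im z powr (- 2 - 2 * \<delta>) * R powr (2 / r)"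
      unfolding C_def using nn by (intro mult_right_mono) auto
    finally show ?thesis .
  qed
  moreover have "C \<ge> 0" unfolding C_def using nn by linarith
  ultimately show ?thesis by blast
qed

text \<open>\<open>\<theta>\<close> stands for \<open>2 / r\<close>. The value \<open>0\<close>
  records the trivial bound, which is what remains when \<open>mu x\<close> is infinite.\<close>

theorem sigser_near_irrational:
  assumes "x \<notin> \<rat>" "0 < \<delta>" "\<delta> \<le> 1/3" "\<theta> = 0 \<or> 0 < \<theta> \<and> \<theta> \<le> 1 \<and> mu x < ereal (2 / \<theta>)"
  shows "\<exists>C\<ge>0. \<forall>z R. Im z > 0 \<longrightarrow> Im z \<le> R \<longrightarrow> \<bar>Re z - x\<bar> \<le> R \<longrightarrow>
    norm (sigser z) \<le> C * Im z powr (- 2 - 2 * \<delta>) * R powr \<theta>"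
  using assms(4)
proof
  assume "\<theta> = 0"
  obtain C1 where C1: "C1 \<ge> 0" "\<forall>z. Im z > 0 \<longrightarrow> norm (sigser z) \<le> C1 * Im z powr (- 2 - 2 * \<delta>)"
    using sigser_trivial_bound[of \<delta>] assms by auto
  have "norm (sigser z) \<le> C1 * Im z powr (- 2 - 2 * \<delta>) * R powr \<theta>" if "Im z > 0" "Im z \<le> R" for z R
    using C1(2)[rule_format, OF that(1)] that \<open>\<theta> = 0\<close> by simp
  then show ?thesis using C1(1) by blast
next
  assume t: "0 < \<theta> \<and> \<theta> \<le> 1 \<and> mu x < ereal (2 / \<theta>)"
  then have r: "2 / \<theta> \<ge> 1" by (simp add: field_simps)
  obtain c where c: "c > 0" "\<forall>m k. 1 \<le> m \<longrightarrow> c * of_int m powr (1 - 2 / \<theta>) \<le> \<bar>of_int m * x - of_int k\<bar>"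
    using diophantine_lower_bound[OF assms(1) _ r] t by blast
  have "2 / (2 / \<theta>) = \<theta>" using t by simp
  then show ?thesis using sigser_near_diophantine[OF assms(2,3) r c(1,2)] by simp
qed

section \<open>Mellin transforms\<close>

text \<open>The Mellin kernel: \<open>y powr (\<sigma> - 1)\<close> on the positive half line, cut off to \<open>0\<close> elsewhere since
  \<open>powr\<close> does not vanish on negative reals.\<close>

definition pw :: "real \<Rightarrow> real \<Rightarrow> real" where
  "pw \<sigma> y = (if y > 0 then y powr (\<sigma> - 1) else 0)"

lemma pw_nonneg [simp]: "pw \<sigma> y \<ge> 0"
  by (simp add: pw_def)

lemma borel_measurable_pw [measurable]: "pw \<sigma> \<in> borel_measurable borel"
  unfolding pw_def[abs_def] by measurable

lemma has_bochner_integral_nonneg_lborel: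
  fixes f :: "real \<Rightarrow> real"
  assumes "f \<in> borel_measurable borel" "\<And>x. 0 \<le> f x" "(f has_integral I) UNIV"
  shows "has_bochner_integral lborel f I"
proof (rule has_bochner_integral_nn_integral)
  show "integral\<^sup>N lborel f = ennreal I" by (rule nn_integral_has_integral_lborel[OF assms])
  show "0 \<le> I" using has_integral_nonneg[OF assms(3)] assms(2) by blast
qed (use assms in auto)

lemma pw_exp_integral:
  assumes "\<sigma> > 0" "l > 0"
  shows "has_bochner_integral lborel (\<lambda>y. pw \<sigma> y * exp (- l * y)) (Gamma \<sigma> / l powr \<sigma>)"
proof -
  have "((\<lambda>t. if t \<in> {0..} then t powr (\<sigma> - 1) / exp t else 0) has_integral Gamma \<sigma>) UNIV"
    using Gamma_integral_real[OF assms(1)] by (simp only: has_integral_restrict_UNIV)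
  also have "(\<lambda>t. if t \<in> {0..} then t powr (\<sigma> - 1) / exp t else 0) = (\<lambda>y. pw \<sigma> y * exp (- y))"
    by (auto simp: fun_eq_iff pw_def exp_minus divide_inverse)
  finally have "has_bochner_integral lborel (\<lambda>y. pw \<sigma> y * exp (- y)) (Gamma \<sigma>)"
    by (intro has_bochner_integral_nonneg_lborel) auto
  then have "has_bochner_integral lborel (\<lambda>y. pw \<sigma> (0 + l * y) * exp (- (0 + l * y))) (Gamma \<sigma> /\<^sub>R \<bar>l\<bar>)"
    using assms by (subst lborel_has_bochner_integral_real_affine_iff[symmetric]) auto
  then have h: "has_bochner_integral lborel (\<lambda>y. l powr (1 - \<sigma>) * (pw \<sigma> (0 + l * y) * exp (- (0 + l * y)))) (l powr (1 - \<sigma>) * (Gamma \<sigma> /\<^sub>R \<bar>l\<bar>))"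
    by (intro has_bochner_integral_mult_right)
  have "l powr (1 - \<sigma>) * (pw \<sigma> (0 + l * y) * exp (- (0 + l * y))) = pw \<sigma> y * exp (- l * y)" for y
  proof (cases "y > 0")
    case True
    have "l powr (1 - \<sigma>) * (l * y) powr (\<sigma> - 1) = (l powr (1 - \<sigma>) * l powr (\<sigma> - 1)) * y powr (\<sigma> - 1)"
      using assms True by (simp add: powr_mult)
    also have "l powr (1 - \<sigma>) * l powr (\<sigma> - 1) = 1" using assms by (simp flip: powr_add)
    finally show ?thesis using True assms by (simp add: pw_def)
  qed (use assms in \<open>simp add: pw_def zero_less_mult_iff\<close>)
  moreover have "l powr (1 - \<sigma>) * (Gamma \<sigma> /\<^sub>R \<bar>l\<bar>) = Gamma \<sigma> / l powr \<sigma>"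
    using assms by (simp add: powr_diff divide_inverse)
  ultimately show ?thesis using h by (simp only:)
qed

lemma e2pi_add_imaginary: "e2pi (of_nat n * (z + \<i> * of_real y)) = e2pi (of_nat n * z) * of_real (exp (- (2 * pi * real n) * y))"
proof -
  have "e2pi (of_nat n * (z + \<i> * of_real y)) = e2pi (of_nat n * z) * e2pi (of_nat n * (\<i> * of_real y))"
    by (simp add: distrib_left e2pi_add)
  also have "e2pi (of_nat n * (\<i> * of_real y)) = of_real (exp (- (2 * pi * real n) * y))"
    unfolding e2pi_def exp_of_real[symmetric] by (rule arg_cong[where f=exp]) (simp add: algebra_simps)
  finally show ?thesis .
qed

text \<open>Termwise Gamma integral. Up to a constant the summability hypothesis is that of the L1
  norms of the terms, so \<open>z\<close> may lie on the real axis, as \<open>sigdir_mellin\<close>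
  requires; \<open>ker_bound\<close> uses interior points.\<close>

theorem qser_mellin:
  assumes "tempered c" "c 0 = 0" "\<sigma> > 0" "Im z \<ge> 0"
    and s: "summable (\<lambda>n. norm (c n * e2pi (of_nat n * z)) / real n powr \<sigma>)"
  shows "integrable lborel (\<lambda>y. of_real (pw \<sigma> y) * qser c (z + \<i> * of_real y))"
    and "(LINT y|lborel. of_real (pw \<sigma> y) * qser c (z + \<i> * of_real y)) =
      of_real (Gamma \<sigma> / (2 * pi) powr \<sigma>) * (\<Sum>n. c n * e2pi (of_nat n * z) / of_real (real n powr \<sigma>))"
proof -
  define f where "f n y = of_real (pw \<sigma> y) * (c n * e2pi (of_nat n * (z + \<i> * of_real y)))" for n y
  define A where "A n = c n * e2pi (of_nat n * z)" for n
  have A0: "A 0 = 0" using assms(2) by (simp add: A_def)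
  have fA: "f n y = A n * of_real (pw \<sigma> y * exp (- (2 * pi * real n) * y))" for n y
    unfolding f_def A_def e2pi_add_imaginary by simp
  have hb: "has_bochner_integral lborel (f n) (A n * of_real (Gamma \<sigma> / (2 * pi * real n) powr \<sigma>))" for n
  proof (cases "n = 0")
    case False
    then show ?thesis unfolding fA[abs_def]
      by (intro has_bochner_integral_mult_right has_bochner_integral_of_real pw_exp_integral assms) auto
  next
    case True
    have "f 0 = (\<lambda>_. 0)" by (simp add: fA A0 fun_eq_iff)
    then show ?thesis using True A0 by (simp add: has_bochner_integral_zero)
  qed
  have hbn: "has_bochner_integral lborel (\<lambda>y. norm (f n y)) (norm (A n) * (Gamma \<sigma> / (2 * pi * real n) powr \<sigma>))" for n
  proof (cases "n = 0")
    case False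
    then have "has_bochner_integral lborel (\<lambda>y. norm (A n) * (pw \<sigma> y * exp (- (2 * pi * real n) * y))) (norm (A n) * (Gamma \<sigma> / (2 * pi * real n) powr \<sigma>))"
      by (intro has_bochner_integral_mult_right pw_exp_integral assms) auto
    moreover have "norm (A n) * (pw \<sigma> y * exp (- (2 * pi * real n) * y)) = norm (f n y)" for y
      unfolding fA norm_mult norm_of_real by simp
    ultimately show ?thesis by simp
  qed (simp add: fA A0 fun_eq_iff has_bochner_integral_zero)
  have i1: "\<And>n. integrable lborel (f n)" using hb by (simp add: has_bochner_integral_iff)
  have pos: "summable (\<lambda>n. norm (f n y))" for y
  proof (cases "y > 0")
    case True
    then have "summable (\<lambda>n. norm (c n * e2pi (of_nat n * (z + \<i> * of_real y))))"
      using assms(4) by (intro qser_summable assms) auto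
    then have "summable (\<lambda>n. pw \<sigma> y * norm (c n * e2pi (of_nat n * (z + \<i> * of_real y))))" by (rule summable_mult)
    then show ?thesis by (simp add: f_def norm_mult)
  qed (simp add: f_def pw_def)
  then have i2: "AE y in lborel. summable (\<lambda>n. norm (f n y))" by simp
  have pr: "(2 * pi * real n) powr \<sigma> = (2 * pi) powr \<sigma> * real n powr \<sigma>" for n by (simp add: powr_mult)
  have "summable (\<lambda>n. (Gamma \<sigma> / (2 * pi) powr \<sigma>) * (norm (A n) / real n powr \<sigma>))"
    using s unfolding A_def by (rule summable_mult)
  moreover have "(LINT y|lborel. norm (f n y)) = (Gamma \<sigma> / (2 * pi) powr \<sigma>) * (norm (A n) / real n powr \<sigma>)" for n
  proof -
    have "(LINT y|lborel. norm (f n y)) = norm (A n) * (Gamma \<sigma> / (2 * pi * real n) powr \<sigma>)"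
      using hbn[of n] unfolding has_bochner_integral_iff by (rule conjunct2)
    then show ?thesis unfolding pr by (simp add: mult_ac)
  qed
  ultimately have i3: "summable (\<lambda>n. LINT y|lborel. norm (f n y))" by (simp only:)
  have q: "(\<Sum>n. f n y) = of_real (pw \<sigma> y) * qser c (z + \<i> * of_real y)" for y
  proof (cases "y > 0")
    case True
    then have "summable (\<lambda>n. c n * e2pi (of_nat n * (z + \<i> * of_real y)))"
      using assms(4) by (intro summable_norm_cancel[OF qser_summable] assms) auto
    then show ?thesis unfolding f_def qser_def by (rule suminf_mult)
  qed (simp add: f_def pw_def)
  show "integrable lborel (\<lambda>y. of_real (pw \<sigma> y) * qser c (z + \<i> * of_real y))"
    using integrable_suminf[OF i1 i2 i3] by (simp add: q)
  have "(LINT y|lborel. (\<Sum>n. f n y)) = (\<Sum>n. A n * of_real (Gamma \<sigma> / (2 * pi * real n) powr \<sigma>))"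
    using integral_suminf[OF i1 i2 i3] hb by (simp add: has_bochner_integral_iff)
  also have "\<dots> = (\<Sum>n. of_real (Gamma \<sigma> / (2 * pi) powr \<sigma>) * (A n / of_real (real n powr \<sigma>)))"
    unfolding pr by (simp add: mult_ac)
  also have "\<dots> = of_real (Gamma \<sigma> / (2 * pi) powr \<sigma>) * (\<Sum>n. A n / of_real (real n powr \<sigma>))"
  proof (rule suminf_mult)
    have "summable (\<lambda>n. norm (A n / of_real (real n powr \<sigma>)))"
      using s unfolding A_def by (simp add: norm_divide)
    then show "summable (\<lambda>n. A n / of_real (real n powr \<sigma>))" by (rule summable_norm_cancel)
  qed
  finally show "(LINT y|lborel. of_real (pw \<sigma> y) * qser c (z + \<i> * of_real y)) =
      of_real (Gamma \<sigma> / (2 * pi) powr \<sigma>) * (\<Sum>n. c n * e2pi (of_nat n * z) / of_real (real n powr \<sigma>))"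
    by (simp add: q A_def)
qed

lemma integrable_powr_near_0:
  assumes "p > -1" "a \<ge> 0"
  shows "integrable lborel (\<lambda>u::real. if 0 < u \<and> u \<le> a then u powr p else 0)"
proof -
  have "((\<lambda>u. if u \<in> {0..a} then u powr p else 0) has_integral (a powr (p + 1) / (p + 1))) UNIV"
    using has_integral_powr_from_0[OF assms] by (simp only: has_integral_restrict_UNIV)
  also have "(\<lambda>u. if u \<in> {0..a} then u powr p else 0) = (\<lambda>u. if 0 < u \<and> u \<le> a then u powr p else 0)"
    by (auto simp: fun_eq_iff)
  finally have "has_bochner_integral lborel (\<lambda>u. if 0 < u \<and> u \<le> a then u powr p else 0) (a powr (p + 1) / (p + 1))"
    by (intro has_bochner_integral_nonneg_lborel) auto
  then show ?thesis by (simp add: has_bochner_integral_iff)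
qed

lemma integral_powr_at_top:
  assumes "p < -1" "a > 0"
  shows "has_bochner_integral lborel (\<lambda>u::real. if u \<ge> a then u powr p else 0) (- (a powr (p + 1)) / (p + 1))"
proof -
  have "((\<lambda>u. if u \<in> {a..} then u powr p else 0) has_integral (-(a powr (p + 1)) / (p + 1))) UNIV"
    using has_integral_powr_to_inf[OF assms] by (simp only: has_integral_restrict_UNIV)
  also have "(\<lambda>u. if u \<in> {a..} then u powr p else 0) = (\<lambda>u. if u \<ge> a then u powr p else 0)"
    by (auto simp: fun_eq_iff)
  finally show ?thesis by (intro has_bochner_integral_nonneg_lborel) auto
qed

lemma qser_holomorphic:
  assumes "tempered c"
  shows "qser c holomorphic_on {z. Im z > 0}"
proof -
  have "(\<lambda>q. \<Sum>n. c n * q ^ n) holomorphic_on ball 0 1"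
  proof (rule power_series_holomorphic)
    fix q :: complex assume "q \<in> ball 0 1"
    then have "summable (\<lambda>n. norm (c n) * norm q ^ n)" by (intro tempered_summable_power assms) auto
    then have "summable (\<lambda>n. norm (c n * q ^ n))" by (simp add: norm_mult norm_power)
    then have "summable (\<lambda>n. c n * q ^ n)" by (rule summable_norm_cancel)
    then show "(\<lambda>n. c n * (q - 0) ^ n) sums (\<Sum>n. c n * q ^ n)" by (simp add: summable_sums)
  qed
  moreover have "e2pi holomorphic_on {z. Im z > 0}" unfolding e2pi_def[abs_def] by (intro holomorphic_intros)
  moreover have "e2pi ` {z. Im z > 0} \<subseteq> ball 0 1" using norm_e2pi_less_1 by auto
  ultimately have "((\<lambda>q. \<Sum>n. c n * q ^ n) \<circ> e2pi) holomorphic_on {z. Im z > 0}"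
    by (rule_tac holomorphic_on_compose_gen)
  moreover have "(\<lambda>q. \<Sum>n. c n * q ^ n) \<circ> e2pi = qser c"
    by (simp add: fun_eq_iff qser_def e2pi_of_nat_mult)
  ultimately show ?thesis by simp
qed

lemma powr_le_exp:
  fixes y p :: real
  assumes "y \<ge> 1" "p \<ge> 0"
  shows "y powr p \<le> exp (p * y)"
proof -
  have "ln y \<le> y" using assms ln_le_minus_one[of y] by linarith
  then have "p * ln y \<le> p * y" using assms by (intro mult_left_mono)
  then show ?thesis using assms by (simp add: powr_def)
qed

text \<open>The q-series has no constant term, so it decays like \<open>exp (- 2 pi y)\<close>.
  Spending \<open>exp (- y)\<close> on the claimed factor leaves \<open>2 pi - 1\<close>, which
  exceeds \<open>2 + 2 * \<delta>\<close> and absorbs the power of \<open>y\<close>.\<close>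

lemma sigser_exp_decay:
  assumes "0 < \<delta>" "\<delta> \<le> 1/3"
  shows "\<exists>C\<ge>0. \<forall>z. Im z \<ge> 1 \<longrightarrow> norm (sigser z) \<le> C * exp (- Im z) * Im z powr (- 2 - 2 * \<delta>)"
proof -
  define S where "S = (\<Sum>n. norm (of_nat (sigma1 n) * e2pi (of_nat n * \<i>)))"
  have s1: "summable (\<lambda>n. norm (of_nat (sigma1 n) * e2pi (of_nat n * \<i>)))"
    by (rule qser_summable[OF tempered_sigma1]) simp
  have S: "S \<ge> 0" unfolding S_def by (rule suminf_nonneg[OF s1]) simp
  have "norm (sigser z) \<le> (S * exp (2 * pi)) * exp (- Im z) * Im z powr (- 2 - 2 * \<delta>)" if z: "Im z \<ge> 1" for z
  proof -
    define y where "y = Im z"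
    have y: "y \<ge> 1" using z by (simp add: y_def)
    have t: "norm (of_nat (sigma1 n) * e2pi (of_nat n * z)) \<le> exp (- 2 * pi * (y - 1)) * norm (of_nat (sigma1 n) * e2pi (of_nat n * \<i>))" for n
    proof (cases "n = 0")
      case False
      have "1 * (2 * pi * (y - 1)) \<le> real n * (2 * pi * (y - 1))" using False y by (intro mult_right_mono) auto
      then have "- 2 * pi * (real n * y) \<le> - 2 * pi * (y - 1) + - 2 * pi * real n" by (simp add: algebra_simps)
      then have "exp (- 2 * pi * (real n * y)) \<le> exp (- 2 * pi * (y - 1)) * exp (- 2 * pi * real n)"
        by (simp only: exp_le_cancel_iff flip: exp_add)
      then have "real (sigma1 n) * exp (- 2 * pi * (real n * y)) \<le> real (sigma1 n) * (exp (- 2 * pi * (y - 1)) * exp (- 2 * pi * real n))"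
        by (intro mult_left_mono) auto
      then show ?thesis by (simp add: norm_mult norm_e2pi y_def mult_ac)
    qed simp
    have s2: "summable (\<lambda>n. exp (- 2 * pi * (y - 1)) * norm (of_nat (sigma1 n) * e2pi (of_nat n * \<i>)))"
      by (rule summable_mult[OF s1])
    have "norm (sigser z) \<le> (\<Sum>n. exp (- 2 * pi * (y - 1)) * norm (of_nat (sigma1 n) * e2pi (of_nat n * \<i>)))"
      unfolding sigser_def qser_def by (rule norm_suminf_le[OF t s2])
    also have "\<dots> = exp (- 2 * pi * (y - 1)) * S" unfolding S_def by (rule suminf_mult[OF s1])
    also have "\<dots> = (S * exp (2 * pi)) * exp (- 2 * pi * y)"
      by (simp add: right_diff_distrib exp_diff exp_minus field_simps flip: exp_add)
    also have "exp (- 2 * pi * y) \<le> exp (- y) * y powr (- 2 - 2 * \<delta>)"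
    proof -
      have "y powr (2 + 2 * \<delta>) \<le> exp ((2 + 2 * \<delta>) * y)" using y assms by (intro powr_le_exp) auto
      also have "\<dots> \<le> exp (2 * pi * y - y)"
      proof -
        have "(2 + 2 * \<delta>) * y \<le> (2 * pi - 1) * y" using y assms pi_gt3 by (intro mult_right_mono) auto
        then show ?thesis by (simp add: algebra_simps)
      qed
      finally have "1 / exp (2 * pi * y - y) \<le> 1 / y powr (2 + 2 * \<delta>)" using y by (intro divide_left_mono) auto
      then have "exp (y - 2 * pi * y) \<le> y powr (- (2 + 2 * \<delta>))"
        unfolding powr_minus_divide by (simp add: exp_diff)
      then have "exp (- y) * exp (y - 2 * pi * y) \<le> exp (- y) * y powr (- (2 + 2 * \<delta>))" by (intro mult_left_mono) auto
      then show ?thesis by (simp flip: exp_add)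
    qed
    then have "(S * exp (2 * pi)) * exp (- 2 * pi * y) \<le> (S * exp (2 * pi)) * (exp (- y) * y powr (- 2 - 2 * \<delta>))"
      using S by (intro mult_left_mono) auto
    finally show ?thesis by (simp add: y_def mult.assoc)
  qed
  moreover have "S * exp (2 * pi) \<ge> 0" using S by simp
  ultimately show ?thesis by blast
qed

text \<open>The factor \<open>exp (- Im z)\<close> makes the Mellin integrals of the Taylor
  coefficients converge at infinity. For \<open>Im z \<ge> 1\<close> also \<open>R \<ge> 1\<close>,
  so the factor \<open>R powr \<theta>\<close> may be inserted for free.\<close>

theorem sigser_near_irrational_decay:
  assumes "x \<notin> \<rat>" "0 < \<delta>" "\<delta> \<le> 1/3" "\<theta> = 0 \<or> 0 < \<theta> \<and> \<theta> \<le> 1 \<and> mu x < ereal (2 / \<theta>)"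
  shows "\<exists>C\<ge>0. \<forall>z R. Im z > 0 \<longrightarrow> Im z \<le> R \<longrightarrow> \<bar>Re z - x\<bar> \<le> R \<longrightarrow>
    norm (sigser z) \<le> C * exp (- Im z) * Im z powr (- 2 - 2 * \<delta>) * R powr \<theta>"
proof -
  obtain C1 where C1: "C1 \<ge> 0" "\<forall>z R. Im z > 0 \<longrightarrow> Im z \<le> R \<longrightarrow> \<bar>Re z - x\<bar> \<le> R \<longrightarrow>
    norm (sigser z) \<le> C1 * Im z powr (- 2 - 2 * \<delta>) * R powr \<theta>"
    using sigser_near_irrational[OF assms] by auto
  obtain C2 where C2: "C2 \<ge> 0" "\<forall>z. Im z \<ge> 1 \<longrightarrow> norm (sigser z) \<le> C2 * exp (- Im z) * Im z powr (- 2 - 2 * \<delta>)"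
    using sigser_exp_decay[OF assms(2,3)] by auto
  define C where "C = C1 * exp 1 + C2"
  have "norm (sigser z) \<le> C * exp (- Im z) * Im z powr (- 2 - 2 * \<delta>) * R powr \<theta>"
    if z: "Im z > 0" "Im z \<le> R" "\<bar>Re z - x\<bar> \<le> R" for z R
  proof (cases "Im z \<ge> 1")
    case True
    have "norm (sigser z) \<le> C2 * exp (- Im z) * Im z powr (- 2 - 2 * \<delta>) * 1" using C2(2) True by simp
    also have "\<dots> \<le> C * exp (- Im z) * Im z powr (- 2 - 2 * \<delta>) * R powr \<theta>"
    proof (rule mult_mono)
      show "1 \<le> R powr \<theta>" using True z assms(4) by (intro ge_one_powr_ge_zero) auto
      show "C2 * exp (- Im z) * Im z powr (- 2 - 2 * \<delta>) \<le> C * exp (- Im z) * Im z powr (- 2 - 2 * \<delta>)"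
        using C1 C2 unfolding C_def by (intro mult_right_mono) auto
    qed (use C1 C2 in \<open>auto simp: C_def\<close>)
    finally show ?thesis .
  next
    case False
    have "norm (sigser z) \<le> C1 * Im z powr (- 2 - 2 * \<delta>) * R powr \<theta>" using C1 z by blast
    also have "\<dots> \<le> (C * exp (- Im z)) * Im z powr (- 2 - 2 * \<delta>) * R powr \<theta>"
    proof (intro mult_right_mono)
      have "C1 * 1 \<le> C1 * (exp 1 * exp (- Im z))"
        using C1 False by (intro mult_left_mono) (simp_all flip: exp_add)
      also have "\<dots> \<le> C * exp (- Im z)" using C2 by (simp add: C_def distrib_right)
      finally show "C1 \<le> C * exp (- Im z)" by simp
    qed auto
    finally show ?thesis .
  qed
  moreover have "C \<ge> 0" using C1 C2 by (simp add: C_def)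
  ultimately show ?thesis by blast
qed

section \<open>Lower bound for the regularity exponent\<close>

text \<open>Under \<open>n = d m\<close> the sum is \<open>zeta(s - 1) zeta(s)\<close>.\<close>

lemma summable_sigma1_powr:
  assumes "s > 2"
  shows "summable (\<lambda>n. real (sigma1 n) / real n powr s)"
proof -
  have P: "(\<lambda>n. real n powr p) summable_on {1..}" if "p < -1" for p
  proof -
    have "summable (\<lambda>n. norm (real n powr p))" using that by (simp add: summable_real_powr_iff)
    then have "(\<lambda>n. real n powr p) summable_on UNIV" by (rule norm_summable_imp_summable_on)
    then show ?thesis by (rule summable_on_subset) auto
  qed
  have "(\<lambda>(d, m). real d * real (d * m) powr (- s)) summable_on ({1..} \<times> {1..})"
  proof (rule summable_on_SigmaI[where g="\<lambda>d. real d powr (1 - s) * infsum (\<lambda>m. real m powr (- s)) {1..}"])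
    fix d :: nat assume d: "d \<in> {1..}"
    have "((\<lambda>m. real d powr (1 - s) * real m powr (- s)) has_sum (real d powr (1 - s) * infsum (\<lambda>m. real m powr (- s)) {1..})) {1..}"
      by (rule has_sum_cmult_right[OF has_sum_infsum[OF P]]) (use assms in auto)
    moreover have "real d powr (1 - s) * real m powr (- s) = real d * real (d * m) powr (- s)" for m
      using d by (simp add: powr_mult powr_diff powr_minus field_simps)
    ultimately show "((\<lambda>m. case (d, m) of (d, m) \<Rightarrow> real d * real (d * m) powr (- s)) has_sum (real d powr (1 - s) * infsum (\<lambda>m. real m powr (- s)) {1..})) {1..}"
      by simp
  next
    show "(\<lambda>d. real d powr (1 - s) * infsum (\<lambda>m. real m powr (- s)) {1..}) summable_on {1..}"
      by (rule summable_on_cmult_left[OF P]) (use assms in auto)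
  qed auto
  then obtain S where "((\<lambda>(d, m). real d * real (d * m) powr (- s)) has_sum S) ({1..} \<times> {1..})"
    unfolding summable_on_def by blast
  from has_sum_divisors[of "\<lambda>d n. real d * real n powr (- s)", OF this]
  have h: "((\<lambda>n. \<Sum>d | d dvd n. real d * real n powr (- s)) has_sum S) {1..}" .
  have "(\<Sum>d | d dvd n. real d * real n powr (- s)) = real (sigma1 n) / real n powr s" for n
    by (simp add: sigma1_def powr_minus divide_inverse flip: sum_distrib_right)
  with h have "((\<lambda>n. real (sigma1 n) / real n powr s) has_sum S) {1..}" by simp
  then have "((\<lambda>n. real (sigma1 n) / real n powr s) has_sum S) UNIV"
    by (subst has_sum_from_one_iff[symmetric]) auto
  then show ?thesis using has_sum_imp_sums sums_summable by blast
qed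

definition sigdir :: "real \<Rightarrow> real \<Rightarrow> complex" where
  "sigdir s u = (\<Sum>n. of_nat (sigma1 n) * e2pi (of_nat n * of_real u) / of_real (real n powr s))"

lemma norm_e2pi_real [simp]: "norm (e2pi (of_nat n * of_real u)) = 1"
  by (simp add: norm_e2pi)

lemma sigdir_summable:
  assumes "s > 2"
  shows "summable (\<lambda>n. norm (of_nat (sigma1 n) * e2pi (of_nat n * of_real u) / of_real (real n powr s)))"
  using summable_sigma1_powr[OF assms] by (simp add: norm_divide norm_mult)

lemma E2_eq_Im_sigdir:
  assumes "s > 2"
  shows "E2 s u = Im (sigdir s u)"
proof -
  let ?f = "\<lambda>n. of_nat (sigma1 n) * e2pi (of_nat n * of_real u) / of_real (real n powr s)"
  have s: "?f sums sigdir s u"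
    unfolding sigdir_def by (rule summable_sums[OF summable_norm_cancel[OF sigdir_summable[OF assms]]])
  then have "(\<lambda>n. ?f (Suc n)) sums sigdir s u" using sums_Suc_iff[of ?f "sigdir s u"] by simp
  then have "(\<lambda>n. Im (?f (Suc n))) sums Im (sigdir s u)" by (rule sums_Im)
  moreover have "Im (?f (Suc n)) = real (sigma1 (Suc n)) / real (Suc n) powr s * sin (2 * pi * real (Suc n) * u)" for n
  proof -
    have "e2pi (of_nat (Suc n) * of_real u) = cis (2 * pi * real (Suc n) * u)"
      unfolding e2pi_def cis_conv_exp by (rule arg_cong[where f=exp]) (simp add: mult_ac)
    then show ?thesis by (simp add: Im_divide_of_real del: of_nat_Suc of_real_of_nat_eq)
  qed
  ultimately have "(\<lambda>n. real (sigma1 (Suc n)) / real (Suc n) powr s * sin (2 * pi * real (Suc n) * u)) sums Im (sigdir s u)"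
    by (simp only:)
  then show ?thesis unfolding E2_def by (rule sums_unique[symmetric])
qed

lemma sigdir_mellin:
  assumes "s > 2"
  shows "integrable lborel (\<lambda>y. of_real (pw s y) * sigser (of_real u + \<i> * of_real y))"
    and "(LINT y|lborel. of_real (pw s y) * sigser (of_real u + \<i> * of_real y)) =
      of_real (Gamma s / (2 * pi) powr s) * sigdir s u"
proof -
  have "summable (\<lambda>n. norm (of_nat (sigma1 n) * e2pi (of_nat n * of_real u)) / real n powr s)"
    using summable_sigma1_powr[OF assms] by (simp add: norm_mult)
  from qser_mellin[OF tempered_sigma1 _ _ _ this]
  show "integrable lborel (\<lambda>y. of_real (pw s y) * sigser (of_real u + \<i> * of_real y))"
    "(LINT y|lborel. of_real (pw s y) * sigser (of_real u + \<i> * of_real y)) =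
      of_real (Gamma s / (2 * pi) powr s) * sigdir s u"
    using assms unfolding sigser_def sigdir_def by auto
qed

text \<open>Cauchy's inequality for the coefficients; the tail is a geometric series with ratio at
  most \<open>1/2\<close>, whence the factor \<open>2\<close>.\<close>

lemma taylor_bounds:
  assumes "f holomorphic_on cball z \<rho>" "\<rho> > 0"
    and B: "\<And>w. w \<in> cball z \<rho> \<Longrightarrow> norm (f w) \<le> B"
  shows "norm ((deriv ^^ j) f z / fact j) \<le> B / \<rho> ^ j"
    and "norm h \<le> \<rho> / 2 \<Longrightarrow>
      norm (f (z + h) - (\<Sum>j\<le>n. (deriv ^^ j) f z / fact j * h ^ j)) \<le> 2 * B * (norm h / \<rho>) ^ Suc n"
proof -
  have hb: "f holomorphic_on ball z \<rho>" using assms(1) by (rule holomorphic_on_subset) auto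
  have cb: "continuous_on (cball z \<rho>) f" using assms(1) by (rule holomorphic_on_imp_continuous_on)
  have c: "norm ((deriv ^^ j) f z / fact j) \<le> B / \<rho> ^ j" for j
  proof -
    have "norm ((deriv ^^ j) f z) \<le> fact j * B / \<rho> ^ j"
      by (rule Cauchy_inequality[OF hb cb assms(2)]) (use B in \<open>auto simp: dist_norm\<close>)
    then show ?thesis by (simp add: norm_divide field_simps)
  qed
  then show "norm ((deriv ^^ j) f z / fact j) \<le> B / \<rho> ^ j" .
  have "norm (f z) \<le> B" using B[of z] assms(2) by simp
  then have B0: "B \<ge> 0" using norm_ge_zero[of "f z"] by linarith
  assume h: "norm h \<le> \<rho> / 2"
  define t where "t = norm h / \<rho>"
  have t: "0 \<le> t" "t \<le> 1 / 2" using h assms(2) by (auto simp: t_def field_simps)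
  let ?a = "\<lambda>j. (deriv ^^ j) f z / fact j * h ^ j"
  have "z + h \<in> ball z \<rho>" using h assms(2) by (simp add: dist_norm)
  from holomorphic_power_series[OF hb this] have "?a sums f (z + h)" by simp
  from sums_split_initial_segment[OF this, of "Suc n"]
  have s: "(\<lambda>j. ?a (j + Suc n)) sums (f (z + h) - (\<Sum>j\<le>n. ?a j))" by (simp add: lessThan_Suc_atMost)
  have b: "norm (?a (j + Suc n)) \<le> (B * t ^ Suc n) * t ^ j" for j
  proof -
    have "norm (?a (j + Suc n)) \<le> B / \<rho> ^ (j + Suc n) * norm h ^ (j + Suc n)"
      unfolding norm_mult norm_power by (intro mult_right_mono c) auto
    also have "\<dots> = B * t ^ (j + Suc n)" by (simp add: t_def power_divide)
    finally show ?thesis by (simp add: power_add mult_ac)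
  qed
  have g: "(\<lambda>j. (B * t ^ Suc n) * t ^ j) sums ((B * t ^ Suc n) * (1 / (1 - t)))"
    using t by (intro sums_mult geometric_sums) auto
  have "norm (f (z + h) - (\<Sum>j\<le>n. ?a j)) \<le> (B * t ^ Suc n) * (1 / (1 - t))"
    using norm_suminf_le[OF b sums_summable[OF g]] s g by (simp add: sums_iff)
  also have "\<dots> \<le> (B * t ^ Suc n) * 2"
  proof (rule mult_left_mono)
    show "1 / (1 - t) \<le> 2" using t by (simp add: field_simps)
    show "0 \<le> B * t ^ Suc n" using B0 t by simp
  qed
  finally show "norm (f (z + h) - (\<Sum>j\<le>n. ?a j)) \<le> 2 * B * (norm h / \<rho>) ^ Suc n"
    by (simp add: t_def mult_ac)
qed

lemma sigser_holomorphic: "sigser holomorphic_on {z. Im z > 0}"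
  unfolding sigser_def by (rule qser_holomorphic[OF tempered_sigma1])

lemma pw_mult_powr: "y > 0 \<Longrightarrow> pw s y * y powr k = pw (s + k) y"
  by (simp add: pw_def algebra_simps flip: powr_add)

text \<open>At each height \<open>y\<close> the Taylor polynomial of \<open>sigser\<close> at
  \<open>x + \<i> y\<close>, of degree \<open>n = \<lfloor>\<alpha>\<rfloor>\<close>, is subtracted;
  its Mellin integral is a polynomial in the displacement \<open>h\<close>. Rescaling
  \<open>y = \<bar>h\<bar> u\<close> extracts \<open>\<bar>h\<bar> powr \<alpha>\<close> from the
  remainder. Because \<open>\<alpha>\<close> is not an integer, \<open>\<alpha> > n\<close> makes
  the coefficients integrable near \<open>0\<close> and \<open>\<alpha> < n + 1\<close> makes the
  Taylor remainder integrable at infinity.\<close>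

theorem holder_at_E2:
  assumes "x \<notin> \<rat>" "0 < \<delta>" "\<delta> \<le> 1/3" "\<theta> = 0 \<or> 0 < \<theta> \<and> \<theta> \<le> 1 \<and> mu x < ereal (2 / \<theta>)"
    and s: "s > 2 + 2 * \<delta>" and al: "\<alpha> = s - 2 - 2 * \<delta> + \<theta>" "\<alpha> \<notin> \<int>"
  shows "holder_at (E2 s) \<alpha> x"
proof -
  have s2: "s > 2" using s assms by simp
  have th: "\<theta> \<ge> 0" using assms(4) by auto
  have al0: "\<alpha> > 0" using s th al by linarith
  define n where "n = nat \<lfloor>\<alpha>\<rfloor>"
  have n: "real n < \<alpha>" "\<alpha> < real n + 1" "int n = \<lfloor>\<alpha>\<rfloor>"
  proof -
    show i: "int n = \<lfloor>\<alpha>\<rfloor>" using al0 unfolding n_def by simp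
    have "\<alpha> \<noteq> of_int \<lfloor>\<alpha>\<rfloor>" using al(2) by (metis Ints_of_int)
    then show "real n < \<alpha>" "\<alpha> < real n + 1" using i by linarith+
  qed
  obtain C where C: "C \<ge> 0" "\<And>z R. Im z > 0 \<Longrightarrow> Im z \<le> R \<Longrightarrow> \<bar>Re z - x\<bar> \<le> R \<Longrightarrow>
    norm (sigser z) \<le> C * exp (- Im z) * Im z powr (- 2 - 2 * \<delta>) * R powr \<theta>"
    using sigser_near_irrational_decay[OF assms(1-4)] by metis
  \<comment> \<open>On the disc of radius \<open>y / 2\<close> about \<open>x + \<i> y\<close> the
    height and the distance \<open>R\<close> are both comparable to \<open>y\<close>, so the bound
    on \<open>sigser\<close> becomes the single power \<open>y powr k\<close>.\<close>
  define k where "k = - 2 - 2 * \<delta> + \<theta>"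
  have ak: "\<alpha> = s + k" using al k_def by simp
  define B0 where "B0 = C * (1 / 2) powr (- 2 - 2 * \<delta>) * (3 / 2) powr \<theta>"
  have B0: "B0 \<ge> 0" unfolding B0_def using C by simp
  define pt where "pt y = of_real x + \<i> * of_real y" for y
  have pt: "Im (pt y) = y" "Re (pt y) = x" for y by (simp_all add: pt_def)
  define a where "a j y = (deriv ^^ j) sigser (pt y) / fact j" for j y
  have hol: "sigser holomorphic_on cball (pt y) (y / 2)" if "y > 0" for y
    using sigser_holomorphic
  proof (rule holomorphic_on_subset)
    show "cball (pt y) (y / 2) \<subseteq> {z. Im z > 0}"
    proof safe
      fix w assume "w \<in> cball (pt y) (y / 2)"
      then have "norm (pt y - w) \<le> y / 2" by (simp add: dist_norm)
      then have "\<bar>Im (pt y - w)\<bar> \<le> y / 2" using abs_Im_le_cmod order_trans by blast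
      then show "Im w > 0" unfolding minus_complex.sel pt using that by linarith
    qed
  qed
  have bd: "norm (sigser w) \<le> B0 * exp (- (1/2) * y) * y powr k" if "y > 0" "w \<in> cball (pt y) (y / 2)" for y w
  proof -
    have "norm (w - pt y) \<le> y / 2" using that(2) by (simp add: dist_norm norm_minus_commute)
    then have "\<bar>Im (w - pt y)\<bar> \<le> y / 2" "\<bar>Re (w - pt y)\<bar> \<le> y / 2"
      using abs_Im_le_cmod abs_Re_le_cmod order_trans by blast+
    then have w: "Im w \<ge> y / 2" "Im w \<le> 3 / 2 * y" "\<bar>Re w - x\<bar> \<le> 3 / 2 * y"
      unfolding minus_complex.sel pt using that(1) by linarith+
    have "norm (sigser w) \<le> C * exp (- Im w) * Im w powr (- 2 - 2 * \<delta>) * (3 / 2 * y) powr \<theta>"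
      using w that(1) by (intro C) auto
    also have "\<dots> \<le> C * exp (- (1/2) * y) * (1 / 2 * y) powr (- 2 - 2 * \<delta>) * (3 / 2 * y) powr \<theta>"
      using w that(1) C assms by (intro mult_right_mono mult_mono mult_left_mono powr_mono2') auto
    also have "\<dots> = B0 * exp (- (1/2) * y) * (y powr (- 2 - 2 * \<delta>) * y powr \<theta>)"
    proof -
      have "(1 / 2 * y) powr q = (1 / 2) powr q * y powr q" "(3 / 2 * y) powr q = (3 / 2) powr q * y powr q" for q
        using that(1) by (intro powr_mult; simp)+
      then show ?thesis unfolding B0_def by (simp only: mult_ac)
    qed
    also have "y powr (- 2 - 2 * \<delta>) * y powr \<theta> = y powr k" using that(1) by (simp add: k_def flip: powr_add)
    finally show ?thesis .
  qed
  have abd: "norm (a j y) \<le> B0 * 2 ^ j * (exp (- (1/2) * y) * y powr (k - real j))" if "y > 0" for j y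
  proof -
    have "norm (a j y) \<le> B0 * exp (- (1/2) * y) * y powr k / (y / 2) ^ j"
      unfolding a_def by (rule taylor_bounds(1)[OF hol]) (use that bd in auto)
    also have "\<dots> = B0 * 2 ^ j * (exp (- (1/2) * y) * y powr (k - real j))"
      using that by (simp add: powr_diff powr_realpow power_divide)
    finally show ?thesis .
  qed
  have ameas: "(\<lambda>y. of_real (pw s y) * a j y) \<in> borel_measurable lborel" for j
  proof -
    have "(deriv ^^ j) sigser holomorphic_on {z. Im z > 0}"
      by (intro holomorphic_higher_deriv sigser_holomorphic open_halfspace_Im_gt)
    then have "continuous_on {z. Im z > 0} ((deriv ^^ j) sigser)" by (rule holomorphic_on_imp_continuous_on)
    then have "continuous_on {0<..} (\<lambda>y. (deriv ^^ j) sigser (pt y))"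
      by (rule continuous_on_compose2) (auto simp: pt_def intro!: continuous_intros)
    then have "continuous_on {0<..} (a j)" unfolding a_def[abs_def] by (intro continuous_intros) auto
    then have "(\<lambda>y. indicator {0<..} y *\<^sub>R a j y) \<in> borel_measurable borel"
      by (intro borel_measurable_continuous_on_indicator) auto
    then have "(\<lambda>y. of_real (pw s y) * (indicator {0<..} y *\<^sub>R a j y)) \<in> borel_measurable borel" by measurable
    also have "(\<lambda>y. of_real (pw s y) * (indicator {0<..} y *\<^sub>R a j y)) = (\<lambda>y. of_real (pw s y) * a j y)"
      by (auto simp: fun_eq_iff pw_def)
    finally show ?thesis by simp
  qed
  have aint: "integrable lborel (\<lambda>y. of_real (pw s y) * a j y)" if "j \<le> n" for j
  proof (rule Bochner_Integration.integrable_bound[OF _ ameas])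
    have "real j \<le> real n" using that by simp
    then have "\<alpha> - real j > 0" using n by linarith
    then have "has_bochner_integral lborel (\<lambda>y. pw (\<alpha> - real j) y * exp (- (1/2) * y)) (Gamma (\<alpha> - real j) / (1/2) powr (\<alpha> - real j))"
      by (intro pw_exp_integral) auto
    then show "integrable lborel (\<lambda>y. B0 * 2 ^ j * (pw (\<alpha> - real j) y * exp (- (1/2) * y)))"
      by (intro integrable_mult_right) (simp add: has_bochner_integral_iff)
    show "AE y in lborel. norm (of_real (pw s y) * a j y) \<le> norm (B0 * 2 ^ j * (pw (\<alpha> - real j) y * exp (- (1/2) * y)))"
    proof (rule AE_I2)
      fix y :: real
      show "norm (of_real (pw s y) * a j y) \<le> norm (B0 * 2 ^ j * (pw (\<alpha> - real j) y * exp (- (1/2) * y)))"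
      proof (cases "y > 0")
        case True
        have "norm (of_real (pw s y) * a j y) = pw s y * norm (a j y)" by (simp add: norm_mult)
        also have "\<dots> \<le> pw s y * (B0 * 2 ^ j * (exp (- (1/2) * y) * y powr (k - real j)))"
          by (intro mult_left_mono abd True) auto
        also have "\<dots> = B0 * 2 ^ j * ((pw s y * y powr (k - real j)) * exp (- (1/2) * y))" by (simp only: mult_ac)
        also have "pw s y * y powr (k - real j) = pw (\<alpha> - real j) y"
          unfolding pw_mult_powr[OF True] ak by (simp add: add_diff_eq)
        finally show ?thesis using B0 by simp
      qed (simp add: pw_def)
    qed
  qed
  define K where "K = (2 * pi) powr s / Gamma s"
  have "Gamma s > 0" using s2 by (intro Gamma_real_pos) auto
  then have K: "K * (Gamma s / (2 * pi) powr s) = 1" "K > 0" by (auto simp: K_def)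
  define b where "b j = (LINT y|lborel. of_real (pw s y) * a j y)" for j
  \<comment> \<open>The integrand at height \<open>y = \<bar>h\<bar> u\<close> is at most \<open>\<bar>h\<bar> powr (\<alpha> - 1) * g u\<close>: Taylor's formula applies
    for \<open>u \<ge> 4\<close>, and for \<open>u \<le> 4\<close> all terms are estimated separately.\<close>
  define g where "g u = C * 4 powr \<theta> * (if 0 < u \<and> u \<le> 4 then u powr (s - 3 - 2 * \<delta>) else 0)
      + (\<Sum>j\<le>n. B0 * 2 ^ j * (if 0 < u \<and> u \<le> 4 then u powr (\<alpha> - 1 - real j) else 0))
      + 2 * B0 * 2 ^ Suc n * (if u \<ge> 4 then u powr (\<alpha> - 2 - real n) else 0)" for u :: real
  have gint: "integrable lborel g"
    unfolding g_def[abs_def]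
  proof (intro Bochner_Integration.integrable_add Bochner_Integration.integrable_sum integrable_mult_right)
    show "integrable lborel (\<lambda>u. if 0 < u \<and> u \<le> 4 then u powr (s - 3 - 2 * \<delta>) else 0)"
      using s by (intro integrable_powr_near_0) auto
    show "integrable lborel (\<lambda>u. if 4 \<le> u then u powr (\<alpha> - 2 - real n) else 0)"
      using n integral_powr_at_top[of "\<alpha> - 2 - real n" 4] by (auto simp: has_bochner_integral_iff)
    fix j assume "j \<in> {..n}"
    then have "real j \<le> real n" by simp
    then show "integrable lborel (\<lambda>u. if 0 < u \<and> u \<le> 4 then u powr (\<alpha> - 1 - real j) else 0)"
      using n by (intro integrable_powr_near_0) auto
  qed
  have g0: "g u \<ge> 0" for u unfolding g_def using C(1) B0 by (intro add_nonneg_nonneg sum_nonneg mult_nonneg_nonneg) auto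
  define I where "I = (LINT u|lborel. g u)"
  have key: "norm (sigdir s (x + h) - of_real K * (\<Sum>j\<le>n. b j * of_real h ^ j)) \<le> K * I * \<bar>h\<bar> powr \<alpha>" if h: "h \<noteq> 0" for h
  proof -
    define H where "H = \<bar>h\<bar>"
    have H: "H > 0" using h by (simp add: H_def)
    define r where "r y = sigser (of_real (x + h) + \<i> * of_real y) - (\<Sum>j\<le>n. a j y * of_real h ^ j)" for y
    have e1: "of_real (pw s y) * r y = of_real (pw s y) * sigser (of_real (x + h) + \<i> * of_real y)
        - (\<Sum>j\<le>n. of_real (pw s y) * a j y * of_real h ^ j)" for y
      by (simp add: r_def right_diff_distrib sum_distrib_left mult.assoc)
    have i2: "integrable lborel (\<lambda>y. \<Sum>j\<le>n. of_real (pw s y) * a j y * of_real h ^ j)"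
      by (intro Bochner_Integration.integrable_sum integrable_mult_left aint) auto
    have rint: "integrable lborel (\<lambda>y. of_real (pw s y) * r y)"
      unfolding e1 by (intro Bochner_Integration.integrable_diff sigdir_mellin s2 i2)
    have "(LINT y|lborel. of_real (pw s y) * r y) =
      of_real (Gamma s / (2 * pi) powr s) * sigdir s (x + h) - (\<Sum>j\<le>n. b j * of_real h ^ j)"
      unfolding e1 Bochner_Integration.integral_diff[OF sigdir_mellin(1)[OF s2] i2] sigdir_mellin(2)[OF s2]
      by (subst Bochner_Integration.integral_sum) (auto simp: b_def intro!: integrable_mult_left aint)
    then have "of_real K * (LINT y|lborel. of_real (pw s y) * r y) =
       of_real (K * (Gamma s / (2 * pi) powr s)) * sigdir s (x + h) - of_real K * (\<Sum>j\<le>n. b j * of_real h ^ j)"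
      by (simp only: right_diff_distrib of_real_mult mult.assoc)
    then have e2: "sigdir s (x + h) - of_real K * (\<Sum>j\<le>n. b j * of_real h ^ j) = of_real K * (LINT y|lborel. of_real (pw s y) * r y)"
      unfolding K by simp
    have pb: "norm (of_real (pw s y) * r y) \<le> H powr (\<alpha> - 1) * g (0 + (1 / H) * y)" for y
    proof -
      define u where "u = y / H"
      \<comment> \<open>The \<open>4\<close> comes from the condition
        \<open>norm h \<le> \<rho> / 2\<close> of \<open>taylor_bounds\<close> with
        \<open>\<rho> = y / 2\<close>.\<close>
      consider "y \<le> 0" | "y > 0" "y \<le> 4 * H" | "y > 4 * H" using H by linarith
      then show ?thesis
      proof cases
        case 1 then show ?thesis using g0 by (simp add: pw_def)
      next
        case 2
        have u: "0 < u" "u \<le> 4" "y = H * u" using 2 H by (auto simp: u_def field_simps)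
        have "norm (sigser (of_real (x + h) + \<i> * of_real y)) \<le> C * exp (- y) * y powr (- 2 - 2 * \<delta>) * (4 * H) powr \<theta>"
          using C(2)[of "of_real (x + h) + \<i> * of_real y" "4 * H"] 2 H by (simp add: H_def)
        also have "\<dots> \<le> C * 1 * y powr (- 2 - 2 * \<delta>) * (4 * H) powr \<theta>"
          using C(1) 2 by (intro mult_right_mono mult_left_mono) auto
        finally have f1: "norm (sigser (of_real (x + h) + \<i> * of_real y)) \<le> C * y powr (- 2 - 2 * \<delta>) * (4 * H) powr \<theta>" by simp
        have f2: "norm (a j y * of_real h ^ j) \<le> B0 * 2 ^ j * y powr (k - real j) * H ^ j" for j
        proof -
          have "norm (a j y) \<le> B0 * 2 ^ j * (1 * y powr (k - real j))"
            by (rule order_trans[OF abd[OF 2(1)]]) (use B0 2 in \<open>intro mult_left_mono mult_right_mono; auto\<close>)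
          then have "norm (a j y) * H ^ j \<le> B0 * 2 ^ j * (1 * y powr (k - real j)) * H ^ j" using H by (intro mult_right_mono) auto
          then show ?thesis by (simp add: norm_mult norm_power H_def mult.assoc)
        qed
        have "norm (r y) \<le> norm (sigser (of_real (x + h) + \<i> * of_real y)) + norm (\<Sum>j\<le>n. a j y * of_real h ^ j)"
          unfolding r_def by (rule norm_triangle_ineq4)
        also have "\<dots> \<le> C * y powr (- 2 - 2 * \<delta>) * (4 * H) powr \<theta> + (\<Sum>j\<le>n. B0 * 2 ^ j * y powr (k - real j) * H ^ j)"
          by (intro add_mono f1 sum_norm_le f2)
        finally have "pw s y * norm (r y) \<le> pw s y * (C * y powr (- 2 - 2 * \<delta>) * (4 * H) powr \<theta> + (\<Sum>j\<le>n. B0 * 2 ^ j * y powr (k - real j) * H ^ j))"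
          by (intro mult_left_mono) auto
        also have "\<dots> = C * (4 * H) powr \<theta> * (pw s y * y powr (- 2 - 2 * \<delta>)) + (\<Sum>j\<le>n. B0 * 2 ^ j * H ^ j * (pw s y * y powr (k - real j)))"
          by (simp add: distrib_left sum_distrib_left mult_ac)
        also have "C * (4 * H) powr \<theta> * (pw s y * y powr (- 2 - 2 * \<delta>)) = H powr (\<alpha> - 1) * (C * 4 powr \<theta> * u powr (s - 3 - 2 * \<delta>))"
        proof -
          have "pw s y * y powr (- 2 - 2 * \<delta>) = y powr (s - 3 - 2 * \<delta>)"
            unfolding pw_mult_powr[OF 2(1)] using 2 by (simp add: pw_def algebra_simps)
          also have "\<dots> = H powr (s - 3 - 2 * \<delta>) * u powr (s - 3 - 2 * \<delta>)"
            unfolding u(3) using H u by (simp add: powr_mult)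
          finally have "C * (4 * H) powr \<theta> * (pw s y * y powr (- 2 - 2 * \<delta>)) =
            (H powr \<theta> * H powr (s - 3 - 2 * \<delta>)) * (C * 4 powr \<theta> * u powr (s - 3 - 2 * \<delta>))"
            using H by (simp add: powr_mult mult_ac)
          also have "H powr \<theta> * H powr (s - 3 - 2 * \<delta>) = H powr (\<alpha> - 1)"
            using H by (simp add: al(1) algebra_simps flip: powr_add)
          finally show ?thesis .
        qed
        also have "(\<Sum>j\<le>n. B0 * 2 ^ j * H ^ j * (pw s y * y powr (k - real j))) =
          (\<Sum>j\<le>n. H powr (\<alpha> - 1) * (B0 * 2 ^ j * u powr (\<alpha> - 1 - real j)))"
        proof (rule sum.cong[OF refl])
          fix j
          have "pw s y * y powr (k - real j) = y powr (\<alpha> - 1 - real j)"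
            unfolding pw_mult_powr[OF 2(1)] using 2 by (simp add: pw_def ak algebra_simps)
          also have "\<dots> = H powr (\<alpha> - 1 - real j) * u powr (\<alpha> - 1 - real j)"
            unfolding u(3) using H u by (simp add: powr_mult)
          also have "H powr (\<alpha> - 1 - real j) = H powr (\<alpha> - 1) / H ^ j"
            using H by (simp add: powr_diff powr_realpow)
          finally show "B0 * 2 ^ j * H ^ j * (pw s y * y powr (k - real j)) = H powr (\<alpha> - 1) * (B0 * 2 ^ j * u powr (\<alpha> - 1 - real j))"
            using H by simp
        qed
        also have "H powr (\<alpha> - 1) * (C * 4 powr \<theta> * u powr (s - 3 - 2 * \<delta>)) + (\<Sum>j\<le>n. H powr (\<alpha> - 1) * (B0 * 2 ^ j * u powr (\<alpha> - 1 - real j)))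
          = H powr (\<alpha> - 1) * (C * 4 powr \<theta> * u powr (s - 3 - 2 * \<delta>) + (\<Sum>j\<le>n. B0 * 2 ^ j * u powr (\<alpha> - 1 - real j)))"
          by (simp add: distrib_left sum_distrib_left)
        also have "\<dots> \<le> H powr (\<alpha> - 1) * g u"
          unfolding g_def using u B0 by (intro mult_left_mono) auto
        finally show ?thesis by (simp add: norm_mult u_def)
      next
        case 3
        have y: "y > 0" using 3 H by linarith
        have u: "u \<ge> 4" "u > 0" "y = H * u" using 3 H by (auto simp: u_def field_simps)
        have eq: "pt y + of_real h = of_real (x + h) + \<i> * of_real y" by (simp add: pt_def)
        have "norm (sigser (pt y + of_real h) - (\<Sum>j\<le>n. (deriv ^^ j) sigser (pt y) / fact j * of_real h ^ j))
            \<le> 2 * (B0 * exp (- (1/2) * y) * y powr k) * (norm (complex_of_real h) / (y / 2)) ^ Suc n"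
          by (rule taylor_bounds(2)[OF hol[OF y] _ bd[OF y]]) (use 3 y in \<open>auto simp: H_def\<close>)
        then have "norm (r y) \<le> 2 * (B0 * exp (- (1/2) * y) * y powr k) * (norm (complex_of_real h) / (y / 2)) ^ Suc n"
          unfolding r_def a_def eq .
        also have "\<dots> \<le> 2 * (B0 * 1 * y powr k) * (norm (complex_of_real h) / (y / 2)) ^ Suc n"
          using B0 y by (intro mult_right_mono mult_left_mono) auto
        also have "norm (complex_of_real h) / (y / 2) = 2 * (H / y)" by (simp add: H_def)
        finally have "norm (r y) \<le> 2 * B0 * 2 ^ Suc n * (H / y) ^ Suc n * y powr k"
          unfolding power_mult_distrib by (simp only: mult_ac mult_1)
        then have "pw s y * norm (r y) \<le> pw s y * (2 * B0 * 2 ^ Suc n * (H / y) ^ Suc n * y powr k)" by (intro mult_left_mono) auto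
        also have "\<dots> = 2 * B0 * 2 ^ Suc n * ((H / y) ^ Suc n * (pw s y * y powr k))" by (simp only: mult_ac)
        also have "(H / y) ^ Suc n * (pw s y * y powr k) = H powr (\<alpha> - 1) * u powr (\<alpha> - 2 - real n)"
        proof -
          have "pw s y * y powr k = y powr (\<alpha> - 1)"
            unfolding pw_mult_powr[OF y] using y by (simp add: pw_def ak)
          also have "\<dots> = H powr (\<alpha> - 1) * u powr (\<alpha> - 1)" unfolding u(3) using H u by (simp add: powr_mult)
          also have "u powr (\<alpha> - 1) = u powr (\<alpha> - 2 - real n) * u powr (real (Suc n))"
            by (simp flip: powr_add)
          also have "u powr (real (Suc n)) = u ^ Suc n" by (rule powr_realpow[OF u(2)])
          finally have "(H / y) ^ Suc n * (pw s y * y powr k) = ((H / y) * u) ^ Suc n * (H powr (\<alpha> - 1) * u powr (\<alpha> - 2 - real n))"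
            unfolding power_mult_distrib by (simp only: mult_ac)
          also have "(H / y) * u = 1" using H u by simp
          finally show ?thesis by simp
        qed
        also have "2 * B0 * 2 ^ Suc n * (H powr (\<alpha> - 1) * u powr (\<alpha> - 2 - real n)) = H powr (\<alpha> - 1) * (2 * B0 * 2 ^ Suc n * u powr (\<alpha> - 2 - real n))"
          by (simp only: mult_ac)
        also have "\<dots> \<le> H powr (\<alpha> - 1) * g u"
        proof (rule mult_left_mono)
          have "C * 4 powr \<theta> * (if 0 < u \<and> u \<le> 4 then u powr (s - 3 - 2 * \<delta>) else 0) \<ge> 0" using C(1) by simp
          moreover have "(\<Sum>j\<le>n. B0 * 2 ^ j * (if 0 < u \<and> u \<le> 4 then u powr (\<alpha> - 1 - real j) else 0)) \<ge> 0"
            using B0 by (intro sum_nonneg) auto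
          ultimately show "2 * B0 * 2 ^ Suc n * u powr (\<alpha> - 2 - real n) \<le> g u" unfolding g_def using u(1) by simp
        qed simp
        finally show ?thesis by (simp add: norm_mult u_def)
      qed
    qed
    have gi: "has_bochner_integral lborel (\<lambda>y. H powr (\<alpha> - 1) * g (0 + (1 / H) * y)) (H powr (\<alpha> - 1) * (I /\<^sub>R \<bar>1 / H\<bar>))"
    proof (rule has_bochner_integral_mult_right)
      have "has_bochner_integral lborel g I" using gint by (simp add: has_bochner_integral_iff I_def)
      then show "has_bochner_integral lborel (\<lambda>y. g (0 + (1 / H) * y)) (I /\<^sub>R \<bar>1 / H\<bar>)"
        using H by (subst lborel_has_bochner_integral_real_affine_iff[symmetric]) auto
    qed
    have "norm (LINT y|lborel. of_real (pw s y) * r y) \<le> (LINT y|lborel. H powr (\<alpha> - 1) * g (0 + (1 / H) * y))"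
      by (rule Bochner_Integration.integral_norm_bound_integral[OF rint]) (use gi pb in \<open>auto simp: has_bochner_integral_iff\<close>)
    also have "\<dots> = H powr (\<alpha> - 1) * (I /\<^sub>R \<bar>1 / H\<bar>)" using gi unfolding has_bochner_integral_iff by (rule conjunct2)
    also have "\<dots> = I * H powr \<alpha>" using H by (simp add: powr_diff)
    finally have "K * norm (LINT y|lborel. of_real (pw s y) * r y) \<le> K * (I * H powr \<alpha>)" using K by (intro mult_left_mono) auto
    then show ?thesis unfolding e2 using K(2) by (simp add: norm_mult H_def mult.assoc)
  qed
  define P where "P = (\<Sum>j\<le>n. monom (Im (of_real K * b j)) j)"
  have Pval: "poly P h = Im (of_real K * (\<Sum>j\<le>n. b j * of_real h ^ j))" for h
    by (simp add: P_def poly_sum poly_monom sum_distrib_left sum_distrib_right mult.assoc flip: of_real_power)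
  have dP: "degree P \<le> n" unfolding P_def
    by (intro degree_sum_le) (auto intro: order_trans[OF degree_monom_le])
  \<comment> \<open>\<open>holder_at\<close> quantifies over a full neighbourhood. At
    \<open>t = x\<close> its right-hand side is \<open>0\<close>, so the polynomial must take the
    exact value there.\<close>
  have zero: "E2 s x = poly P 0"
  proof -
    have "(\<Sum>j\<le>n. b j * of_real 0 ^ j) = (\<Sum>j\<in>{0}. b j * of_real 0 ^ j)"
      by (rule sum.mono_neutral_right) auto
    then have "(\<Sum>j\<le>n. b j * of_real 0 ^ j) = b 0" by simp
    moreover have "b 0 = of_real (Gamma s / (2 * pi) powr s) * sigdir s x"
      using sigdir_mellin(2)[OF s2, of x] by (simp add: b_def a_def pt_def)
    then have "of_real K * b 0 = of_real (K * (Gamma s / (2 * pi) powr s)) * sigdir s x" by (simp only: of_real_mult mult.assoc)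
    ultimately show ?thesis unfolding Pval K E2_eq_Im_sigdir[OF s2] by simp
  qed
  have "\<bar>E2 s t - poly P (t - x)\<bar> \<le> K * I * \<bar>t - x\<bar> powr \<alpha>" for t
  proof (cases "t = x")
    case True then show ?thesis using zero by simp
  next
    case False
    have "E2 s t - poly P (t - x) = Im (sigdir s (x + (t - x)) - of_real K * (\<Sum>j\<le>n. b j * of_real (t - x) ^ j))"
      unfolding Pval E2_eq_Im_sigdir[OF s2] by simp
    then have "\<bar>E2 s t - poly P (t - x)\<bar> \<le> norm (sigdir s (x + (t - x)) - of_real K * (\<Sum>j\<le>n. b j * of_real (t - x) ^ j))"
      by (metis abs_Im_le_cmod)
    also have "\<dots> \<le> K * I * \<bar>t - x\<bar> powr \<alpha>" by (rule key) (use False in simp)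
    finally show ?thesis .
  qed
  moreover have "int (degree P) \<le> \<lfloor>\<alpha>\<rfloor>" using dP n(3) by simp
  ultimately show ?thesis unfolding holder_at_def by (blast intro: always_eventually)
qed

section \<open>Upper bound for the regularity exponent\<close>

lemma qser_has_field_derivative:
  assumes "tempered c" "Im z > 0"
  shows "(qser c has_field_derivative (2 * of_real pi * \<i> * qser (\<lambda>n. of_nat n * c n) z)) (at z)"
proof -
  let ?G = "\<lambda>q. \<Sum>n. c n * q ^ n"
  have su: "summable (\<lambda>n. c n * q ^ n)" if "norm q < 1" for q
  proof (rule summable_norm_cancel)
    show "summable (\<lambda>n. norm (c n * q ^ n))"
      using tempered_summable_power[OF assms(1), of "norm q"] that by (simp add: norm_mult norm_power)
  qed
  have q: "norm (e2pi z) < 1" by (rule norm_e2pi_less_1[OF assms(2)])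
  have sd: "summable (\<lambda>n. diffs c n * e2pi z ^ n)"
    by (rule termdiff_converges[of "e2pi z" 1 c]) (use su q in auto)
  have "(?G has_field_derivative (\<Sum>n. diffs c n * e2pi z ^ n)) (at (e2pi z))"
    by (rule termdiffs_strong'[of 1]) (use su q in auto)
  moreover have "(e2pi has_field_derivative (2 * of_real pi * \<i> * e2pi z)) (at z)"
    unfolding e2pi_def[abs_def] by (auto intro!: derivative_eq_intros)
  ultimately have "((\<lambda>z. ?G (e2pi z)) has_field_derivative ((\<Sum>n. diffs c n * e2pi z ^ n) * (2 * of_real pi * \<i> * e2pi z))) (at z)"
    by (rule DERIV_chain2)
  moreover have "(\<lambda>z. ?G (e2pi z)) = qser c" by (simp add: fun_eq_iff qser_def e2pi_of_nat_mult)
  moreover have "(\<Sum>n. diffs c n * e2pi z ^ n) * (2 * of_real pi * \<i> * e2pi z) = 2 * of_real pi * \<i> * ((\<Sum>n. diffs c n * e2pi z ^ n) * e2pi z)"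
    by (simp only: mult_ac)
  moreover have "(\<Sum>n. diffs c n * e2pi z ^ n) * e2pi z = qser (\<lambda>n. of_nat n * c n) z"
  proof -
    have "(\<lambda>n. (diffs c n * e2pi z ^ n) * e2pi z) sums ((\<Sum>n. diffs c n * e2pi z ^ n) * e2pi z)"
      by (intro sums_mult2 summable_sums sd)
    then have "(\<lambda>n. of_nat (Suc n) * c (Suc n) * e2pi z ^ Suc n) sums ((\<Sum>n. diffs c n * e2pi z ^ n) * e2pi z)"
      by (simp add: diffs_def mult_ac)
    then have "(\<lambda>n. of_nat n * c n * e2pi z ^ n) sums ((\<Sum>n. diffs c n * e2pi z ^ n) * e2pi z)"
      using sums_Suc_iff[of "\<lambda>n. of_nat n * c n * e2pi z ^ n"] by simp
    then show ?thesis unfolding qser_def e2pi_of_nat_mult by (simp add: sums_iff)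
  qed
  ultimately show ?thesis by (simp only:)
qed

lemma tempered_powr: "tempered (\<lambda>n. of_real (real n powr p))"
  unfolding tempered_def
proof (rule exI[of _ "1::real"], rule exI[of _ "nat \<lceil>\<bar>p\<bar>\<rceil>"], rule allI)
  fix n
  show "norm (of_real (real n powr p) :: complex) \<le> 1 * (1 + real n) ^ nat \<lceil>\<bar>p\<bar>\<rceil>"
  proof (cases "n = 0")
    case False
    have "real n powr p \<le> real n powr \<bar>p\<bar>" using False by (intro powr_mono) auto
    also have "\<dots> \<le> (1 + real n) powr \<bar>p\<bar>" by (intro powr_mono2) auto
    also have "\<dots> \<le> (1 + real n) powr real (nat \<lceil>\<bar>p\<bar>\<rceil>)" by (intro powr_mono) (auto intro: of_nat_ceiling)
    also have "\<dots> = (1 + real n) ^ nat \<lceil>\<bar>p\<bar>\<rceil>" by (rule powr_realpow) simp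
    finally show ?thesis by simp
  qed simp
qed

text \<open>The polylogarithm of order \<open>- p\<close> at \<open>e2pi z\<close>. Its weights
  \<open>n powr s\<close> undo the division by \<open>n powr s\<close> in
  \<open>E2 s\<close>.\<close>

definition ker :: "real \<Rightarrow> complex \<Rightarrow> complex" where
  "ker p = qser (\<lambda>n. of_real (real n powr p))"

lemma ker_has_field_derivative:
  assumes "Im z > 0"
  shows "(ker p has_field_derivative (2 * of_real pi * \<i> * ker (p + 1) z)) (at z)"
proof -
  have "(\<lambda>n. complex_of_nat n * of_real (real n powr p)) = (\<lambda>n. of_real (real n powr (p + 1)))"
    by (auto simp: fun_eq_iff powr_add powr_one_gt_zero_iff mult.commute)
  then show ?thesis
    using qser_has_field_derivative[OF tempered_powr assms, of p] unfolding ker_def by simp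
qed

lemma ker_add_of_int: "ker p (z + of_int k) = ker p z"
  unfolding ker_def qser_def e2pi_of_nat_mult by simp

lemma ker_1_eq:
  assumes "Im z > 0"
  shows "ker 1 z = - 1 / (4 * (sin (of_real pi * z))\<^sup>2)"
proof -
  have "(\<lambda>d. of_nat d * e2pi z ^ d) sums (e2pi z / (1 - e2pi z)\<^sup>2)"
    using has_sum_imp_sums[OF geometric_deriv_has_sum(1)[OF norm_e2pi_less_1[OF assms]]] .
  then have "ker 1 z = e2pi z / (1 - e2pi z)\<^sup>2"
    unfolding ker_def qser_def e2pi_of_nat_mult by (simp add: sums_iff)
  then show ?thesis by (simp only: e2pi_over_square)
qed

lemma higher_deriv_ker:
  assumes "Im z > 0"
  shows "(deriv ^^ j) (ker p) z = (2 * of_real pi * \<i>) ^ j * ker (p + real j) z"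
  using assms
proof (induction j arbitrary: z)
  case (Suc j)
  have "((deriv ^^ j) (ker p) has_field_derivative (2 * of_real pi * \<i>) ^ j * (2 * of_real pi * \<i> * ker (p + real j + 1) z)) (at z)"
  proof (rule has_field_derivative_transform_within_open[of "\<lambda>z. (2 * of_real pi * \<i>) ^ j * ker (p + real j) z" _ _ "{z. Im z > 0}"])
    show "((\<lambda>z. (2 * of_real pi * \<i>) ^ j * ker (p + real j) z) has_field_derivative (2 * of_real pi * \<i>) ^ j * (2 * of_real pi * \<i> * ker (p + real j + 1) z)) (at z)"
      by (intro DERIV_cmult ker_has_field_derivative Suc.prems)
  qed (use Suc in \<open>auto simp: open_halfspace_Im_gt\<close>)
  then have "deriv ((deriv ^^ j) (ker p)) z = (2 * of_real pi * \<i>) ^ j * (2 * of_real pi * \<i> * ker (p + real j + 1) z)"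
    by (rule DERIV_imp_deriv)
  then show ?case by (simp add: algebra_simps)
qed simp

text \<open>\<open>ker (1 + j)\<close> is up to a constant the \<open>j\<close>-th derivative of
  \<open>ker 1\<close>, whose closed form \<open>- 1 / (4 sin^2)\<close> is at most
  \<open>1 / \<rho>^2\<close> at distance at least \<open>\<rho>\<close> from the integers; Cauchy's
  inequality does the rest.\<close>

lemma ker_nat_bound:
  assumes "Im w > 0" "\<rho> > 0" and far: "\<And>k::int. 2 * \<rho> \<le> norm (w - of_int k)"
  shows "norm (ker (1 + real j) w) \<le> fact j * (1 / \<rho>\<^sup>2) / \<rho> ^ j"
proof -
  \<comment> \<open>The disc about \<open>w\<close> may cross the real axis, beyond which the
    q-series says nothing; the closed form is holomorphic on the whole disc.\<close>
  define f where "f v = - 1 / (4 * (sin (of_real pi * v))\<^sup>2)" for v :: complex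
  have sb: "\<rho> \<le> norm (sin (of_real pi * v))" if "v \<in> cball w \<rho>" for v
  proof -
    define k where "k = round (Re v)"
    have "2 * \<rho> \<le> norm (w - of_int k)" by (rule far)
    also have "\<dots> \<le> norm (w - v) + norm (v - of_int k)" using norm_triangle_ineq[of "w - v" "v - of_int k"] by simp
    finally have "\<rho> \<le> norm (v - of_int k)" using that by (simp add: dist_norm)
    then have "\<rho>\<^sup>2 \<le> (norm (v - of_int k))\<^sup>2" using assms(2) by (intro power_mono) auto
    also have "\<dots> = (near_int (Re v))\<^sup>2 + (Im v)\<^sup>2" by (simp add: cmod_power2 near_int_def k_def)
    also have "\<dots> \<le> (sin (pi * Re v))\<^sup>2 + (sinh (pi * Im v))\<^sup>2"
    proof (rule add_mono)
      show "(near_int (Re v))\<^sup>2 \<le> (sin (pi * Re v))\<^sup>2"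
        unfolding near_int_def using abs_sin_ge_dist_int abs_le_square_iff by blast
      have pos: "u \<le> sinh (pi * u)" if "u > 0" for u :: real
      proof -
        have "1 * u \<le> pi * u" using that pi_gt3 by (intro mult_right_mono) auto
        also have "\<dots> \<le> sinh (pi * u)" using that sinh_ge_powr(1)[of "pi * u" 1] by simp
        finally show ?thesis by simp
      qed
      have "\<bar>Im v\<bar> \<le> \<bar>sinh (pi * Im v)\<bar>"
      proof (cases "Im v > 0")
        case True then show ?thesis using pos[OF True] by simp
      next
        case False
        then show ?thesis using pos[of "- Im v"] by (cases "Im v = 0") auto
      qed
      then show "(Im v)\<^sup>2 \<le> (sinh (pi * Im v))\<^sup>2" by (simp only: abs_le_square_iff)
    qed
    also have "\<dots> = (norm (sin (of_real pi * v)))\<^sup>2" using norm_sin_squared_eq[of "of_real pi * v"] by simp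
    finally show ?thesis by (rule power2_le_imp_le) simp
  qed
  have nz: "sin (of_real pi * v) \<noteq> 0" if "v \<in> cball w \<rho>" for v
    using sb[OF that] assms(2) by auto
  have hol: "f holomorphic_on cball w \<rho>"
    unfolding f_def[abs_def] using nz by (intro holomorphic_intros) auto
  have "norm ((deriv ^^ j) f w) \<le> fact j * (1 / \<rho>\<^sup>2) / \<rho> ^ j"
  proof (rule Cauchy_inequality)
    show "f holomorphic_on ball w \<rho>" using hol by (rule holomorphic_on_subset) auto
    show "continuous_on (cball w \<rho>) f" using hol by (rule holomorphic_on_imp_continuous_on)
    fix v assume "norm (w - v) = \<rho>"
    then have v: "v \<in> cball w \<rho>" by (simp add: dist_norm)
    have "norm (f v) = 1 / (4 * (norm (sin (of_real pi * v)))\<^sup>2)"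
      by (simp add: f_def norm_divide norm_mult norm_power)
    also have "\<dots> \<le> 1 / \<rho>\<^sup>2"
    proof (rule frac_le)
      have "\<rho>\<^sup>2 \<le> (norm (sin (of_real pi * v)))\<^sup>2" using sb[OF v] assms(2) by (intro power_mono) auto
      then show "\<rho>\<^sup>2 \<le> 4 * (norm (sin (of_real pi * v)))\<^sup>2" using zero_le_power2[of \<rho>] by linarith
    qed (use assms(2) in auto)
    finally show "norm (f v) \<le> 1 / \<rho>\<^sup>2" .
  qed (use assms in auto)
  moreover have "(deriv ^^ j) f w = (deriv ^^ j) (ker 1) w"
  proof (rule higher_deriv_cong_ev)
    have "\<forall>\<^sub>F v in nhds w. v \<in> {z. Im z > 0}" using assms(1) by (intro eventually_nhds_in_open open_halfspace_Im_gt) auto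
    then show "\<forall>\<^sub>F v in nhds w. f v = ker 1 v" by eventually_elim (simp add: f_def ker_1_eq)
  qed simp
  moreover have "norm (ker (1 + real j) w) \<le> norm ((deriv ^^ j) (ker 1) w)"
  proof -
    have "1 \<le> (2 * pi) ^ j" using pi_gt3 by (intro one_le_power) auto
    then have "1 * norm (ker (1 + real j) w) \<le> (2 * pi) ^ j * norm (ker (1 + real j) w)" by (intro mult_right_mono) auto
    then show ?thesis unfolding higher_deriv_ker[OF assms(1)] by (simp add: norm_mult norm_power)
  qed
  ultimately show ?thesis by simp
qed

text \<open>Fractional orders are reduced to \<open>ker_nat_bound\<close> by a Mellin transform in the imaginary direction;
  the hypothesis says that \<open>d + y\<close> is at most \<open>A\<close> times the distance of \<open>w + i y\<close> from the integers.\<close>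

theorem ker_bound:
  assumes "p > 0"
  shows "\<exists>C\<ge>0. \<forall>w d. Im w > 0 \<longrightarrow> d > 0 \<longrightarrow> (\<forall>k::int. \<forall>y\<ge>0. d + y \<le> A * norm (w + \<i> * of_real y - of_int k)) \<longrightarrow> A > 0 \<longrightarrow>
    norm (ker p w) \<le> C * d powr (- p - 1)"
proof -
  \<comment> \<open>The order \<open>1 + j\<close> is lowered to \<open>p\<close> by a Mellin
    transform with \<open>\<sigma> = 1 + j - p\<close>. Rounding up gives
    \<open>\<sigma> \<ge> 1\<close>, so \<open>y powr (\<sigma> - 1)\<close> may be enlarged to
    \<open>(d + y) powr (\<sigma> - 1)\<close>.\<close>
  define j where "j = nat \<lceil>p\<rceil>"
  define \<sigma> where "\<sigma> = 1 + real j - p"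
  have j: "real j \<ge> p" unfolding j_def by linarith
  then have sg: "\<sigma> \<ge> 1" unfolding \<sigma>_def by simp
  define c :: "nat \<Rightarrow> complex" where "c n = of_real (real n powr (1 + real j))" for n
  have ker_c: "qser c = ker (1 + real j)" by (simp add: ker_def c_def[abs_def])
  have c_t: "tempered c" unfolding c_def[abs_def] by (rule tempered_powr)
  define D where "D = fact j * (2 * \<bar>A\<bar>) ^ (2 + j)"
  have D: "D \<ge> 0" by (simp add: D_def)
  define K where "K = (2 * pi) powr \<sigma> / Gamma \<sigma>"
  have G: "Gamma \<sigma> > 0" using sg by (intro Gamma_real_pos) auto
  then have K: "K > 0" "K * (Gamma \<sigma> / (2 * pi) powr \<sigma>) = 1" by (auto simp: K_def)
  have "norm (ker p w) \<le> (K * (D / (p + 1))) * d powr (- p - 1)"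
    if w: "Im w > 0" "d > 0" "\<forall>k::int. \<forall>y\<ge>0. d + y \<le> A * norm (w + \<i> * of_real y - of_int k)" "A > 0" for w d
  proof -
    have kp: "c n * e2pi (of_nat n * w) / of_real (real n powr \<sigma>) = of_real (real n powr p) * e2pi (of_nat n * w)" for n
    proof (cases "n = 0")
      case False
      have "c n * e2pi (of_nat n * w) / of_real (real n powr \<sigma>) = of_real (real n powr (1 + real j) / real n powr \<sigma>) * e2pi (of_nat n * w)"
        by (simp add: c_def)
      also have "real n powr (1 + real j) / real n powr \<sigma> = real n powr p" by (simp add: \<sigma>_def flip: powr_diff)
      finally show ?thesis .
    qed (simp add: c_def)
    have "summable (\<lambda>n. norm (of_real (real n powr p) * e2pi (of_nat n * w)))"
      by (rule qser_summable[OF tempered_powr w(1)])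
    then have "summable (\<lambda>n. norm (c n * e2pi (of_nat n * w) / of_real (real n powr \<sigma>)))" unfolding kp .
    then have su: "summable (\<lambda>n. norm (c n * e2pi (of_nat n * w)) / real n powr \<sigma>)" by (simp add: norm_divide)
    have m: "integrable lborel (\<lambda>y. of_real (pw \<sigma> y) * qser c (w + \<i> * of_real y))"
      "(LINT y|lborel. of_real (pw \<sigma> y) * qser c (w + \<i> * of_real y)) = of_real (Gamma \<sigma> / (2 * pi) powr \<sigma>) * ker p w"
      using qser_mellin[OF c_t _ _ _ su] sg w(1) unfolding kp by (auto simp: c_def ker_def qser_def)
    define g where "g u = (if u \<ge> d then u powr (- p - 2) else 0)" for u :: real
    have hg: "has_bochner_integral lborel g (d powr (- p - 1) / (p + 1))"
    proof -
      have e: "- p - 2 + 1 = - p - 1" "- (p + 1) = - p - 1" by simp_all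
      have "- X / (- p - 1) = X / (p + 1)" for X :: real
        using minus_divide_divide[of X "p + 1"] unfolding e .
      then have eq: "- (d powr (- p - 2 + 1)) / (- p - 2 + 1) = d powr (- p - 1) / (p + 1)" unfolding e .
      have "has_bochner_integral lborel g (- (d powr (- p - 2 + 1)) / (- p - 2 + 1))"
        unfolding g_def[abs_def] by (rule integral_powr_at_top) (use w(2) assms in auto)
      then show ?thesis unfolding eq .
    qed
    have hg': "has_bochner_integral lborel (\<lambda>y. D * g (d + 1 * y)) (D * (d powr (- p - 1) / (p + 1) /\<^sub>R \<bar>1\<bar>))"
      using hg by (intro has_bochner_integral_mult_right) (subst lborel_has_bochner_integral_real_affine_iff[symmetric], auto)
    have pb: "norm (of_real (pw \<sigma> y) * qser c (w + \<i> * of_real y)) \<le> D * g (d + 1 * y)" for y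
    proof (cases "y > 0")
      case True
      define v where "v = w + \<i> * of_real y"
      define r where "r = (d + y) / (2 * A)"
      have r: "r > 0" using True w unfolding r_def by simp
      have dy: "d + y > 0" using True w by simp
      have "2 * r \<le> norm (v - of_int k)" for k :: int
        using w(3)[rule_format, of y k] True w(4) unfolding r_def v_def by (simp add: field_simps)
      then have "norm (ker (1 + real j) v) \<le> fact j * (1 / r\<^sup>2) / r ^ j"
        using w(1) True r by (intro ker_nat_bound) (auto simp: v_def)
      also have "\<dots> = fact j * (1 / r ^ (2 + j))" by (simp add: power_add power2_eq_square)
      also have "1 / r ^ (2 + j) = (2 * \<bar>A\<bar>) ^ (2 + j) / (d + y) ^ (2 + j)"
        using w(4) unfolding r_def by (simp add: power_divide)
      finally have kb: "norm (ker (1 + real j) v) \<le> D / (d + y) ^ (2 + j)" unfolding D_def by simp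
      have "y powr (\<sigma> - 1) \<le> (d + y) powr (\<sigma> - 1)" using True w sg by (intro powr_mono2) auto
      then have "pw \<sigma> y * norm (ker (1 + real j) v) \<le> (d + y) powr (\<sigma> - 1) * (D / (d + y) ^ (2 + j))"
        using True by (intro mult_mono kb) (auto simp: pw_def)
      also have "(d + y) ^ (2 + j) = (d + y) powr real (2 + j)" by (rule powr_realpow[OF dy, symmetric])
      also have "(d + y) powr (\<sigma> - 1) * (D / (d + y) powr real (2 + j)) = D * (d + y) powr (\<sigma> - 1 - real (2 + j))"
        unfolding powr_diff[of "d + y" "\<sigma> - 1" "real (2 + j)"] by (simp only: times_divide_eq_right mult.commute)
      also have "\<sigma> - 1 - real (2 + j) = - p - 2" by (simp add: \<sigma>_def)
      finally have "pw \<sigma> y * norm (ker (1 + real j) v) \<le> D * g (d + 1 * y)" using True by (simp add: g_def)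
      then show ?thesis unfolding ker_c v_def by (simp add: norm_mult)
    next
      case False then show ?thesis using D by (simp add: pw_def g_def)
    qed
    have "norm (LINT y|lborel. of_real (pw \<sigma> y) * qser c (w + \<i> * of_real y)) \<le> (LINT y|lborel. D * g (d + 1 * y))"
      by (rule Bochner_Integration.integral_norm_bound_integral[OF m(1)]) (use hg' pb in \<open>auto simp: has_bochner_integral_iff\<close>)
    also have "\<dots> = D * (d powr (- p - 1) / (p + 1))" using hg' by (simp add: has_bochner_integral_iff)
    finally have "K * ((Gamma \<sigma> / (2 * pi) powr \<sigma>) * norm (ker p w)) \<le> K * (D * (d powr (- p - 1) / (p + 1)))"
      using K(1) G unfolding m(2) norm_mult norm_of_real by (intro mult_left_mono) auto
    then have "(K * (Gamma \<sigma> / (2 * pi) powr \<sigma>)) * norm (ker p w) \<le> K * (D * (d powr (- p - 1) / (p + 1)))"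
      by (simp only: mult.assoc)
    then show ?thesis unfolding K(2) by simp
  qed
  moreover have "K * (D / (p + 1)) \<ge> 0" using K D assms by simp
  ultimately show ?thesis by blast
qed

section \<open>Fourier coefficients of \<open>E2\<close> and the convolution formula\<close>

lemma has_integral_suminf:
  fixes g :: "nat \<Rightarrow> real \<Rightarrow> complex"
  assumes "\<And>n. continuous_on {a..b} (g n)" "\<And>n t. t \<in> {a..b} \<Longrightarrow> norm (g n t) \<le> M n" "summable M"
    and "\<And>n. (g n has_integral J n) {a..b}"
  shows "((\<lambda>t. \<Sum>n. g n t) has_integral (\<Sum>n. J n)) {a..b}"
proof -
  have u: "uniform_limit {a..b} (\<lambda>N t. \<Sum>n<N. g n t) (\<lambda>t. \<Sum>n. g n t) sequentially"
    by (rule Weierstrass_m_test[OF assms(2,3)])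
  have c: "continuous_on {a..b} (\<lambda>t. \<Sum>n<N. g n t)" for N by (intro continuous_on_sum assms(1))
  from uniform_limit_integral[OF u c trivial_limit_sequentially] obtain I L where
    I: "\<And>N. ((\<lambda>t. \<Sum>n<N. g n t) has_integral I N) {a..b}" "((\<lambda>t. \<Sum>n. g n t) has_integral L) {a..b}" "I \<longlonglongrightarrow> L"
    by metis
  have "((\<lambda>t. \<Sum>n<N. g n t) has_integral (\<Sum>n<N. J n)) {a..b}" for N by (intro has_integral_sum assms(4)) auto
  then have "I = (\<lambda>N. \<Sum>n<N. J n)" using I(1) has_integral_unique by blast
  then have "J sums L" using I(3) by (simp add: sums_def)
  then show ?thesis using I(2) by (simp add: sums_iff)
qed

lemma continuous_on_e2pi_comp [continuous_intros]:
  "continuous_on A f \<Longrightarrow> continuous_on A (\<lambda>t. e2pi (f t))"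
  unfolding e2pi_def by (intro continuous_intros)

lemma e2pi_has_integral:
  fixes k :: int
  shows "((\<lambda>t. e2pi (of_int k * of_real t)) has_integral (if k = 0 then 1 else 0)) {x - 1/2..x + 1/2}"
proof (cases "k = 0")
  case True
  have "((\<lambda>t. 1::complex) has_integral ((x + 1/2) - (x - 1/2)) *\<^sub>R 1) {x - 1/2..x + 1/2}"
    using has_integral_const_real[of "1::complex" "x - 1/2" "x + 1/2"] by simp
  then show ?thesis using True by (simp add: e2pi_def)
next
  case False
  define F where "F t = e2pi (of_int k * of_real t) / (2 * of_real pi * \<i> * of_int k)" for t :: real
  have "((\<lambda>t. e2pi (of_int k * of_real t)) has_integral (F (x + 1/2) - F (x - 1/2))) {x - 1/2..x + 1/2}"
  proof (rule fundamental_theorem_of_calculus)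
    fix t :: real
    have "((\<lambda>v. e2pi (of_int k * v) / (2 * of_real pi * \<i> * of_int k)) has_field_derivative e2pi (of_int k * of_real t)) (at (of_real t))"
      unfolding e2pi_def using False by (auto intro!: derivative_eq_intros)
    then have "((\<lambda>t. e2pi (of_int k * of_real t) / (2 * of_real pi * \<i> * of_int k)) has_vector_derivative e2pi (of_int k * of_real t)) (at t)"
      by (rule has_vector_derivative_real_field)
    then show "(F has_vector_derivative e2pi (of_int k * of_real t)) (at t within {x - 1/2..x + 1/2})"
      unfolding F_def[abs_def] by (rule has_vector_derivative_at_within)
  qed simp
  moreover have "e2pi (of_int k * of_real (x + 1/2)) = e2pi (of_int k * of_real (x - 1/2))"
  proof -
    have "of_int k * complex_of_real (x + 1/2) = of_int k * of_real (x - 1/2) + of_int k"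
      by (simp add: algebra_simps)
    then show ?thesis by (simp only: e2pi_add_of_int)
  qed
  then have "F (x + 1/2) - F (x - 1/2) = 0" by (simp add: F_def)
  ultimately show ?thesis using False by simp
qed

lemma E2_sums:
  assumes "s > 2"
  shows "(\<lambda>n. real (sigma1 n) / real n powr s * sin (2 * pi * real n * t)) sums E2 s t"
    "summable (\<lambda>n. real (sigma1 n) / real n powr s)"
    "\<bar>E2 s t\<bar> \<le> (\<Sum>n. real (sigma1 n) / real n powr s)"
proof -
  show su: "summable (\<lambda>n. real (sigma1 n) / real n powr s)" by (rule summable_sigma1_powr[OF assms])
  let ?f = "\<lambda>n. real (sigma1 n) / real n powr s * sin (2 * pi * real n * t)"
  have b: "norm (?f n) \<le> real (sigma1 n) / real n powr s" for n
  proof -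
    have "\<bar>?f n\<bar> = real (sigma1 n) / real n powr s * \<bar>sin (2 * pi * real n * t)\<bar>" by (simp add: abs_mult)
    also have "\<dots> \<le> real (sigma1 n) / real n powr s * 1" by (intro mult_left_mono) auto
    finally show ?thesis by simp
  qed
  have "summable ?f" by (rule summable_comparison_test[OF _ su]) (use b in blast)
  then have "?f sums suminf ?f" by (rule summable_sums)
  moreover from this have "(\<lambda>n. ?f (Suc n)) sums suminf ?f" using sums_Suc_iff[of ?f "suminf ?f"] by simp
  then have "E2 s t = suminf ?f" unfolding E2_def by (rule sums_unique[symmetric])
  ultimately show "?f sums E2 s t" by simp
  show "\<bar>E2 s t\<bar> \<le> (\<Sum>n. real (sigma1 n) / real n powr s)"
    using norm_suminf_le[OF b su] \<open>E2 s t = suminf ?f\<close> by simp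
qed

text \<open>Orthogonality of the exponentials over one period. The negative frequency
  \<open>- n\<close> could only match for \<open>n = m = 0\<close>, where the coefficient
  vanishes.\<close>

lemma E2_fourier_coefficient:
  assumes "s > 2"
  shows "((\<lambda>t. of_real (E2 s t) * e2pi (- (of_nat m * of_real t))) has_integral
     of_real (real (sigma1 m) / real m powr s) / (2 * \<i>)) {x - 1/2..x + 1/2}"
proof -
  define c where "c n = complex_of_real (real (sigma1 n) / real n powr s)" for n
  define g where "g n t = c n * of_real (sin (2 * pi * real n * t)) * e2pi (- (of_nat m * of_real t))" for n and t :: real
  define J where "J n = (if n = m then c m / (2 * \<i>) else 0)" for n
  have ge: "g n t = c n / (2 * \<i>) * (e2pi (of_int (int n - int m) * of_real t) - e2pi (of_int (- int n - int m) * of_real t))" for n t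
  proof -
    have "complex_of_real (sin (2 * pi * real n * t)) = (e2pi (of_nat n * of_real t) - e2pi (- (of_nat n * of_real t))) / (2 * \<i>)"
      unfolding e2pi_def sin_of_real[symmetric] sin_exp_eq by (simp add: mult_ac)
    moreover have "e2pi (of_nat n * of_real t) * e2pi (- (of_nat m * of_real t)) = e2pi (of_int (int n - int m) * of_real t)"
      "e2pi (- (of_nat n * of_real t)) * e2pi (- (of_nat m * of_real t)) = e2pi (of_int (- int n - int m) * of_real t)"
      unfolding e2pi_add[symmetric] by (rule arg_cong[where f=e2pi], simp add: algebra_simps)+
    moreover have "d * ((a - b) / (2 * \<i>)) * q = d / (2 * \<i>) * (a * q - b * q)" for d a b q :: complex
      by (simp add: algebra_simps diff_divide_distrib)
    ultimately show ?thesis unfolding g_def by (simp only:)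
  qed
  have "((\<lambda>t. \<Sum>n. g n t) has_integral (\<Sum>n. J n)) {x - 1/2..x + 1/2}"
  proof (rule has_integral_suminf[where M="\<lambda>n. real (sigma1 n) / real n powr s"])
    show "continuous_on {x - 1/2..x + 1/2} (g n)" for n
      unfolding g_def[abs_def] by (intro continuous_intros)
    show "summable (\<lambda>n. real (sigma1 n) / real n powr s)" by (rule E2_sums[OF assms])
    fix n
    show "norm (g n t) \<le> real (sigma1 n) / real n powr s" for t
    proof -
      have "norm (g n t) = real (sigma1 n) / real n powr s * \<bar>sin (2 * pi * real n * t)\<bar>"
        by (simp add: g_def c_def norm_mult norm_divide norm_e2pi)
      also have "\<dots> \<le> real (sigma1 n) / real n powr s * 1" by (intro mult_left_mono) auto
      finally show ?thesis by simp
    qed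
    have "(g n has_integral c n / (2 * \<i>) * ((if int n - int m = 0 then 1 else 0) - (if - int n - int m = 0 then 1 else 0))) {x - 1/2..x + 1/2}"
      unfolding ge[abs_def] by (intro has_integral_mult_right has_integral_diff e2pi_has_integral)
    moreover have "c n / (2 * \<i>) * ((if int n - int m = 0 then 1 else 0) - (if - int n - int m = 0 then 1 else 0)) = J n"
      by (cases "n = 0") (auto simp: J_def c_def)
    ultimately show "(g n has_integral J n) {x - 1/2..x + 1/2}" by simp
  qed
  also have "(\<lambda>t. \<Sum>n. g n t) = (\<lambda>t. of_real (E2 s t) * e2pi (- (of_nat m * of_real t)))"
  proof
    fix t
    have "(\<lambda>n. complex_of_real (real (sigma1 n) / real n powr s * sin (2 * pi * real n * t)) * e2pi (- (of_nat m * of_real t)))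
        sums (of_real (E2 s t) * e2pi (- (of_nat m * of_real t)))"
      by (intro sums_mult2 sums_of_real E2_sums assms)
    then have "(\<lambda>n. g n t) sums (of_real (E2 s t) * e2pi (- (of_nat m * of_real t)))"
      by (simp add: g_def[abs_def] c_def)
    then show "(\<Sum>n. g n t) = of_real (E2 s t) * e2pi (- (of_nat m * of_real t))" by (simp add: sums_iff)
  qed
  also have "(\<Sum>n. J n) = c m / (2 * \<i>)"
    using sums_single[of m "\<lambda>_. c m / (2 * \<i>)"] unfolding J_def by (simp add: sums_iff)
  finally show ?thesis by (simp add: c_def)
qed

lemma continuous_on_E2:
  assumes "s > 2"
  shows "continuous_on A (E2 s)"
proof -
  have "uniform_limit UNIV (\<lambda>N t. \<Sum>n<N. real (sigma1 n) / real n powr s * sin (2 * pi * real n * t))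
      (\<lambda>t. \<Sum>n. real (sigma1 n) / real n powr s * sin (2 * pi * real n * t)) sequentially"
  proof (rule Weierstrass_m_test[OF _ E2_sums(2)[OF assms]])
    fix n t
    have "\<bar>real (sigma1 n) / real n powr s * sin (2 * pi * real n * t)\<bar> = real (sigma1 n) / real n powr s * \<bar>sin (2 * pi * real n * t)\<bar>"
      by (simp add: abs_mult)
    also have "\<dots> \<le> real (sigma1 n) / real n powr s * 1" by (intro mult_left_mono) auto
    finally show "norm (real (sigma1 n) / real n powr s * sin (2 * pi * real n * t)) \<le> real (sigma1 n) / real n powr s" by simp
  qed
  then have "continuous_on UNIV (\<lambda>t. \<Sum>n. real (sigma1 n) / real n powr s * sin (2 * pi * real n * t))"
  proof (rule uniform_limit_theorem[rotated])
    show "\<forall>\<^sub>F N in sequentially. continuous_on UNIV (\<lambda>t. \<Sum>n<N. real (sigma1 n) / real n powr s * sin (2 * pi * real n * t))"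
      by (intro always_eventually allI continuous_intros)
  qed simp
  moreover have "(\<lambda>t. \<Sum>n. real (sigma1 n) / real n powr s * sin (2 * pi * real n * t)) = E2 s"
    using E2_sums(1)[OF assms] by (auto simp: fun_eq_iff sums_iff)
  ultimately show ?thesis by (metis continuous_on_subset subset_UNIV)
qed

text \<open>Expanding the kernel picks out the Fourier coefficients of index
  \<open>m \<ge> 0\<close>, and \<open>m powr s\<close> cancels the weight in \<open>E2\<close>.
  Only the positive-frequency half of each sine is seen, whence
  \<open>1 / (2 * \<i>)\<close>.\<close>

lemma E2_convolution:
  assumes "s > 2" "Im z > 0"
  shows "((\<lambda>t. of_real (E2 s t) * ker s (z - of_real t)) has_integral sigser z / (2 * \<i>)) {x - 1/2..x + 1/2}"
proof -
  define B where "B = (\<Sum>n. real (sigma1 n) / real n powr s)"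
  have B: "\<bar>E2 s t\<bar> \<le> B" for t unfolding B_def by (rule E2_sums[OF assms(1)])
  define g where "g m t = of_real (real m powr s) * e2pi (of_nat m * z) * (of_real (E2 s t) * e2pi (- (of_nat m * of_real t)))" for m and t :: real
  have ee: "e2pi (of_nat m * (z - of_real t)) = e2pi (of_nat m * z) * e2pi (- (of_nat m * of_real t))" for m and t :: real
    unfolding e2pi_add[symmetric] by (simp add: algebra_simps)
  have su: "summable (\<lambda>m. norm (of_real (real m powr s) * e2pi (of_nat m * z)))"
    by (rule qser_summable[OF tempered_powr assms(2)])
  have "((\<lambda>t. \<Sum>m. g m t) has_integral (\<Sum>m. of_real (real m powr s) * e2pi (of_nat m * z) * (of_real (real (sigma1 m) / real m powr s) / (2 * \<i>)))) {x - 1/2..x + 1/2}"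
  proof (rule has_integral_suminf[where M="\<lambda>m. norm (of_real (real m powr s) * e2pi (of_nat m * z)) * B"])
    show "continuous_on {x - 1/2..x + 1/2} (g m)" for m
      unfolding g_def[abs_def] by (intro continuous_intros continuous_on_E2 assms)
    show "summable (\<lambda>m. norm (of_real (real m powr s) * e2pi (of_nat m * z)) * B)" by (rule summable_mult2[OF su])
    show "norm (g m t) \<le> norm (of_real (real m powr s) * e2pi (of_nat m * z)) * B" for m t
      unfolding g_def norm_mult[of "of_real (real m powr s) * e2pi (of_nat m * z)"]
      using B[of t] by (intro mult_left_mono) (auto simp: norm_mult norm_e2pi)
    show "(g m has_integral of_real (real m powr s) * e2pi (of_nat m * z) * (of_real (real (sigma1 m) / real m powr s) / (2 * \<i>))) {x - 1/2..x + 1/2}" for m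
      unfolding g_def[abs_def] by (intro has_integral_mult_right E2_fourier_coefficient assms)
  qed
  also have "(\<lambda>t. \<Sum>m. g m t) = (\<lambda>t. of_real (E2 s t) * ker s (z - of_real t))"
  proof
    fix t
    have "summable (\<lambda>m. of_real (real m powr s) * e2pi (of_nat m * (z - of_real t)))"
      using assms(2) by (intro summable_norm_cancel[OF qser_summable[OF tempered_powr]]) simp
    then have "(\<Sum>m. of_real (E2 s t) * (of_real (real m powr s) * e2pi (of_nat m * (z - of_real t)))) = of_real (E2 s t) * ker s (z - of_real t)"
      unfolding ker_def qser_def by (rule suminf_mult)
    moreover have "of_real (E2 s t) * (of_real (real m powr s) * e2pi (of_nat m * (z - of_real t))) = g m t" for m
      unfolding g_def ee by (simp only: mult_ac)
    ultimately show "(\<Sum>m. g m t) = of_real (E2 s t) * ker s (z - of_real t)" by simp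
  qed
  also have "(\<Sum>m. of_real (real m powr s) * e2pi (of_nat m * z) * (of_real (real (sigma1 m) / real m powr s) / (2 * \<i>))) = sigser z / (2 * \<i>)"
  proof -
    have "of_real (real m powr s) * e2pi (of_nat m * z) * (of_real (real (sigma1 m) / real m powr s) / (2 * \<i>)) = (of_nat (sigma1 m) * e2pi (of_nat m * z)) / (2 * \<i>)" for m
      by (cases "m = 0") auto
    then show ?thesis unfolding sigser_def qser_def
      using suminf_divide[OF summable_norm_cancel[OF qser_summable[OF tempered_sigma1 assms(2)]], of "2 * \<i>"]
      by (simp only:)
  qed
  finally show ?thesis .
qed

lemma continuous_on_ker_shift:
  assumes "Im z > 0"
  shows "continuous_on A (\<lambda>t. ker p (z - of_real t))"
proof -
  have "continuous_on {z. Im z > 0} (ker p)"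
    unfolding ker_def by (intro holomorphic_on_imp_continuous_on qser_holomorphic tempered_powr)
  then show ?thesis
    by (rule continuous_on_compose2) (use assms in \<open>auto intro!: continuous_intros\<close>)
qed

definition ker_moment :: "real \<Rightarrow> nat \<Rightarrow> real \<Rightarrow> complex \<Rightarrow> complex" where
  "ker_moment x j p z = integral {x - 1/2..x + 1/2} (\<lambda>t. of_real ((t - x) ^ j) * ker p (z - of_real t))"

text \<open>Integration by parts lowers \<open>j\<close> and \<open>p\<close> together. For
  \<open>j = 0\<close> the truncated \<open>j - 1\<close> stands beside the factor
  \<open>0\<close>.\<close>

lemma ker_moment_parts:
  assumes "Im z > 0"
  shows "2 * of_real pi * \<i> * ker_moment x j p z = of_nat j * ker_moment x (j - 1) (p - 1) z
    - (of_real ((1/2) ^ j) * ker (p - 1) (z - of_real (x + 1/2)) - of_real ((- 1/2) ^ j) * ker (p - 1) (z - of_real (x - 1/2)))"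
proof -
  let ?S = "{x - 1/2..x + 1/2}"
  define F where "F t = of_real ((t - x) ^ j) * ker (p - 1) (z - of_real t)" for t
  define f1 where "f1 t = of_real ((t - x) ^ (j - 1)) * ker (p - 1) (z - of_real t)" for t
  define f2 where "f2 t = of_real ((t - x) ^ j) * ker p (z - of_real t)" for t
  have int: "f1 integrable_on ?S" "f2 integrable_on ?S"
    unfolding f1_def[abs_def] f2_def[abs_def]
    by (intro integrable_continuous_real continuous_intros continuous_on_ker_shift assms)+
  have "((\<lambda>t. of_nat j * f1 t - 2 * of_real pi * \<i> * f2 t) has_integral (F (x + 1/2) - F (x - 1/2))) ?S"
  proof (rule fundamental_theorem_of_calculus)
    fix t :: real
    have k: "((\<lambda>v. ker (p - 1) (z - v)) has_field_derivative (2 * of_real pi * \<i> * ker (p - 1 + 1) (z - of_real t)) * (- 1)) (at (of_real t))"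
      by (rule DERIV_chain2[OF ker_has_field_derivative]) (use assms in \<open>auto intro!: derivative_eq_intros\<close>)
    have "((\<lambda>v. (v - of_real x) ^ j * ker (p - 1) (z - v)) has_field_derivative
        (of_nat j * f1 t - 2 * of_real pi * \<i> * f2 t)) (at (of_real t))"
      by (rule derivative_eq_intros k refl)+ (simp add: f1_def f2_def algebra_simps)
    then have "((\<lambda>t. (of_real t - of_real x) ^ j * ker (p - 1) (z - of_real t)) has_vector_derivative
        (of_nat j * f1 t - 2 * of_real pi * \<i> * f2 t)) (at t)"
      by (rule has_vector_derivative_real_field)
    then show "(F has_vector_derivative (of_nat j * f1 t - 2 * of_real pi * \<i> * f2 t)) (at t within ?S)"
      unfolding F_def[abs_def] by (simp add: has_vector_derivative_at_within)
  qed simp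
  moreover have "((\<lambda>t. of_nat j * f1 t - 2 * of_real pi * \<i> * f2 t) has_integral
      (of_nat j * integral ?S f1 - 2 * of_real pi * \<i> * integral ?S f2)) ?S"
    by (intro has_integral_diff has_integral_mult_right integrable_integral int)
  ultimately have "of_nat j * integral ?S f1 - 2 * of_real pi * \<i> * integral ?S f2 = F (x + 1/2) - F (x - 1/2)"
    by (rule has_integral_unique[symmetric])
  then show ?thesis
    unfolding ker_moment_def f1_def[symmetric] f2_def[symmetric] by (simp add: F_def algebra_simps)
qed

text \<open>\<open>ker p\<close> itself blows up at the real axis, but low-degree polynomials do not
  detect this. For \<open>j = 0\<close> periodicity cancels the boundary terms exactly; afterwards
  the new boundary terms sit at \<open>x - 1/2\<close> and \<open>x + 1/2\<close>, where
  \<open>z - t\<close> keeps distance \<open>1/4\<close> from the integers. The condition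
  \<open>p > j\<close> keeps the order positive in every use of \<open>ker_bound\<close>.\<close>

lemma ker_moment_bounded:
  assumes "p > real j"
  shows "\<exists>C\<ge>0. \<forall>z. Im z > 0 \<longrightarrow> \<bar>Re z - x\<bar> \<le> 1/4 \<longrightarrow> norm (ker_moment x j p z) \<le> C"
  using assms
proof (induction j arbitrary: p)
  case 0
  have "ker_moment x 0 p z = 0" if "Im z > 0" for z
  proof -
    have "z - of_real (x - 1/2) = (z - of_real (x + 1/2)) + of_int 1" by simp
    then have "ker (p - 1) (z - of_real (x - 1/2)) = ker (p - 1) (z - of_real (x + 1/2))"
      by (metis ker_add_of_int)
    then show ?thesis using ker_moment_parts[OF that, of x 0 p] by simp
  qed
  then show ?case by (intro exI[of _ 0]) auto
next
  case (Suc j)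
  obtain C1 where C1: "C1 \<ge> 0" "\<forall>z. Im z > 0 \<longrightarrow> \<bar>Re z - x\<bar> \<le> 1/4 \<longrightarrow> norm (ker_moment x j (p - 1) z) \<le> C1"
    using Suc.IH[of "p - 1"] Suc.prems by auto
  have "p - 1 > 0" using Suc.prems by simp
  from ker_bound[OF this, of 2] obtain C2 where C2: "C2 \<ge> 0" "\<forall>w d. Im w > 0 \<longrightarrow> d > 0 \<longrightarrow>
    (\<forall>k::int. \<forall>y\<ge>0. d + y \<le> 2 * norm (w + \<i> * of_real y - of_int k)) \<longrightarrow> norm (ker (p - 1) w) \<le> C2 * d powr (- (p - 1) - 1)"
    by auto
  define C3 where "C3 = C2 * (1/4) powr (- (p - 1) - 1)"
  have C3: "C3 \<ge> 0" unfolding C3_def using C2 by simp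
  have bd: "norm (ker (p - 1) (z - of_real t)) \<le> C3"
    if z: "Im z > 0" "\<bar>Re z - x\<bar> \<le> 1/4" and t: "t = x + 1/2 \<or> t = x - 1/2" for z t
    unfolding C3_def
  proof (rule C2(2)[rule_format])
    fix k :: int and y :: real assume y: "y \<ge> 0"
    let ?w = "z - of_real t + \<i> * of_real y - of_int k"
    have "\<bar>Re z - t - of_int k\<bar> \<ge> 1/4"
    proof -
      have "\<bar>t - x + of_int k\<bar> \<ge> 1/2"
      proof (cases "t = x + 1/2")
        case True
        have "of_int k \<ge> (0::real) \<or> of_int k \<le> (-1::real)" by (cases "k \<ge> 0") auto
        then show ?thesis using True by linarith
      next
        case False
        have "of_int k \<le> (0::real) \<or> of_int k \<ge> (1::real)" by (cases "k \<le> 0") auto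
        then show ?thesis using False t by linarith
      qed
      then show ?thesis using z(2) by linarith
    qed
    then have "1/4 \<le> norm ?w" using abs_Re_le_cmod[of ?w] by simp
    moreover have "y \<le> norm ?w" using abs_Im_le_cmod[of ?w] y z(1) by simp
    ultimately show "1/4 + y \<le> 2 * norm ?w" by linarith
  qed (use z in auto)
  have "norm (ker_moment x (Suc j) p z) \<le> real (Suc j) * C1 + 2 * C3" if z: "Im z > 0" "\<bar>Re z - x\<bar> \<le> 1/4" for z
  proof -
    let ?b1 = "of_real ((1/2) ^ Suc j) * ker (p - 1) (z - of_real (x + 1/2))"
    let ?b2 = "of_real ((- 1/2) ^ Suc j) * ker (p - 1) (z - of_real (x - 1/2))"
    have half: "\<bar>(1/2) ^ Suc j\<bar> \<le> (1::real)" "\<bar>(- 1/2) ^ Suc j\<bar> \<le> (1::real)"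
      unfolding power_abs by (intro power_le_one; simp)+
    have b1: "norm ?b1 \<le> 1 * C3" unfolding norm_mult norm_of_real
      using z by (intro mult_mono half bd) auto
    have b2: "norm ?b2 \<le> 1 * C3" unfolding norm_mult norm_of_real
      using z by (intro mult_mono half bd) auto
    have "norm (2 * of_real pi * \<i> * ker_moment x (Suc j) p z) = norm (of_nat (Suc j) * ker_moment x j (p - 1) z - (?b1 - ?b2))"
      unfolding ker_moment_parts[OF z(1)] by simp
    also have "\<dots> \<le> norm (of_nat (Suc j) * ker_moment x j (p - 1) z) + norm (?b1 - ?b2)" by (rule norm_triangle_ineq4)
    also have "norm (?b1 - ?b2) \<le> norm ?b1 + norm ?b2" by (rule norm_triangle_ineq4)
    also have "norm (of_nat (Suc j) * ker_moment x j (p - 1) z) \<le> real (Suc j) * C1"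
      unfolding norm_mult norm_of_nat using C1 z by (intro mult_left_mono) auto
    finally have "(2 * pi) * norm (ker_moment x (Suc j) p z) \<le> real (Suc j) * C1 + 2 * C3"
      using b1 b2 by (simp add: norm_mult)
    moreover have "1 * norm (ker_moment x (Suc j) p z) \<le> (2 * pi) * norm (ker_moment x (Suc j) p z)"
      using pi_gt3 by (intro mult_right_mono) auto
    ultimately show ?thesis by linarith
  qed
  moreover have "real (Suc j) * C1 + 2 * C3 \<ge> 0" using C1 C3 by simp
  ultimately show ?case by blast
qed

lemma powr_distance_integral:
  fixes x y q :: real
  assumes "y > 0" "q < -1"
  shows "(\<lambda>t. (y + \<bar>t - x\<bar>) powr q) integrable_on {x - 1/2..x + 1/2}"
    "integral {x - 1/2..x + 1/2} (\<lambda>t. (y + \<bar>t - x\<bar>) powr q) \<le> 2 * (y powr (q + 1) / - (q + 1))"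
proof -
  let ?f = "\<lambda>t. (y + \<bar>t - x\<bar>) powr q"
  let ?V = "((y + 1/2) powr (q + 1) - y powr (q + 1)) / (q + 1)"
  have q: "q + 1 \<noteq> 0" using assms by simp
  have r: "(?f has_integral ?V) {x..x + 1/2}"
  proof -
    have "((\<lambda>t. (y + (t - x)) powr q) has_integral ((y + (x + 1/2 - x)) powr (q + 1) / (q + 1) - (y + (x - x)) powr (q + 1) / (q + 1))) {x..x + 1/2}"
    proof (rule fundamental_theorem_of_calculus)
      fix t assume "t \<in> {x..x + 1/2}"
      then show "((\<lambda>t. (y + (t - x)) powr (q + 1) / (q + 1)) has_vector_derivative (y + (t - x)) powr q) (at t within {x..x + 1/2})"
        unfolding has_real_derivative_iff_has_vector_derivative[symmetric]
        using assms q by (auto intro!: derivative_eq_intros)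
    qed simp
    then have "((\<lambda>t. (y + (t - x)) powr q) has_integral ?V) {x..x + 1/2}" by (simp add: diff_divide_distrib)
    then show ?thesis by (rule has_integral_eq[rotated]) auto
  qed
  have l: "(?f has_integral ?V) {x - 1/2..x}"
  proof -
    have "((\<lambda>t. (y + (x - t)) powr q) has_integral (- ((y + (x - x)) powr (q + 1) / (q + 1)) - (- ((y + (x - (x - 1/2))) powr (q + 1) / (q + 1))))) {x - 1/2..x}"
    proof (rule fundamental_theorem_of_calculus)
      fix t assume "t \<in> {x - 1/2..x}"
      then show "((\<lambda>t. - ((y + (x - t)) powr (q + 1) / (q + 1))) has_vector_derivative (y + (x - t)) powr q) (at t within {x - 1/2..x})"
        unfolding has_real_derivative_iff_has_vector_derivative[symmetric]
        using assms q by (auto intro!: derivative_eq_intros)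
    qed simp
    then have "((\<lambda>t. (y + (x - t)) powr q) has_integral ?V) {x - 1/2..x}" by (simp add: diff_divide_distrib)
    then show ?thesis by (rule has_integral_eq[rotated]) auto
  qed
  have h: "(?f has_integral (?V + ?V)) {x - 1/2..x + 1/2}"
    by (rule has_integral_combine[OF _ _ l r]) auto
  then show "?f integrable_on {x - 1/2..x + 1/2}" by blast
  have "?V \<le> y powr (q + 1) / - (q + 1)"
  proof -
    have "(y + 1/2) powr (q + 1) / (q + 1) \<le> 0" using assms by (intro divide_nonneg_neg) auto
    then show ?thesis unfolding diff_divide_distrib minus_divide_right[symmetric] by linarith
  qed
  then show "integral {x - 1/2..x + 1/2} ?f \<le> 2 * (y powr (q + 1) / - (q + 1))"
    unfolding integral_unique[OF h] by linarith
qed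

text \<open>\<open>holder_at\<close> limits the degree of the polynomial, so the monomials of degree
  above \<open>\<lfloor>\<beta>'\<rfloor>\<close> have to be discarded; near \<open>0\<close> they
  are bounded by a multiple of \<open>\<bar>u\<bar> powr \<beta>'\<close>.\<close>

lemma holder_at_mono:
  assumes "holder_at f \<beta> x" "0 < \<beta>'" "\<beta>' \<le> \<beta>"
  shows "holder_at f \<beta>' x"
proof -
  obtain P C where P: "\<forall>\<^sub>F t in nhds x. \<bar>f t - poly P (t - x)\<bar> \<le> C * \<bar>t - x\<bar> powr \<beta>"
    using assms(1) unfolding holder_at_def by blast
  define n where "n = nat \<lfloor>\<beta>'\<rfloor>"
  have n: "\<beta>' < real n + 1" "int n = \<lfloor>\<beta>'\<rfloor>" unfolding n_def using assms(2) by linarith+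
  define Q where "Q = (\<Sum>i\<in>{i\<in>{..degree P}. i \<le> n}. monom (coeff P i) i)"
  define D where "D = (\<Sum>i\<in>{i\<in>{..degree P}. \<not> i \<le> n}. \<bar>coeff P i\<bar>)"
  have dQ: "degree Q \<le> n" unfolding Q_def
    by (intro degree_sum_le) (auto intro: order_trans[OF degree_monom_le])
  have "poly P u = poly Q u + (\<Sum>i\<in>{i\<in>{..degree P}. \<not> i \<le> n}. coeff P i * u ^ i)" for u
  proof -
    have "poly P u = (\<Sum>i\<in>{i\<in>{..degree P}. i \<le> n} \<union> {i\<in>{..degree P}. \<not> i \<le> n}. coeff P i * u ^ i)"
      unfolding poly_altdef by (rule sum.cong) auto
    also have "\<dots> = (\<Sum>i\<in>{i\<in>{..degree P}. i \<le> n}. coeff P i * u ^ i) + (\<Sum>i\<in>{i\<in>{..degree P}. \<not> i \<le> n}. coeff P i * u ^ i)"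
      by (rule sum.union_disjoint) auto
    finally show ?thesis by (simp add: Q_def poly_sum poly_monom)
  qed
  then have d: "\<bar>poly P u - poly Q u\<bar> \<le> D * \<bar>u\<bar> powr \<beta>'" if "\<bar>u\<bar> < 1" for u
  proof -
    assume "\<And>u. poly P u = poly Q u + (\<Sum>i\<in>{i\<in>{..degree P}. \<not> i \<le> n}. coeff P i * u ^ i)"
    then have "\<bar>poly P u - poly Q u\<bar> \<le> (\<Sum>i\<in>{i\<in>{..degree P}. \<not> i \<le> n}. \<bar>coeff P i * u ^ i\<bar>)" by simp
    also have "\<dots> \<le> (\<Sum>i\<in>{i\<in>{..degree P}. \<not> i \<le> n}. \<bar>coeff P i\<bar> * \<bar>u\<bar> powr \<beta>')"
    proof (rule sum_mono)
      fix i assume "i \<in> {i\<in>{..degree P}. \<not> i \<le> n}"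
      then have i: "real i \<ge> real n + 1" by auto
      have "\<bar>u\<bar> ^ i \<le> \<bar>u\<bar> powr \<beta>'"
      proof (cases "u = 0")
        case False
        then have "\<bar>u\<bar> ^ i = \<bar>u\<bar> powr real i" by (simp add: powr_realpow)
        also have "\<dots> \<le> \<bar>u\<bar> powr \<beta>'" using i n False that by (intro powr_mono') auto
        finally show ?thesis .
      next
        case True then show ?thesis using i by (cases i) auto
      qed
      then show "\<bar>coeff P i * u ^ i\<bar> \<le> \<bar>coeff P i\<bar> * \<bar>u\<bar> powr \<beta>'"
        unfolding abs_mult power_abs by (intro mult_left_mono) auto
    qed
    finally show ?thesis by (simp add: D_def sum_distrib_right)
  qed
  have "\<forall>\<^sub>F t in nhds x. t \<in> ball x 1" by (intro eventually_nhds_in_open) auto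
  with P have "\<forall>\<^sub>F t in nhds x. \<bar>f t - poly Q (t - x)\<bar> \<le> (\<bar>C\<bar> + D) * \<bar>t - x\<bar> powr \<beta>'"
  proof eventually_elim
    case (elim t)
    have u: "\<bar>t - x\<bar> < 1" using elim(2) by (simp add: dist_real_def abs_minus_commute)
    have "C * \<bar>t - x\<bar> powr \<beta> \<le> \<bar>C\<bar> * \<bar>t - x\<bar> powr \<beta>'"
    proof (rule mult_mono)
      show "\<bar>t - x\<bar> powr \<beta> \<le> \<bar>t - x\<bar> powr \<beta>'" using u assms(3) by (cases "t = x") (auto intro: powr_mono')
    qed auto
    then show ?case using elim(1) d[OF u] unfolding distrib_right by linarith
  qed
  then show ?thesis unfolding holder_at_def using dQ n(2) by (intro exI[of _ Q]) auto
qed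

text \<open>In the convolution formula \<open>E2 s\<close> is split into the Hoelder polynomial and
  a remainder. The polynomial has degree at most \<open>\<beta> < s\<close>, so its moments are
  bounded. The remainder contributes the integral of
  \<open>(y + \<bar>t - x\<bar>) powr (\<beta> - s - 1)\<close>, of order
  \<open>y powr (\<beta> - s)\<close>, which dominates a constant for small
  \<open>y\<close>.\<close>

theorem sigser_le_of_holder:
  assumes s: "s > 2" and hol: "holder_at (E2 s) \<beta> x" and \<beta>: "0 < \<beta>" "\<beta> < s"
  shows "\<exists>C\<ge>0. \<forall>z. 0 < Im z \<longrightarrow> Im z \<le> 1/8 \<longrightarrow> norm (z - of_real x) \<le> 2 * Im z \<longrightarrow>
    norm (sigser z) \<le> C * Im z powr (\<beta> - s)"
proof -
  let ?S = "{x - 1/2..x + 1/2}"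
  obtain P C0 where dP: "int (degree P) \<le> \<lfloor>\<beta>\<rfloor>" and P: "\<forall>\<^sub>F t in nhds x. \<bar>E2 s t - poly P (t - x)\<bar> \<le> C0 * \<bar>t - x\<bar> powr \<beta>"
    using hol unfolding holder_at_def by blast
  define R where "R t = E2 s t - poly P (t - x)" for t
  obtain d where d: "d > 0" "\<And>t. \<bar>t - x\<bar> < d \<Longrightarrow> \<bar>R t\<bar> \<le> C0 * \<bar>t - x\<bar> powr \<beta>"
    using P unfolding eventually_nhds_metric R_def dist_real_def by blast
  have Rc: "continuous_on A R" for A
    unfolding R_def[abs_def] by (intro continuous_intros continuous_on_E2 s)
  have "compact (R ` ?S)" by (intro compact_continuous_image Rc) auto
  then obtain M where M: "\<And>t. t \<in> ?S \<Longrightarrow> \<bar>R t\<bar> \<le> M"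
    using compact_imp_bounded bounded_iff by (metis imageI real_norm_def)
  have M0: "M \<ge> 0" using M[of x] by (auto intro: order_trans[OF abs_ge_zero])
  \<comment> \<open>Extends the local Hoelder bound to the whole period: at distance at least
    \<open>d\<close> from \<open>x\<close> the bounded remainder is dominated by a multiple of
    \<open>\<bar>t - x\<bar> powr \<beta>\<close>.\<close>
  define C1 where "C1 = \<bar>C0\<bar> + M / d powr \<beta>"
  have C1: "C1 \<ge> 0" unfolding C1_def using M0 by simp
  have R: "\<bar>R t\<bar> \<le> C1 * \<bar>t - x\<bar> powr \<beta>" if "t \<in> ?S" for t
  proof (cases "\<bar>t - x\<bar> < d")
    case True
    have "\<bar>R t\<bar> \<le> C0 * \<bar>t - x\<bar> powr \<beta>" by (rule d(2)[OF True])
    also have "\<dots> \<le> C1 * \<bar>t - x\<bar> powr \<beta>"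
      using M0 by (intro mult_right_mono) (auto simp: C1_def intro: add_increasing2)
    finally show ?thesis .
  next
    case False
    have "\<bar>R t\<bar> \<le> M / d powr \<beta> * d powr \<beta>" using M[OF that] d by simp
    also have "\<dots> \<le> M / d powr \<beta> * \<bar>t - x\<bar> powr \<beta>"
      using M0 False d \<beta> by (intro mult_left_mono powr_mono2) auto
    also have "\<dots> \<le> C1 * \<bar>t - x\<bar> powr \<beta>" by (intro mult_right_mono) (auto simp: C1_def)
    finally show ?thesis .
  qed
  have "\<exists>C2\<ge>0. \<forall>w d. Im w > 0 \<longrightarrow> d > 0 \<longrightarrow>
    (\<forall>k::int. \<forall>y\<ge>0. d + y \<le> 6 * norm (w + \<i> * of_real y - of_int k)) \<longrightarrow> norm (ker s w) \<le> C2 * d powr (- s - 1)"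
    using ker_bound[of s 6] s by auto
  then obtain C2 where C2: "C2 \<ge> 0" "\<forall>w d. Im w > 0 \<longrightarrow> d > 0 \<longrightarrow>
    (\<forall>k::int. \<forall>y\<ge>0. d + y \<le> 6 * norm (w + \<i> * of_real y - of_int k)) \<longrightarrow> norm (ker s w) \<le> C2 * d powr (- s - 1)"
    by blast
  have "\<forall>j\<in>{..degree P}. \<exists>C\<ge>0. \<forall>z. Im z > 0 \<longrightarrow> \<bar>Re z - x\<bar> \<le> 1/4 \<longrightarrow> norm (ker_moment x j s z) \<le> C"
  proof
    fix j assume "j \<in> {..degree P}"
    then have "real j \<le> \<beta>" using dP by (simp add: le_floor_iff)
    then show "\<exists>C\<ge>0. \<forall>z. Im z > 0 \<longrightarrow> \<bar>Re z - x\<bar> \<le> 1/4 \<longrightarrow> norm (ker_moment x j s z) \<le> C"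
      using \<beta> by (intro ker_moment_bounded) auto
  qed
  then obtain K where K: "\<And>j. j \<in> {..degree P} \<Longrightarrow> K j \<ge> 0"
    "\<And>j z. j \<in> {..degree P} \<Longrightarrow> Im z > 0 \<Longrightarrow> \<bar>Re z - x\<bar> \<le> 1/4 \<Longrightarrow> norm (ker_moment x j s z) \<le> K j"
    by metis
  define C3 where "C3 = (\<Sum>j\<le>degree P. \<bar>coeff P j\<bar> * K j)"
  have C3: "C3 \<ge> 0" unfolding C3_def using K(1) by (intro sum_nonneg) auto
  define C where "C = 2 * (C1 * C2 * (2 / (s - \<beta>)) + C3)"
  have "norm (sigser z) \<le> C * Im z powr (\<beta> - s)"
    if z: "0 < Im z" "Im z \<le> 1/8" "norm (z - of_real x) \<le> 2 * Im z" for z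
  proof -
    define y where "y = Im z"
    have y: "0 < y" "y \<le> 1/8" using z by (auto simp: y_def)
    have re: "\<bar>Re z - x\<bar> \<le> 2 * y" using abs_Re_le_cmod[of "z - of_real x"] z(3) by (simp add: y_def)
    have kb: "norm (ker s (z - of_real t)) \<le> C2 * (y + \<bar>t - x\<bar>) powr (- s - 1)" if t: "t \<in> ?S" for t
    proof (rule C2(2)[rule_format])
      fix k :: int and v :: real assume v: "v \<ge> 0"
      let ?w = "z - of_real t + \<i> * of_real v - of_int k"
      define a where "a = Re z - t"
      have tx: "\<bar>t - x\<bar> \<le> 1/2" using t unfolding atLeastAtMost_iff by linarith
      have a: "\<bar>a\<bar> \<le> 3/4" "\<bar>t - x\<bar> \<le> \<bar>a\<bar> + 2 * y" unfolding a_def using tx re y by linarith+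
      \<comment> \<open>For \<open>k \<noteq> 0\<close> the right side is at least
        \<open>1 - \<bar>a\<bar> \<ge> 1/4\<close>, which is a third of the maximum
        \<open>3/4\<close> of \<open>\<bar>a\<bar>\<close>. The constant \<open>6\<close> arises as
        \<open>3\<close> for \<open>\<bar>a\<bar>\<close>, \<open>2\<close> for \<open>2 * y\<close>
        and \<open>1\<close> for \<open>y + v\<close>.\<close>
      have "\<bar>a\<bar> / 3 \<le> \<bar>a - of_int k\<bar>"
      proof (cases "k = 0")
        case False
        then have "of_int k \<ge> (1::real) \<or> of_int k \<le> (-1::real)" by (cases "k \<ge> 0") auto
        then show ?thesis using a(1) by linarith
      qed simp
      also have "\<dots> \<le> norm ?w" using abs_Re_le_cmod[of ?w] by (simp add: a_def)
      finally have n1: "\<bar>a\<bar> / 3 \<le> norm ?w" .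
      have n2: "y + v \<le> norm ?w" using abs_Im_le_cmod[of ?w] v y by (simp add: y_def)
      show "y + \<bar>t - x\<bar> + v \<le> 6 * norm ?w" using n1 n2 a(2) v y by linarith
    qed (use z y in \<open>auto intro: add_pos_nonneg\<close>)
    have i0: "((\<lambda>t. of_real (E2 s t) * ker s (z - of_real t)) has_integral sigser z / (2 * \<i>)) ?S"
      by (rule E2_convolution[OF s z(1)])
    have i1: "((\<lambda>t. of_real (poly P (t - x)) * ker s (z - of_real t)) has_integral (\<Sum>j\<le>degree P. of_real (coeff P j) * ker_moment x j s z)) ?S"
    proof -
      have "((\<lambda>t. \<Sum>j\<le>degree P. of_real (coeff P j) * (of_real ((t - x) ^ j) * ker s (z - of_real t))) has_integral (\<Sum>j\<le>degree P. of_real (coeff P j) * ker_moment x j s z)) ?S"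
        unfolding ker_moment_def
        by (intro has_integral_sum has_integral_mult_right integrable_integral integrable_continuous_real
            continuous_intros continuous_on_ker_shift z) auto
      then show ?thesis by (simp add: poly_altdef sum_distrib_right mult.assoc)
    qed
    define W where "W = sigser z / (2 * \<i>) - (\<Sum>j\<le>degree P. of_real (coeff P j) * ker_moment x j s z)"
    have i2: "((\<lambda>t. of_real (R t) * ker s (z - of_real t)) has_integral W) ?S"
      unfolding W_def using has_integral_diff[OF i0 i1] by (simp add: R_def left_diff_distrib)
    define q where "q = \<beta> - s - 1"
    have q: "q < -1" unfolding q_def using \<beta> by simp
    have "norm (integral ?S (\<lambda>t. of_real (R t) * ker s (z - of_real t))) \<le> integral ?S (\<lambda>t. C1 * C2 * (y + \<bar>t - x\<bar>) powr q)"
    proof (rule integral_norm_bound_integral)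
      show "(\<lambda>t. of_real (R t) * ker s (z - of_real t)) integrable_on ?S" using i2 by blast
      show "(\<lambda>t. C1 * C2 * (y + \<bar>t - x\<bar>) powr q) integrable_on ?S"
        by (intro integrable_on_mult_right powr_distance_integral y q)
      fix t assume t: "t \<in> ?S"
      have "norm (of_real (R t) * ker s (z - of_real t)) \<le> (C1 * \<bar>t - x\<bar> powr \<beta>) * (C2 * (y + \<bar>t - x\<bar>) powr (- s - 1))"
        unfolding norm_mult norm_of_real using C1 by (intro mult_mono R t kb) auto
      also have "\<dots> \<le> (C1 * (y + \<bar>t - x\<bar>) powr \<beta>) * (C2 * (y + \<bar>t - x\<bar>) powr (- s - 1))"
        using C1 C2 y \<beta> by (intro mult_right_mono mult_left_mono powr_mono2) auto
      also have "\<dots> = C1 * C2 * ((y + \<bar>t - x\<bar>) powr \<beta> * (y + \<bar>t - x\<bar>) powr (- s - 1))" by (simp only: mult_ac)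
      also have "(y + \<bar>t - x\<bar>) powr \<beta> * (y + \<bar>t - x\<bar>) powr (- s - 1) = (y + \<bar>t - x\<bar>) powr q"
        by (simp add: q_def algebra_simps flip: powr_add)
      finally show "norm (of_real (R t) * ker s (z - of_real t)) \<le> C1 * C2 * (y + \<bar>t - x\<bar>) powr q" .
    qed
    also have "\<dots> = C1 * C2 * integral ?S (\<lambda>t. (y + \<bar>t - x\<bar>) powr q)" by simp
    also have "\<dots> \<le> C1 * C2 * (2 * (y powr (q + 1) / - (q + 1)))"
      using C1 C2 by (intro mult_left_mono powr_distance_integral y q) auto
    also have "\<dots> = C1 * C2 * (2 / (s - \<beta>)) * y powr (\<beta> - s)" by (simp add: q_def)
    finally have Wb: "norm W \<le> C1 * C2 * (2 / (s - \<beta>)) * y powr (\<beta> - s)" using i2 by (simp add: integral_unique)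
    have "\<bar>Re z - x\<bar> \<le> 1/4" using re y by linarith
    then have sb: "norm (\<Sum>j\<le>degree P. of_real (coeff P j) * ker_moment x j s z) \<le> C3"
      unfolding C3_def using K z by (intro sum_norm_le) (auto simp: norm_mult intro!: mult_left_mono)
    have y1: "1 \<le> y powr (\<beta> - s)"
    proof -
      have "1 powr (\<beta> - s) \<le> y powr (\<beta> - s)" using y \<beta> by (intro powr_mono2') auto
      then show ?thesis by simp
    qed
    have "norm (sigser z) / 2 = norm (sigser z / (2 * \<i>))" by (simp add: norm_divide norm_mult)
    also have "\<dots> = norm (W + (\<Sum>j\<le>degree P. of_real (coeff P j) * ker_moment x j s z))" by (simp add: W_def)
    also have "\<dots> \<le> norm W + norm (\<Sum>j\<le>degree P. of_real (coeff P j) * ker_moment x j s z)" by (rule norm_triangle_ineq)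
    also have "\<dots> \<le> C1 * C2 * (2 / (s - \<beta>)) * y powr (\<beta> - s) + C3 * y powr (\<beta> - s)"
      using Wb sb mult_left_mono[OF y1 C3] by linarith
    finally have "2 * (norm (sigser z) / 2) \<le> 2 * (C1 * C2 * (2 / (s - \<beta>)) * y powr (\<beta> - s) + C3 * y powr (\<beta> - s))"
      by (rule mult_left_mono) simp
    then have "norm (sigser z) \<le> 2 * (C1 * C2 * (2 / (s - \<beta>)) * y powr (\<beta> - s) + C3 * y powr (\<beta> - s))"
      by (simp only: times_divide_eq_right nonzero_mult_div_cancel_left zero_neq_numeral[symmetric] not_False_eq_True)
    also have "\<dots> = C * y powr (\<beta> - s)" unfolding C_def by (simp only: distrib_left distrib_right mult.assoc)
    finally show ?thesis by (simp add: y_def)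
  qed
  moreover have "C \<ge> 0" unfolding C_def using C1 C2 C3 \<beta> by simp
  ultimately show ?thesis by blast
qed

section \<open>Behaviour of \<open>kappa\<close> along the convergents, choice of parameters and
  conclusion\<close>

lemma eventually_cf_den_gt_1:
  assumes "x \<notin> \<rat>"
  shows "\<forall>\<^sub>F n in sequentially. cf_den x n > 1"
proof (rule eventually_sequentiallyI)
  fix n :: nat assume "2 \<le> n"
  then show "cf_den x n > 1" using cf_den_ge[OF assms, of n] by linarith
qed

lemma nu_bounds:
  assumes "x \<notin> \<rat>"
  shows "2 \<le> nu x" "nu x \<le> mu x"
proof -
  have "\<forall>\<^sub>F n in sequentially. 2 \<le> ereal (kappa x n)"
    using eventually_cf_den_gt_1[OF assms]
  proof eventually_elim
    case (elim n)
    then have "ereal 2 \<le> ereal (kappa x n)" using kappa_ge_2[OF assms] by simp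
    then show ?case by simp
  qed
  then show "2 \<le> nu x" unfolding nu_def by (rule Liminf_bounded)
  show "nu x \<le> mu x" unfolding nu_def mu_def by (rule Liminf_le_Limsup) simp
qed

lemma eventually_powr_gt:
  assumes "p > 0"
  shows "\<forall>\<^sub>F n in sequentially. real n powr p > B"
proof -
  define c where "c = max 1 B powr (1 / p)"
  have c: "c \<ge> 0" "c powr p = max 1 B" unfolding c_def using assms by (auto simp: powr_powr)
  have "\<forall>\<^sub>F n in sequentially. real n > c"
    using filterlim_real_sequentially by (simp add: filterlim_at_top_dense)
  then show ?thesis
  proof eventually_elim
    case (elim n)
    then have "c powr p < real n powr p" using assms c(1) by (intro powr_less_mono2) auto
    then show ?case unfolding c(2) by simp
  qed
qed

text \<open>Supplies the nonintegral orders that \<open>holder_at_E2\<close> demands. The interval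
  is first cut down to lie strictly between \<open>\<lceil>b\<rceil> - 1\<close> and
  \<open>\<lceil>b\<rceil>\<close>, apart from its endpoints.\<close>

lemma noninteger_between:
  fixes a b :: real
  assumes "a < b"
  shows "\<exists>c. a < c \<and> c < b \<and> c \<notin> \<int>"
proof -
  define l where "l = max a (of_int (\<lceil>b\<rceil> - 1))"
  have l: "l < b" "a \<le> l" "of_int (\<lceil>b\<rceil> - 1) \<le> l" unfolding l_def using assms by linarith+
  define c where "c = (l + b) / 2"
  have c: "l < c" "c < b" unfolding c_def using l by auto
  have "c \<notin> \<int>"
  proof
    assume "c \<in> \<int>"
    then obtain k where k: "c = of_int k" by (auto elim: Ints_cases)
    have "real_of_int (\<lceil>b\<rceil> - 1) < of_int k" using c l k by linarith
    moreover have "real_of_int k < of_int \<lceil>b\<rceil>" using c k by linarith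
    ultimately have "\<lceil>b\<rceil> - 1 < k" "k < \<lceil>b\<rceil>" by (simp_all only: of_int_less_iff)
    then show False by linarith
  qed
  then show ?thesis using c l by (intro exI[of _ c]) auto
qed

lemma holder_at_E2_below:
  assumes "x \<notin> \<rat>" "s > 2" "ereal a < ereal s - 2 + 2 / mu x"
  shows "\<exists>\<alpha>. a < \<alpha> \<and> 0 < \<alpha> \<and> holder_at (E2 s) \<alpha> x"
proof (cases "mu x = \<infinity>")
  case True
  have T: "ereal s - 2 + 2 / mu x = ereal (s - 2)" using True by simp
  \<comment> \<open>With \<open>\<theta> = 0\<close> the whole gap goes into
    \<open>\<delta> = (s - 2 - \<alpha>) / 2\<close>, so a gap below \<open>2/3\<close> is what
    \<open>\<delta> \<le> 1/3\<close> asks for.\<close>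
  have "max a (max 0 (s - 2 - 2/3)) < s - 2" using assms unfolding T by auto
  from noninteger_between[OF this] obtain \<alpha> where \<alpha>: "a < \<alpha>" "0 < \<alpha>" "s - 2 - 2/3 < \<alpha>" "\<alpha> < s - 2" "\<alpha> \<notin> \<int>"
    by auto
  have "holder_at (E2 s) \<alpha> x"
    by (rule holder_at_E2[of x "(s - 2 - \<alpha>) / 2" 0]) (use assms \<alpha> in \<open>auto simp: field_simps\<close>)
  then show ?thesis using \<alpha> by blast
next
  case False
  have m2: "2 \<le> mu x" using nu_bounds[OF assms(1)] by (rule order_trans)
  then obtain m where m: "mu x = ereal m" using False by (cases "mu x") auto
  have m2: "m \<ge> 2" using m2 unfolding m by simp
  define T where "T = s - 2 + 2 / m"
  have T: "ereal s - 2 + 2 / mu x = ereal T" using m2 unfolding m T_def by simp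
  \<comment> \<open>The three bounds on the gap ensure, in this order, \<open>\<theta> > 0\<close>,
    \<open>\<delta> \<le> 1/3\<close>, and both \<open>s > 2 + 2 * \<delta>\<close> and
    \<open>\<alpha> > 0\<close>.\<close>
  define g0 where "g0 = min (2 / m) (min (2/3) (s - 2))"
  have mp: "2 / m > 0" using m2 by simp
  then have g0: "0 < g0" "g0 \<le> 2 / m" "g0 \<le> 2/3" "g0 \<le> s - 2" unfolding g0_def using assms(2) by linarith+
  have "max a (T - g0) < T" using assms(3) g0 unfolding T by auto
  from noninteger_between[OF this] obtain \<alpha> where \<alpha>: "a < \<alpha>" "T - g0 < \<alpha>" "\<alpha> < T" "\<alpha> \<notin> \<int>" by auto
  define g where "g = T - \<alpha>"
  have g: "0 < g" "g < g0" using \<alpha> by (auto simp: g_def)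
  have a0: "\<alpha> > 0" using \<alpha>(2) g0(4) mp unfolding T_def by linarith
  \<comment> \<open>Half of the gap \<open>g\<close> makes \<open>\<theta>\<close> strictly smaller
    than \<open>2 / m\<close>; the other half is \<open>2 * \<delta>\<close> with
    \<open>\<delta> = g / 4\<close>.\<close>
  define \<theta> where "\<theta> = 2 / m - g / 2"
  have th: "0 < \<theta>" "\<theta> < 2 / m" unfolding \<theta>_def using g g0 by linarith+
  have "2 / m \<le> 1" using m2 by simp
  then have th1: "\<theta> \<le> 1" using th by linarith
  have "m < 2 / \<theta>" using th m2 by (simp add: field_simps)
  then have mt: "mu x < ereal (2 / \<theta>)" unfolding m by simp
  have "holder_at (E2 s) \<alpha> x"
  proof (rule holder_at_E2[of x "g / 4" \<theta>])
    show "\<alpha> = s - 2 - 2 * (g / 4) + \<theta>" unfolding \<theta>_def g_def T_def by (simp add: field_simps)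
  qed (use assms \<alpha> g g0 th th1 mt in auto)
  then show ?thesis using \<alpha> a0 by blast
qed

text \<open>If \<open>mu x = 2\<close>, every nonjunk \<open>kappa\<close> is already at least
  \<open>2\<close> and the hypothesis on the partial quotients supplies the large complete
  quotients. If \<open>mu x > 2\<close>, a \<open>kappa\<close> above some fixed
  \<open>k > 2\<close> forces a large complete quotient by itself. The uniform margin
  \<open>\<eta>\<close> drives the final contradiction.\<close>

lemma frequently_kappa:
  assumes "x \<notin> \<rat>" "e > 0" "2 / mu x < ereal e" "infinite {n. cf_quot x n \<ge> 7}"
  shows "\<exists>\<eta>>0. \<exists>\<^sub>F n in sequentially. cf_complete x (Suc n) \<ge> 7 \<and> kappa x n * e \<ge> 2 + \<eta>"
proof (cases "mu x = 2")
  case True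
  have e1: "e > 1" using assms(3) unfolding True by simp
  have "\<exists>\<^sub>F n in sequentially. cf_complete x (Suc n) \<ge> 7"
  proof -
    have "\<exists>\<^sub>F n in sequentially. cf_quot x n \<ge> 7"
      using assms(4) by (simp add: frequently_cofinite flip: cofinite_eq_sequentially)
    then have "\<exists>\<^sub>F n in sequentially. cf_quot x (Suc n) \<ge> 7"
      unfolding frequently_def eventually_sequentially_Suc[of "\<lambda>n. \<not> cf_quot x n \<ge> 7"] .
    then show ?thesis
    proof (rule frequently_elim1)
      fix n assume "cf_quot x (Suc n) \<ge> 7"
      then have "real_of_int (cf_quot x (Suc n)) \<ge> 7" by simp
      then show "cf_complete x (Suc n) \<ge> 7" using cf_quot_le_complete[of x "Suc n"] by linarith
    qed
  qed
  moreover have "\<forall>\<^sub>F n in sequentially. kappa x n * e \<ge> 2 + (2 * e - 2)"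
    using eventually_cf_den_gt_1[OF assms(1)]
  proof eventually_elim
    case (elim n)
    then have "2 * e \<le> kappa x n * e" using kappa_ge_2[OF assms(1)] assms(2) by (intro mult_right_mono) auto
    then show ?case by simp
  qed
  ultimately have "\<exists>\<^sub>F n in sequentially. cf_complete x (Suc n) \<ge> 7 \<and> kappa x n * e \<ge> 2 + (2 * e - 2)"
    by (rule frequently_eventually_frequently)
  then show ?thesis using e1 by (intro exI[of _ "2 * e - 2"]) auto
next
  case False
  have m2: "2 < mu x" using nu_bounds[OF assms(1)] False by (metis order_trans order_le_less)
  have "ereal (2 / e) < mu x"
  proof (cases "mu x")
    case (real m)
    then show ?thesis using assms(2,3) m2 by (auto simp: field_simps)
  qed (use m2 in auto)
  \<comment> \<open>The level \<open>k\<close> chosen next must exceed \<open>2 / e\<close>, so that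
    \<open>k * e > 2\<close>, and also \<open>2\<close>, so that the complete quotients become
    large.\<close>
  with m2 have "ereal (max 2 (2 / e)) < mu x" by (simp add: max_def)
  from ereal_dense2[OF this] obtain k where "ereal (max 2 (2 / e)) < ereal k" "ereal k < mu x" by blast
  then have k: "max 2 (2 / e) < k" "ereal k < mu x" by (simp_all only: ereal_less_eq less_ereal.simps)
  have fr: "\<exists>\<^sub>F n in sequentially. kappa x n > k"
  proof (rule ccontr)
    assume "\<not> ?thesis"
    then have "\<forall>\<^sub>F n in sequentially. ereal (kappa x n) \<le> ereal k" by (simp add: not_frequently not_less)
    then have "mu x \<le> ereal k" unfolding mu_def by (rule Limsup_bounded)
    then show False using k by simp
  qed
  have "\<forall>\<^sub>F n in sequentially. real n powr (k - 2) > 14" using k by (intro eventually_powr_gt) auto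
  with eventually_cf_den_gt_1[OF assms(1)]
  have ev: "\<forall>\<^sub>F n in sequentially. cf_den x n > 1 \<and> real n powr (k - 2) \<ge> 14" by eventually_elim auto
  have "\<exists>\<^sub>F n in sequentially. cf_complete x (Suc n) \<ge> 7 \<and> kappa x n * e \<ge> 2 + (k * e - 2)"
    using frequently_eventually_frequently[OF fr ev]
  proof (rule frequently_elim1, elim conjE)
    fix n assume n: "kappa x n > k" "cf_den x n > 1" "real n powr (k - 2) \<ge> 14"
    let ?q = "real_of_int (cf_den x n)"
    have q: "?q > 1" "real n \<le> ?q" using n(2) cf_den_ge[OF assms(1), of n] by linarith+
    \<comment> \<open>\<open>14\<close> is twice \<open>7\<close>, because \<open>cf_height\<close>
      is only bounded by \<open>2\<close> times denominator times complete quotient.\<close>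
    have "14 \<le> real n powr (k - 2)" by (rule n(3))
    also have "\<dots> \<le> ?q powr (k - 2)" using q k by (intro powr_mono2) auto
    also have "\<dots> = ?q powr k / ?q\<^sup>2" using q by (simp add: powr_diff powr_numeral)
    also have "\<dots> \<le> ?q powr (kappa x n) / ?q\<^sup>2" using q n by (intro divide_right_mono powr_mono) auto
    also have "\<dots> = cf_height x n / ?q" unfolding kappa_height[OF assms(1) n(2)] using q by (simp add: power2_eq_square)
    also have "\<dots> \<le> 2 * cf_complete x (Suc n)"
      using cf_height_bounds(2)[OF assms(1), of n] q by (simp add: field_simps)
    finally have "cf_complete x (Suc n) \<ge> 7" by simp
    moreover have "k * e \<le> kappa x n * e" using n(1) assms(2) by (intro mult_right_mono) auto
    ultimately show "cf_complete x (Suc n) \<ge> 7 \<and> kappa x n * e \<ge> 2 + (k * e - 2)" by simp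
  qed
  moreover have "k * e - 2 > 0" using k assms(2) by (simp add: field_simps)
  ultimately show ?thesis by blast
qed

text \<open>Comparing the lower bound at the transported point with the Hoelder upper bound gives
  \<open>t y \<le> 50 C y powr e\<close>, where \<open>t y\<close> is at least
  \<open>1 / (2 q^2)\<close> and \<open>y \<le> 2 q powr (- kappa)\<close>. Hence
  \<open>q powr (-2)\<close> is at most a constant times \<open>q powr (- 2 - \<eta>)\<close>,
  impossible for large \<open>q\<close>.\<close>

lemma holder_at_E2_upper:
  assumes "x \<notin> \<rat>" "s > 2" "holder_at (E2 s) \<beta> x" "infinite {n. cf_quot x n \<ge> 7}"
  shows "ereal \<beta> \<le> ereal s - 2 + 2 / mu x"
proof (rule ccontr)
  assume "\<not> ?thesis"
  then have lt: "ereal s - 2 + 2 / mu x < ereal \<beta>" by simp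
  have m2: "2 \<le> mu x" using nu_bounds[OF assms(1)] by (rule order_trans)
  obtain v where v: "2 / mu x = ereal v" "0 \<le> v" "v \<le> 1"
  proof (cases "mu x")
    case (real m)
    then have "m \<ge> 2" using m2 by simp
    then show ?thesis using real by (intro that[of "2 / m"]) auto
  next
    case PInf then show ?thesis by (intro that[of 0]) auto
  qed (use m2 in auto)
  have b: "s - 2 + v < \<beta>" using lt unfolding v(1) by simp
  \<comment> \<open>The order is lowered below \<open>s\<close>, where the moments of the kernel are
    bounded and the remainder integral has its exponent below \<open>-1\<close>.\<close>
  obtain \<beta>' where \<beta>': "s - 2 + v < \<beta>'" "\<beta>' < min \<beta> s" using dense[of "s - 2 + v" "min \<beta> s"] b v by auto
  have b0: "0 < \<beta>'" "\<beta>' < s" "\<beta>' \<le> \<beta>" using \<beta>' v assms(2) by auto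
  have hol: "holder_at (E2 s) \<beta>' x" by (rule holder_at_mono[OF assms(3)]) (use b0 in auto)
  define e where "e = \<beta>' - s + 2"
  have e: "e > 0" "2 / mu x < ereal e" unfolding e_def v(1) using \<beta>' v by auto
  obtain C where C: "C \<ge> 0" "\<And>z. 0 < Im z \<Longrightarrow> Im z \<le> 1/8 \<Longrightarrow> norm (z - of_real x) \<le> 2 * Im z \<Longrightarrow>
    norm (sigser z) \<le> C * Im z powr (\<beta>' - s)"
    using sigser_le_of_holder[OF assms(2) hol b0(1,2)] by blast
  obtain \<eta> where eta: "\<eta> > 0" "\<exists>\<^sub>F n in sequentially. cf_complete x (Suc n) \<ge> 7 \<and> kappa x n * e \<ge> 2 + \<eta>"
    using frequently_kappa[OF assms(1) e assms(4)] by blast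
  define D where "D = 100 * C * 2 powr e"
  have key: "real n powr \<eta> \<le> D" if n: "cf_complete x (Suc n) \<ge> 7" "kappa x n * e \<ge> 2 + \<eta>" "n \<ge> 2" for n
  proof -
    define t q where "t = cf_complete x (Suc n)" and "q = real_of_int (cf_den x n)"
    obtain z where z: "Im z > 0" "Im z \<le> 1 / (q\<^sup>2 * t)" "1 / (2 * q\<^sup>2 * t) \<le> Im z"
      "norm (z - of_real x) \<le> 2 * Im z" "Im z * norm (sigser z) \<ge> t / 50"
      using sigser_lower_bound[OF assms(1) n(1)] unfolding t_def q_def by blast
    define y where "y = Im z"
    have y0: "y > 0" using z(1) by (simp add: y_def)
    have t: "t \<ge> 7" using n(1) by (simp add: t_def)
    have q1: "cf_den x n > 1" and qn: "real n \<le> q" using cf_den_ge[OF assms(1), of n] n(3) unfolding q_def by linarith+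
    have q: "q \<ge> 2" using qn n(3) by linarith
    have "2\<^sup>2 * 7 \<le> q\<^sup>2 * t" using q t by (intro mult_mono power_mono) auto
    then have "1 / (q\<^sup>2 * t) \<le> 1 / 8" by (intro divide_left_mono) auto
    then have "norm (sigser z) \<le> C * y powr (\<beta>' - s)" unfolding y_def using z by (intro C(2)) auto
    then have "t / 50 \<le> y * (C * y powr (\<beta>' - s))"
      using z(1,5) mult_left_mono[of "norm (sigser z)" "C * y powr (\<beta>' - s)" y] unfolding y_def by linarith
    also have "\<dots> = C * (y powr 1 * y powr (\<beta>' - s))" using z(1) by (simp add: y_def)
    also have "y powr 1 * y powr (\<beta>' - s) = y powr (e - 1)"
      unfolding powr_add[symmetric] by (simp add: e_def algebra_simps)
    finally have "t / 50 * y \<le> C * y powr (e - 1) * y powr 1" using z(1) unfolding y_def by simp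
    also have "\<dots> = C * y powr e" unfolding mult.assoc powr_add[symmetric] by simp
    finally have ty: "t / 50 * y \<le> C * y powr e" .
    have "1 / (2 * q\<^sup>2) = t * (1 / (2 * q\<^sup>2 * t))" using t by simp
    also have "\<dots> \<le> t * y" using z(3) t unfolding y_def by (intro mult_left_mono) auto
    finally have 1: "1 / (2 * q\<^sup>2) / 50 \<le> C * y powr e" using ty by simp
    have h: "cf_height x n > 0" using cf_height_bounds(3)[OF assms(1), of n] by simp
    have qk: "q powr (kappa x n) = q * cf_height x n" unfolding q_def by (rule kappa_height[OF assms(1) q1])
    have "y \<le> 1 / (q\<^sup>2 * t)" using z(2) by (simp add: y_def)
    also have "\<dots> \<le> 2 / (q * cf_height x n)"
    proof -
      have "q * cf_height x n \<le> q * (2 * q * t)"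
        using cf_height_bounds(2)[OF assms(1), of n] q unfolding q_def t_def by (intro mult_left_mono) auto
      then have "2 / (q * (2 * q * t)) \<le> 2 / (q * cf_height x n)"
        using q h t by (intro divide_left_mono mult_pos_pos) auto
      then show ?thesis by (simp add: power2_eq_square)
    qed
    also have "\<dots> = 2 * q powr (- kappa x n)" unfolding qk[symmetric] powr_minus_divide by simp
    finally have "y powr e \<le> (2 * q powr (- kappa x n)) powr e" using z(1) e unfolding y_def by (intro powr_mono2) auto
    also have "\<dots> = 2 powr e * q powr (- (kappa x n * e))" using q by (simp add: powr_mult powr_powr)
    also have "\<dots> \<le> 2 powr e * q powr (- 2 - \<eta>)" using q n(2) by (intro mult_left_mono powr_mono) auto
    finally have "C * y powr e \<le> C * (2 powr e * q powr (- 2 - \<eta>))" using C(1) by (intro mult_left_mono)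
    with 1 have "1 / (2 * q\<^sup>2) / 50 \<le> C * (2 powr e * q powr (- 2 - \<eta>))" by linarith
    then have "1 / q\<^sup>2 \<le> D * q powr (- 2 - \<eta>)" unfolding D_def by (simp add: mult_ac)
    then have "1 / q\<^sup>2 * q powr (2 + \<eta>) \<le> D * q powr (- 2 - \<eta>) * q powr (2 + \<eta>)" by (intro mult_right_mono) auto
    also have "\<dots> = D" using q by (simp add: mult.assoc flip: powr_add)
    also have "1 / q\<^sup>2 * q powr (2 + \<eta>) = q powr \<eta>" using q by (simp add: powr_add powr_numeral)
    finally have "q powr \<eta> \<le> D" .
    moreover have "real n powr \<eta> \<le> q powr \<eta>" using qn eta by (intro powr_mono2) auto
    ultimately show ?thesis by linarith
  qed
  have "\<forall>\<^sub>F n in sequentially. real n powr \<eta> > D" by (rule eventually_powr_gt[OF eta(1)])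
  with eventually_ge_at_top[of 2] have "\<forall>\<^sub>F n in sequentially. n \<ge> 2 \<and> real n powr \<eta> > D" by eventually_elim auto
  from frequently_eventually_frequently[OF eta(2) this] obtain n
    where "cf_complete x (Suc n) \<ge> 7" "kappa x n * e \<ge> 2 + \<eta>" "n \<ge> 2" "real n powr \<eta> > D"
    by (auto dest: frequently_ex)
  then show False using key[of n] by linarith
qed

theorem theorem6p1:
  fixes s x :: real
  assumes "x \<notin> \<rat>"
    and "ereal s > 2 + 2 / nu x - 2 / mu x"
  shows "holder_exponent (E2 s) x \<ge> ereal s - 2 + 2 / mu x
    \<and> (infinite {n. cf_quot x n \<ge> 7} \<longrightarrow>
         holder_exponent (E2 s) x = ereal s - 2 + 2 / mu x)"
proof -
  note m = nu_bounds[OF assms(1)]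
  \<comment> \<open>Since \<open>nu x \<le> mu x\<close>, the difference
    \<open>2 / nu x - 2 / mu x\<close> is nonnegative. The resulting \<open>s > 2\<close> is
    absolute convergence of the series.\<close>
  have s: "s > 2"
  proof (cases "nu x")
    case (real v)
    then have v: "v \<ge> 2" using m(1) by simp
    show ?thesis
    proof (cases "mu x")
      case (real u)
      with \<open>nu x = ereal v\<close> have "v \<le> u" using m(2) by simp
      then have "2 / u \<le> 2 / v" using v by (intro divide_left_mono) auto
      moreover have "2 + 2 / v - 2 / u < s" using assms(2) v \<open>v \<le> u\<close> unfolding real \<open>nu x = ereal v\<close> by simp
      ultimately show ?thesis by linarith
    next
      case PInf
      have "2 + 2 / v < s" using assms(2) v unfolding PInf real by simp
      moreover have "2 / v > 0" using v by simp
      ultimately show ?thesis by linarith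
    qed (use m in auto)
  next
    case PInf
    then have "mu x = \<infinity>" using m(2) by simp
    then show ?thesis using assms(2) PInf by simp
  qed (use m in auto)
  have lower: "ereal s - 2 + 2 / mu x \<le> holder_exponent (E2 s) x"
  proof (rule dense_le)
    fix w assume w: "w < ereal s - 2 + 2 / mu x"
    then obtain a where a: "w < ereal a" "ereal a < ereal s - 2 + 2 / mu x" using ereal_dense2 by blast
    from holder_at_E2_below[OF assms(1) s a(2)] obtain \<alpha> where \<alpha>: "a < \<alpha>" "0 < \<alpha>" "holder_at (E2 s) \<alpha> x" by blast
    have "w \<le> ereal \<alpha>" using a(1) \<alpha>(1) by (meson ereal_less(2) less_ereal.simps(1) less_imp_le less_trans)
    also have "\<dots> \<le> holder_exponent (E2 s) x"
      unfolding holder_exponent_def by (rule SUP_upper) (use \<alpha> in auto)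
    finally show "w \<le> holder_exponent (E2 s) x" .
  qed
  moreover have "holder_exponent (E2 s) x \<le> ereal s - 2 + 2 / mu x" if "infinite {n. cf_quot x n \<ge> 7}"
    unfolding holder_exponent_def using holder_at_E2_upper[OF assms(1) s _ that] by (intro SUP_least) auto
  ultimately show ?thesis by (auto intro: antisym)
qed

end
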